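(* Let $\Gamma$ be a nonuniform lattice in $G=\mathrm{SL}_2(\mathbf{R})$ that contains $-I$. Let $\Lambda_1,\Lambda_2\subset\mathbf{R}^2$ be (not necessarily distinct) scaled discrete $\Gamma$-orbits, and let $f$ be a bounded semicontinuous function of compact support on $\mathbf{R}^2\times\mathbf{R}^2$. Then $$\int_C\Theta_{\Lambda_1,\Lambda_2;f}(A)\det(A)^2\,dm(A)=c_\Gamma^2\iint_{\mathbf{R}^2\times\mathbf{R}^2}f(\mathbf{x},\mathbf{y})\,d\mathbf{x}\,d\mathbf{y}+\frac{\delta_{\Lambda_1,\Lambda_2}c_\Gamma}{2}\int_{\mathbf{R}^2}\left(f(\mathbf{x},-\mathbf{x})+f(\mathbf{x},\mathbf{x})\right)d\mathbf{x}+c_\Gamma\iint_{\mathbf{R}^2\times\mathbf{R}^2}\Psi(|\mathbf{x}\wedge\mathbf{y}|)f(\mathbf{x},\mathbf{y})\,d\mathbf{x}\,d\mathbf{y},$$ where $|\mathbf{x}\wedge\mathbf{y}|=|\det(\mathbf{x}\,|\,\mathbf{y})|$, $\delta_{\Lambda_1,\Lambda_2}=1$ if $\Lambda_1$ and $\Lambda_2$ are homothetic and is $0$ otherwise, and for $t>0$ $$\Psi(t)=t\sum_{\substack{c\in\mathcal{N}\setminus\{0\}\\ c\ge t}}\frac{\varphi(c)}{c^{3}}-c_\Gamma.$$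
   Context: $\Gamma$ acts linearly on $\mathbf{R}^2$; a discrete $\Gamma$-orbit is an orbit $\Gamma\mathbf{x}$, $\mathbf{x}\ne\mathbf{0}$, that is a discrete subset of $\mathbf{R}^2$. $\mu$ is the $G$-invariant probability measure on $G/\Gamma$. Semicontinuous means lower semicontinuous or upper semicontinuous (real-valued). $V$ is the hyperbolic area of $\Gamma\backslash\mathbf{H}^2$ and $c_\Gamma=\frac{2}{\pi V}$. By Veech's theorem, for each discrete $\Gamma$-orbit $\Lambda$ there is a constant $c_\Lambda>0$ with $\int_{G/\Gamma}\sum_{\mathbf{x}\in\Lambda}h(g\mathbf{x})\,d\mu(g)=c_\Lambda\int_{\mathbf{R}^2}h(\mathbf{x})\,d\mathbf{x}$ for all bounded compactly supported Borel $h$. $\Lambda$ is called scaled if $c_\Lambda=c_\Gamma$. Two orbits are homothetic if they are equal up to multiplication by some $\lambda\ne0$. $C=\{A=\nu^{1/2}g: g\in G/\Gamma,\ \det(A)=\nu\in(0,1]\}$ is equipped with the probability measure $m$ given by $\int_Cf(A)\,dm(A)=\int_0^1\int_{G/\Gamma}f(\nu^{1/2}g)\,d\mu(g)\,d\nu$. For $A\in C$, $\Theta_{\Lambda_1,\Lambda_2;f}(A)=\sum_{\mathbf{x}\in\Lambda_1}\sum_{\mathbf{y}\in\Lambda_2}f(A\mathbf{x},A\mathbf{y})$. $\mathcal{N}=\{\det(\mathbf{x}\,|\,\mathbf{y}):(\mathbf{x},\mathbf{y})\in\Lambda_1\times\Lambda_2\}$. Pairs $(\mathbf{x}_1,\mathbf{y}_1),(\mathbf{x}_2,\mathbf{y}_2)\in\Lambda_1\times\Lambda_2$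 are equivalent if $(\mathbf{x}_1,\mathbf{y}_1)=(\gamma\mathbf{x}_2,\gamma\mathbf{y}_2)$ for some $\gamma\in\Gamma$, and $\varphi(c)$ is the number of equivalence classes of pairs $(\mathbf{x},\mathbf{y})\in\Lambda_1\times\Lambda_2$ with $\det(\mathbf{x}\,|\,\mathbf{y})=c$. *)

theory Defs
  imports "HOL-Probability.Probability_Measure" "HOL-Algebra.Group"
begin

section \<open>The group, its coset spaces and lattices\<close>

definition SL2 :: "(real^2^2) monoid" where
  "SL2 = \<lparr>carrier = {A. det A = 1}, mult = (**), one = mat 1\<rparr>"

abbreviation G :: "(real^2^2) set" where
  "G \<equiv> carrier SL2"

lemma group_SL2: "group SL2"
proof (rule groupI)
  fix A assume A: "A \<in> carrier SL2"
  then have "det A = 1" by (simp add: SL2_def)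
  then have "invertible A" by (simp add: invertible_det_nz)
  then obtain B where B: "A ** B = mat 1" "B ** A = mat 1"
    unfolding invertible_def by blast
  have "det B * det A = 1" using B(2) by (metis det_mul det_I)
  with \<open>det A = 1\<close> have "det B = 1" by simp
  with B show "\<exists>y\<in>carrier SL2. y \<otimes>\<^bsub>SL2\<^esub> A = \<one>\<^bsub>SL2\<^esub>"
    by (auto simp: SL2_def)
qed (auto simp: SL2_def det_mul matrix_mul_assoc)

definition coset :: "(real^2^2) set \<Rightarrow> real^2^2 \<Rightarrow> (real^2^2) set" where
  "coset \<Gamma> A = (\<lambda>\<gamma>. A ** \<gamma>) ` \<Gamma>"

text \<open>For a set \<open>S\<close> of matrices that is stable under right multiplication by \<open>\<Gamma>\<close>,
  the space \<open>S / \<Gamma>\<close> consists of the cosets \<open>A \<Gamma>\<close> with \<open>A \<in> S\<close>; it carries the quotient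
  topology and the corresponding Borel sigma-algebra (as a measure space with the zero measure).
  It is used for \<open>S = G\<close> and for \<open>S = det_cone\<close> below.\<close>

definition coset_topology :: "(real^2^2) set \<Rightarrow> (real^2^2) set \<Rightarrow> (real^2^2) set topology" where
  "coset_topology S \<Gamma> = topology (\<lambda>U. U \<subseteq> coset \<Gamma> ` S \<and>
     openin (top_of_set S) {A \<in> S. coset \<Gamma> A \<in> U})"

lemma openin_coset_topology:
  "openin (coset_topology S \<Gamma>) U \<longleftrightarrow>
     U \<subseteq> coset \<Gamma> ` S \<and> openin (top_of_set S) {A \<in> S. coset \<Gamma> A \<in> U}"
proof -
  have "istopology (\<lambda>U. U \<subseteq> coset \<Gamma> ` S \<and> openin (top_of_set S) {A \<in> S. coset \<Gamma> A \<in> U})"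
    unfolding istopology_def
  proof (intro conjI allI impI)
    fix U V
    assume U: "U \<subseteq> coset \<Gamma> ` S \<and> openin (top_of_set S) {A \<in> S. coset \<Gamma> A \<in> U}"
      and V: "V \<subseteq> coset \<Gamma> ` S \<and> openin (top_of_set S) {A \<in> S. coset \<Gamma> A \<in> V}"
    have eq: "{A \<in> S. coset \<Gamma> A \<in> U \<inter> V} = {A \<in> S. coset \<Gamma> A \<in> U} \<inter> {A \<in> S. coset \<Gamma> A \<in> V}"
      by auto
    show "openin (top_of_set S) {A \<in> S. coset \<Gamma> A \<in> U \<inter> V}"
      using U V by (simp only: eq openin_Int)
    show "U \<inter> V \<subseteq> coset \<Gamma> ` S" using U by auto
  next
    fix \<K>
    assume K: "\<forall>K\<in>\<K>. K \<subseteq> coset \<Gamma> ` S \<and> openin (top_of_set S) {A \<in> S. coset \<Gamma> A \<in> K}"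
    have eq: "{A \<in> S. coset \<Gamma> A \<in> \<Union>\<K>} = (\<Union>K\<in>\<K>. {A \<in> S. coset \<Gamma> A \<in> K})"
      by auto
    show "openin (top_of_set S) {A \<in> S. coset \<Gamma> A \<in> \<Union>\<K>}"
      unfolding eq using K by (intro openin_Union) auto
    show "\<Union>\<K> \<subseteq> coset \<Gamma> ` S" using K by auto
  qed
  then show ?thesis
    unfolding coset_topology_def by (simp add: topology_inverse')
qed

lemma topspace_coset_topology: "topspace (coset_topology S \<Gamma>) = coset \<Gamma> ` S"
proof -
  have eq: "{A \<in> S. coset \<Gamma> A \<in> coset \<Gamma> ` S} = S" by auto
  have "openin (coset_topology S \<Gamma>) (coset \<Gamma> ` S)"
    unfolding openin_coset_topology eq by auto
  then show ?thesis
    by (meson openin_coset_topology openin_subset openin_topspace subset_antisym)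
qed

lemma quotient_map_coset: "quotient_map (top_of_set S) (coset_topology S \<Gamma>) (coset \<Gamma>)"
  unfolding quotient_map_def topspace_coset_topology openin_coset_topology by simp

definition coset_borel :: "(real^2^2) set \<Rightarrow> (real^2^2) set \<Rightarrow> (real^2^2) set measure" where
  "coset_borel S \<Gamma> = sigma (coset \<Gamma> ` S) {U. openin (coset_topology S \<Gamma>) U}"

definition invariant_prob :: "(real^2^2) set \<Rightarrow> (real^2^2) set measure \<Rightarrow> bool" where
  "invariant_prob \<Gamma> \<mu> \<longleftrightarrow> prob_space \<mu> \<and> sets \<mu> = sets (coset_borel G \<Gamma>) \<and>
     (\<forall>g\<in>G. \<forall>E\<in>sets \<mu>. (\<lambda>K. (\<lambda>A. g ** A) ` K) ` E \<in> sets \<mu> \<and>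
        emeasure \<mu> ((\<lambda>K. (\<lambda>A. g ** A) ` K) ` E) = emeasure \<mu> E)"

definition is_lattice :: "(real^2^2) set \<Rightarrow> bool" where
  "is_lattice \<Gamma> \<longleftrightarrow> subgroup \<Gamma> SL2 \<and> discrete \<Gamma> \<and> (\<exists>\<mu>. invariant_prob \<Gamma> \<mu>)"

definition nonuniform :: "(real^2^2) set \<Rightarrow> bool" where
  "nonuniform \<Gamma> \<longleftrightarrow> \<not> compact_space (coset_topology G \<Gamma>)"

section \<open>Hyperbolic area of the quotient\<close>

definition upper_half :: "complex set" where
  "upper_half = {z. Im z > 0}"

definition act :: "real^2^2 \<Rightarrow> complex \<Rightarrow> complex" where
  "act A = moebius (of_real (A$1$1)) (of_real (A$1$2)) (of_real (A$2$1)) (of_real (A$2$2))"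

definition hyp_area :: "complex set \<Rightarrow> ennreal" where
  "hyp_area F = (\<integral>\<^sup>+z\<in>F. ennreal (1 / (Im z)\<^sup>2) \<partial>lborel)"

text \<open>A Borel set of representatives for \<open>\<Gamma> \<backslash> H\<close>. All of these have the same area,
  which is the hyperbolic area of the quotient.\<close>

definition fundamental_set :: "(real^2^2) set \<Rightarrow> complex set \<Rightarrow> bool" where
  "fundamental_set \<Gamma> F \<longleftrightarrow> F \<in> sets borel \<and> F \<subseteq> upper_half \<and>
     (\<forall>z\<in>upper_half. \<exists>!w. w \<in> F \<and> (\<exists>\<gamma>\<in>\<Gamma>. w = act \<gamma> z))"

definition quotient_area :: "(real^2^2) set \<Rightarrow> real" where
  "quotient_area \<Gamma> = enn2real (THE V. \<exists>F. fundamental_set \<Gamma> F \<and> V = hyp_area F)"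

definition c_lat :: "(real^2^2) set \<Rightarrow> real" where
  "c_lat \<Gamma> = 2 / (pi * quotient_area \<Gamma>)"

section \<open>Orbits\<close>

definition discrete_orbit :: "(real^2^2) set \<Rightarrow> (real^2) set \<Rightarrow> bool" where
  "discrete_orbit \<Gamma> \<Lambda> \<longleftrightarrow> (\<exists>x. x \<noteq> 0 \<and> \<Lambda> = (\<lambda>\<gamma>. \<gamma> *v x) ` \<Gamma>) \<and> discrete \<Lambda>"

definition homothetic :: "(real^2) set \<Rightarrow> (real^2) set \<Rightarrow> bool" where
  "homothetic \<Lambda>1 \<Lambda>2 \<longleftrightarrow> (\<exists>r::real. r \<noteq> 0 \<and> \<Lambda>1 = (\<lambda>x. r *\<^sub>R x) ` \<Lambda>2)"

text \<open>The sums over \<open>\<Gamma>\<close>-stable sets below do not depend on the chosen representative.\<close>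

definition rep :: "(real^2^2) set \<Rightarrow> real^2^2" where
  "rep K = (SOME A. A \<in> K)"

definition compact_support :: "('a::topological_space \<Rightarrow> real) \<Rightarrow> bool" where
  "compact_support h \<longleftrightarrow> compact (closure {x. h x \<noteq> 0})"

text \<open>\<open>c\<close> is the constant \<open>c\<^sub>\<Lambda>\<close> in Veech's formula. Convergence is stated explicitly because
  \<open>infsum\<close> and the Bochner integral are \<open>0\<close> when they do not converge.\<close>

definition veech_constant ::
    "(real^2^2) set measure \<Rightarrow> (real^2) set \<Rightarrow> real \<Rightarrow> bool" where
  "veech_constant \<mu> \<Lambda> c \<longleftrightarrow> c > 0 \<and>
     (\<forall>h::real^2 \<Rightarrow> real. h \<in> borel_measurable borel \<and> bounded (range h) \<and> compact_support h \<longrightarrow>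
        (AE K in \<mu>. (\<lambda>x. h (rep K *v x)) summable_on \<Lambda>) \<and>
        integrable \<mu> (\<lambda>K. \<Sum>\<^sub>\<infinity>x\<in>\<Lambda>. h (rep K *v x)) \<and>
        (\<integral>K. (\<Sum>\<^sub>\<infinity>x\<in>\<Lambda>. h (rep K *v x)) \<partial>\<mu>) = c * (\<integral>x. h x \<partial>lborel))"

definition scaled :: "(real^2^2) set \<Rightarrow> (real^2^2) set measure \<Rightarrow> (real^2) set \<Rightarrow> bool" where
  "scaled \<Gamma> \<mu> \<Lambda> \<longleftrightarrow> veech_constant \<mu> \<Lambda> (c_lat \<Gamma>)"

section \<open>The cone C and the theta function\<close>

definition det_cone :: "(real^2^2) set" where
  "det_cone = {A. 0 < det A \<and> det A \<le> 1}"

definition cone_measure ::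
    "(real^2^2) set \<Rightarrow> (real^2^2) set measure \<Rightarrow> (real^2^2) set measure" where
  "cone_measure \<Gamma> \<mu> =
     distr (restrict_space lborel {0<..1::real} \<Otimes>\<^sub>M \<mu>) (coset_borel det_cone \<Gamma>)
       (\<lambda>(\<nu>, K). (\<lambda>g. sqrt \<nu> *\<^sub>R g) ` K)"

definition Theta :: "(real^2) set \<Rightarrow> (real^2) set \<Rightarrow> ((real^2) \<times> (real^2) \<Rightarrow> real) \<Rightarrow>
    (real^2^2) set \<Rightarrow> real" where
  "Theta \<Lambda>1 \<Lambda>2 f K = (\<Sum>\<^sub>\<infinity>(x, y)\<in>\<Lambda>1 \<times> \<Lambda>2. f (rep K *v x, rep K *v y))"

section \<open>Determinants of pairs\<close>

definition wedge :: "real^2 \<Rightarrow> real^2 \<Rightarrow> real" where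
  "wedge x y = det (\<chi> i j. if j = 1 then x$i else y$i)"

lemma wedge_eq: "wedge x y = x$1 * y$2 - y$1 * x$2"
  by (simp add: wedge_def det_2)

definition dets :: "(real^2) set \<Rightarrow> (real^2) set \<Rightarrow> real set" where
  "dets \<Lambda>1 \<Lambda>2 = {wedge x y | x y. x \<in> \<Lambda>1 \<and> y \<in> \<Lambda>2}"

definition pairs_with_det ::
    "(real^2) set \<Rightarrow> (real^2) set \<Rightarrow> real \<Rightarrow> ((real^2) \<times> (real^2)) set" where
  "pairs_with_det \<Lambda>1 \<Lambda>2 c = {(x, y). x \<in> \<Lambda>1 \<and> y \<in> \<Lambda>2 \<and> wedge x y = c}"

definition pair_equiv :: "(real^2^2) set \<Rightarrow> (real^2) set \<Rightarrow> (real^2) set \<Rightarrow>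
    (((real^2) \<times> (real^2)) \<times> ((real^2) \<times> (real^2))) set" where
  "pair_equiv \<Gamma> \<Lambda>1 \<Lambda>2 = {(p, q). p \<in> \<Lambda>1 \<times> \<Lambda>2 \<and> q \<in> \<Lambda>1 \<times> \<Lambda>2 \<and>
     (\<exists>\<gamma>\<in>\<Gamma>. fst p = \<gamma> *v fst q \<and> snd p = \<gamma> *v snd q)}"

definition num_classes ::
    "(real^2^2) set \<Rightarrow> (real^2) set \<Rightarrow> (real^2) set \<Rightarrow> real \<Rightarrow> nat" where
  "num_classes \<Gamma> \<Lambda>1 \<Lambda>2 c = card (pairs_with_det \<Lambda>1 \<Lambda>2 c // pair_equiv \<Gamma> \<Lambda>1 \<Lambda>2)"

definition Psi ::
    "(real^2^2) set \<Rightarrow> (real^2) set \<Rightarrow> (real^2) set \<Rightarrow> real \<Rightarrow> real" where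
  "Psi \<Gamma> \<Lambda>1 \<Lambda>2 t =
     t * (\<Sum>\<^sub>\<infinity>c\<in>{c \<in> dets \<Lambda>1 \<Lambda>2 - {0}. c \<ge> t}. real (num_classes \<Gamma> \<Lambda>1 \<Lambda>2 c) / c ^ 3) - c_lat \<Gamma>"

section \<open>Semicontinuity\<close>

definition lower_semicontinuous :: "('a::topological_space \<Rightarrow> real) \<Rightarrow> bool" where
  "lower_semicontinuous f \<longleftrightarrow> (\<forall>a. open {x. a < f x})"

definition upper_semicontinuous :: "('a::topological_space \<Rightarrow> real) \<Rightarrow> bool" where
  "upper_semicontinuous f \<longleftrightarrow> (\<forall>a. open {x. f x < a})"

end

theory Submission
  imports Defs
begin

text \<open>
  Subtracting the constant \<open>c_lat \<Gamma>\<close> inside \<open>Psi\<close> cancels the first term on the right-hand side, so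
  the pairs of determinant \<open>0\<close> must give the diagonal term and those of determinant \<open>c \<noteq> 0\<close> must give
  \<open>c_lat \<Gamma>\<close> times the integral of \<open>f\<close> against \<open>t \<Sum>\<^sub>c \<phi>(c) / c ^ 3\<close>, \<open>t = \<bar>x \<and> y\<bar>\<close>.

  Two scaled orbits can share a line only if they coincide, and then only through \<open>y = \<plusminus> x\<close>; these pairs
  are handled by Veech's formula. On pairs of determinant \<open>c \<noteq> 0\<close> the group acts freely, so the sum
  over a class is a sum over \<open>\<Gamma>\<close> and unfolds to an integral over \<open>G\<close>; together with the integration
  over the cone this is an integral over the matrices with \<open>\<bar>det\<bar> \<le> \<bar>c\<bar>\<close>. The constant of the
  unfolding is found by applying it to the set of matrices whose inverse carries \<open>i\<close> into a
  fundamental set: this relates it to the hyperbolic area.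

  Convergence comes from the discreteness of the orbits. If a point of a scaled orbit had trivial
  stabilizer, unfolding would make the integral in Veech's formula infinite; a parabolic element
  fixing \<open>x\<close> shears every point close to the line through \<open>x\<close> towards \<open>x\<close>, so the nonzero
  determinants within one orbit are bounded away from \<open>0\<close>. Hence the number of orbit points in a
  disc is \<open>O(1 / det A)\<close>, which bounds the theta function times \<open>det\<^sup>2\<close>.
\<close>

section \<open>Lebesgue measure on matrices\<close>

lemma borel_measurable_fst_snd [measurable (raw)]:
  fixes f :: "'c \<Rightarrow> 'a::second_countable_topology \<times> 'b::second_countable_topology"
  assumes "f \<in> borel_measurable M"
  shows "(\<lambda>x. fst (f x)) \<in> borel_measurable M" "(\<lambda>x. snd (f x)) \<in> borel_measurable M"
  by (rule borel_measurable_continuous_on[OF _ assms], intro continuous_intros)+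

lemma distr_lborel_Basis:
  fixes T :: "'a::euclidean_space \<Rightarrow> 'b::euclidean_space"
  assumes T: "linear T" and bij: "bij_betw T Basis Basis"
  shows "distr lborel borel T = lborel"
proof (rule sym, rule lborel_eqI)
  have cont: "continuous_on UNIV T"
    using T linear_continuous_on linear_conv_bounded_linear by blast
  then have [measurable]: "T \<in> borel_measurable borel"
    by (rule borel_measurable_continuous_onI)
  have TB: "T b \<in> Basis" if "b \<in> Basis" for b
    using bij that by (auto simp: bij_betw_def)
  have img: "T ` Basis = Basis" and inj: "inj_on T Basis"
    using bij by (auto simp: bij_betw_def)
  have coord: "T x \<bullet> T b = x \<bullet> b" if b: "b \<in> Basis" for x b
  proof -
    have "T x = (\<Sum>i\<in>Basis. (x \<bullet> i) *\<^sub>R T i)"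
      by (subst euclidean_representation[of x, symmetric])
         (simp add: linear_sum[OF T] linear_cmul[OF T])
    then have "T x \<bullet> T b = (\<Sum>i\<in>Basis. (x \<bullet> i) * (T i \<bullet> T b))"
      by (simp add: inner_sum_left)
    also have "\<dots> = (\<Sum>i\<in>Basis. if i = b then x \<bullet> i else 0)"
    proof (rule sum.cong)
      fix i :: 'a assume i: "i \<in> Basis"
      have "T i \<bullet> T b = (if T i = T b then 1 else 0)"
        using TB i b by (simp add: inner_Basis)
      then show "(x \<bullet> i) * (T i \<bullet> T b) = (if i = b then x \<bullet> i else 0)"
        using inj i b by (auto simp: inj_on_def)
    qed simp
    finally show ?thesis using b by simp
  qed
  fix l u :: 'b assume le: "\<And>b. b \<in> Basis \<Longrightarrow> l \<bullet> b \<le> u \<bullet> b"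
  let ?p = "\<lambda>v. \<Sum>b\<in>Basis. (v \<bullet> T b) *\<^sub>R b"
  have "T -` box l u = box (?p l) (?p u)"
  proof -
    have "T x \<in> box l u \<longleftrightarrow> (\<forall>b\<in>Basis. l \<bullet> T b < x \<bullet> b \<and> x \<bullet> b < u \<bullet> T b)" for x
    proof -
      have "T x \<in> box l u \<longleftrightarrow> (\<forall>c\<in>T ` Basis. l \<bullet> c < T x \<bullet> c \<and> T x \<bullet> c < u \<bullet> c)"
        unfolding img by (simp add: box_def)
      also have "\<dots> \<longleftrightarrow> (\<forall>b\<in>Basis. l \<bullet> T b < x \<bullet> b \<and> x \<bullet> b < u \<bullet> T b)"
        by (simp add: coord)
      finally show ?thesis .
    qed
    then show ?thesis by (auto simp: box_def)
  qed
  then have "emeasure (distr lborel borel T) (box l u) = emeasure lborel (box (?p l) (?p u))"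
    by (simp add: emeasure_distr)
  also have "\<dots> = ennreal (\<Prod>b\<in>Basis. (?p u - ?p l) \<bullet> b)"
    using le TB by (intro emeasure_lborel_box) simp
  also have "(\<Prod>b\<in>Basis. (?p u - ?p l) \<bullet> b) = (\<Prod>b\<in>Basis. (u - l) \<bullet> T b)"
    by (intro prod.cong) (simp_all add: inner_diff_left)
  also have "\<dots> = (\<Prod>b\<in>T ` Basis. (u - l) \<bullet> b)"
    using inj by (simp add: prod.reindex)
  finally show "emeasure (distr lborel borel T) (box l u) = (\<Prod>b\<in>Basis. (u - l) \<bullet> b)"
    by (simp add: img)
qed simp

lemma nn_integral_lborel_Basis:
  fixes T :: "'a::euclidean_space \<Rightarrow> 'b::euclidean_space"
  assumes "linear T" "bij_betw T Basis Basis" and [measurable]: "F \<in> borel_measurable borel"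
  shows "(\<integral>\<^sup>+x. F (T x) \<partial>lborel) = (\<integral>\<^sup>+y. F y \<partial>lborel)"
proof -
  have [measurable]: "T \<in> borel_measurable borel"
    using assms(1) by (intro borel_measurable_continuous_onI linear_continuous_on)
      (simp add: linear_conv_bounded_linear)
  have "(\<integral>\<^sup>+y. F y \<partial>lborel) = (\<integral>\<^sup>+y. F y \<partial>distr lborel borel T)"
    by (simp add: distr_lborel_Basis assms)
  then show ?thesis by (simp add: nn_integral_distr)
qed

lemma nn_integral_lborel_affine:
  fixes t :: "'a::euclidean_space"
  assumes [measurable]: "F \<in> borel_measurable borel" and c: "c \<noteq> 0"
  shows "(\<integral>\<^sup>+x. F x \<partial>lborel) = ennreal (\<bar>c\<bar> ^ DIM('a)) * (\<integral>\<^sup>+x. F (t + c *\<^sub>R x) \<partial>lborel)"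
  by (subst lborel_affine[OF c, of t])
     (simp add: nn_integral_density nn_integral_distr nn_integral_cmult)

lemma nn_integral_lborel_pair:
  fixes F :: "'a::euclidean_space \<times> 'b::euclidean_space \<Rightarrow> ennreal"
  assumes [measurable]: "F \<in> borel_measurable borel"
  shows "(\<integral>\<^sup>+p. F p \<partial>lborel) = (\<integral>\<^sup>+x. \<integral>\<^sup>+y. F (x, y) \<partial>lborel \<partial>lborel)"
    and "(\<integral>\<^sup>+p. F p \<partial>lborel) = (\<integral>\<^sup>+y. \<integral>\<^sup>+x. F (x, y) \<partial>lborel \<partial>lborel)"
proof -
  have F: "F \<in> borel_measurable (lborel \<Otimes>\<^sub>M lborel)"
    by (simp add: lborel_prod)
  show "(\<integral>\<^sup>+p. F p \<partial>lborel) = (\<integral>\<^sup>+x. \<integral>\<^sup>+y. F (x, y) \<partial>lborel \<partial>lborel)"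
    using lborel.nn_integral_fst[OF F] by (simp add: lborel_prod)
  show "(\<integral>\<^sup>+p. F p \<partial>lborel) = (\<integral>\<^sup>+y. \<integral>\<^sup>+x. F (x, y) \<partial>lborel \<partial>lborel)"
    using lborel_pair.nn_integral_snd[OF F] by (simp add: lborel_prod)
qed

text \<open>The linear map \<open>(x, y) \<mapsto> (a x + c y, b x + d y)\<close> of \<open>V \<times> V\<close> has determinant
  \<open>(a d - b c) ^ dim V\<close>; for \<open>a \<noteq> 0\<close> it is a product of two shears with scalings.\<close>

lemma nn_integral_lborel_pair_linear:
  fixes F :: "'a::euclidean_space \<times> 'a \<Rightarrow> ennreal"
  assumes F[measurable]: "F \<in> borel_measurable borel" and det: "a * d - b * c \<noteq> 0"
  shows "ennreal (\<bar>a * d - b * c\<bar> ^ DIM('a)) *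
      (\<integral>\<^sup>+p. F (a *\<^sub>R fst p + c *\<^sub>R snd p, b *\<^sub>R fst p + d *\<^sub>R snd p) \<partial>lborel) = (\<integral>\<^sup>+p. F p \<partial>lborel)"
proof -
  have *: "ennreal (\<bar>a * d - b * c\<bar> ^ DIM('a)) *
      (\<integral>\<^sup>+p. F (a *\<^sub>R fst p + c *\<^sub>R snd p, b *\<^sub>R fst p + d *\<^sub>R snd p) \<partial>lborel) = (\<integral>\<^sup>+p. F p \<partial>lborel)"
    if a: "a \<noteq> 0" and F[measurable]: "F \<in> borel_measurable borel" and det: "a * d - b * c \<noteq> 0"
    for a b c d and F :: "'a \<times> 'a \<Rightarrow> ennreal"
  proof -
    define e where "e = d - b * c / a"
    have e: "e \<noteq> 0" "a * d - b * c = a * e" using a det by (auto simp: e_def field_simps)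
    have "(\<integral>\<^sup>+p. F p \<partial>lborel) = (\<integral>\<^sup>+x. \<integral>\<^sup>+y. F (x, y) \<partial>lborel \<partial>lborel)"
      by (rule nn_integral_lborel_pair) simp
    also have "\<dots> = (\<integral>\<^sup>+x. ennreal (\<bar>e\<bar> ^ DIM('a)) * (\<integral>\<^sup>+y. F (x, (b/a) *\<^sub>R x + e *\<^sub>R y) \<partial>lborel) \<partial>lborel)"
      using e by (intro nn_integral_cong nn_integral_lborel_affine) auto
    also have "\<dots> = ennreal (\<bar>e\<bar> ^ DIM('a)) * (\<integral>\<^sup>+x. \<integral>\<^sup>+y. F (x, (b/a) *\<^sub>R x + e *\<^sub>R y) \<partial>lborel \<partial>lborel)"
      by (intro nn_integral_cmult) simp
    also have "(\<integral>\<^sup>+x. \<integral>\<^sup>+y. F (x, (b/a) *\<^sub>R x + e *\<^sub>R y) \<partial>lborel \<partial>lborel)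
        = (\<integral>\<^sup>+y. \<integral>\<^sup>+x. F (x, (b/a) *\<^sub>R x + e *\<^sub>R y) \<partial>lborel \<partial>lborel)"
      using lborel_pair.Fubini'[of "\<lambda>x y. F (x, (b/a) *\<^sub>R x + e *\<^sub>R y)"] by simp
    also have "\<dots> = (\<integral>\<^sup>+y. ennreal (\<bar>a\<bar> ^ DIM('a)) *
        (\<integral>\<^sup>+x. F (c *\<^sub>R y + a *\<^sub>R x, (b/a) *\<^sub>R (c *\<^sub>R y + a *\<^sub>R x) + e *\<^sub>R y) \<partial>lborel) \<partial>lborel)"
      using a by (intro nn_integral_cong nn_integral_lborel_affine) auto
    also have "\<dots> = ennreal (\<bar>a\<bar> ^ DIM('a)) *
        (\<integral>\<^sup>+y. \<integral>\<^sup>+x. F (c *\<^sub>R y + a *\<^sub>R x, (b/a) *\<^sub>R (c *\<^sub>R y + a *\<^sub>R x) + e *\<^sub>R y) \<partial>lborel \<partial>lborel)"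
      by (intro nn_integral_cmult) simp
    also have "(\<integral>\<^sup>+y. \<integral>\<^sup>+x. F (c *\<^sub>R y + a *\<^sub>R x, (b/a) *\<^sub>R (c *\<^sub>R y + a *\<^sub>R x) + e *\<^sub>R y) \<partial>lborel \<partial>lborel)
      = (\<integral>\<^sup>+y. \<integral>\<^sup>+x. F (a *\<^sub>R x + c *\<^sub>R y, b *\<^sub>R x + d *\<^sub>R y) \<partial>lborel \<partial>lborel)"
    proof (intro nn_integral_cong arg_cong[where f=F])
      fix x y :: 'a
      have "(b/a) *\<^sub>R (c *\<^sub>R y + a *\<^sub>R x) + e *\<^sub>R y = (b/a * c + e) *\<^sub>R y + (b/a*a) *\<^sub>R x"
        by (simp add: algebra_simps)
      also have "b/a * c + e = d" using a by (auto simp: e_def)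
      also have "b/a*a = b" using a by simp
      finally show "(c *\<^sub>R y + a *\<^sub>R x, (b/a) *\<^sub>R (c *\<^sub>R y + a *\<^sub>R x) + e *\<^sub>R y)
        = (a *\<^sub>R x + c *\<^sub>R y, b *\<^sub>R x + d *\<^sub>R y)" by (simp add: add.commute)
    qed
    also have "\<dots> = (\<integral>\<^sup>+p. F (a *\<^sub>R fst p + c *\<^sub>R snd p, b *\<^sub>R fst p + d *\<^sub>R snd p) \<partial>lborel)"
      by (subst nn_integral_lborel_pair(2)) simp_all
    finally show ?thesis
      unfolding e(2) by (simp add: abs_mult power_mult_distrib ennreal_mult' mult_ac)
  qed
  show ?thesis
  proof (cases "a = 0")
    case False
    then show ?thesis using * F det by blast
  next
    case True
    then have c: "c \<noteq> 0" using det by auto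
    have sw: "(\<integral>\<^sup>+p. H (snd p, fst p) \<partial>lborel) = (\<integral>\<^sup>+p. H p \<partial>lborel)"
      if [measurable]: "H \<in> borel_measurable borel" for H :: "'a \<times> 'a \<Rightarrow> ennreal"
      by (subst nn_integral_lborel_pair(2), simp, subst nn_integral_lborel_pair(1)) simp_all
    have "ennreal (\<bar>c * b - d * a\<bar> ^ DIM('a)) *
      (\<integral>\<^sup>+p. F (c *\<^sub>R fst p + a *\<^sub>R snd p, d *\<^sub>R fst p + b *\<^sub>R snd p) \<partial>lborel) = (\<integral>\<^sup>+p. F p \<partial>lborel)"
      by (rule *[OF c F]) (use det in \<open>simp add: mult.commute\<close>)
    also have "\<bar>c * b - d * a\<bar> = \<bar>a * d - b * c\<bar>" by (simp add: abs_minus_commute mult.commute)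
    also have "(\<integral>\<^sup>+p. F (c *\<^sub>R fst p + a *\<^sub>R snd p, d *\<^sub>R fst p + b *\<^sub>R snd p) \<partial>lborel)
      = (\<integral>\<^sup>+p. F (a *\<^sub>R fst p + c *\<^sub>R snd p, b *\<^sub>R fst p + d *\<^sub>R snd p) \<partial>lborel)"
      by (subst sw[symmetric]) (simp_all add: add.commute)
    finally show ?thesis .
  qed
qed

definition of_cols :: "(real^2) \<times> (real^2) \<Rightarrow> real^2^2" where
  "of_cols p = (\<chi> i j. if j = 1 then fst p $ i else snd p $ i)"

lemma of_cols_nth [simp]: "of_cols p $ i $ 1 = fst p $ i" "of_cols p $ i $ 2 = snd p $ i"
  by (simp_all add: of_cols_def)

lemma mat2_eq_iff: "(A::real^2^2) = B \<longleftrightarrow>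
    A$1$1 = B$1$1 \<and> A$1$2 = B$1$2 \<and> A$2$1 = B$2$1 \<and> A$2$2 = B$2$2"
  by (auto simp: vec_eq_iff forall_2)

lemma mat2_mult_nth: "((A::real^2^2) ** B) $ i $ j = A$i$1 * B$1$j + A$i$2 * B$2$j"
  by (simp add: matrix_matrix_mult_def sum_2)

lemma mat2_vec_nth: "((A::real^2^2) *v x) $ i = A$i$1 * x$1 + A$i$2 * x$2"
  by (simp add: matrix_vector_mult_def sum_2)

lemma wedge_det: "wedge x y = det (of_cols (x, y))"
  by (simp add: wedge_eq det_2)

lemma of_cols_mult: "A ** of_cols p = of_cols (A *v fst p, A *v snd p)"
  by (simp add: mat2_eq_iff mat2_mult_nth mat2_vec_nth)

lemma norm_mat2_le: "norm (A :: real^2^2) \<le> \<bar>A$1$1\<bar> + \<bar>A$1$2\<bar> + \<bar>A$2$1\<bar> + \<bar>A$2$2\<bar>"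
proof -
  have "norm A \<le> (\<Sum>i\<in>UNIV. norm (A $ i))"
    unfolding norm_vec_def by (rule L2_set_le_sum) simp
  also have "\<dots> \<le> (\<Sum>i\<in>UNIV. \<bar>A$i$1\<bar> + \<bar>A$i$2\<bar>)"
  proof (rule sum_mono)
    show "norm (A $ i) \<le> \<bar>A$i$1\<bar> + \<bar>A$i$2\<bar>" for i
      using norm_le_l1_cart[of "A $ i"] by (simp add: sum_2)
  qed
  finally show ?thesis by (simp add: sum_2)
qed

lemma Basis_real2: "(Basis :: (real^2) set) = {axis 1 1, axis 2 1}"
  by (auto simp: Basis_vec_def exhaust_2 UNIV_2)

lemma Basis_mat2: "(Basis :: (real^2^2) set) =
    {axis 1 (axis 1 1), axis 1 (axis 2 1), axis 2 (axis 1 1), axis 2 (axis 2 1)}"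
  by (auto simp: Basis_vec_def exhaust_2 UNIV_2)

lemma bij_betw_of_card_eq: "finite A \<Longrightarrow> card A = card B \<Longrightarrow> T ` A = B \<Longrightarrow> bij_betw T A B"
  by (metis bij_betw_def eq_card_imp_inj_on)

lemma nn_integral_of_cols:
  assumes "F \<in> borel_measurable borel"
  shows "(\<integral>\<^sup>+p. F (of_cols p) \<partial>lborel) = (\<integral>\<^sup>+A. F A \<partial>lborel)"
proof (rule nn_integral_lborel_Basis[OF _ _ assms])
  show "linear of_cols"
    by (intro linearI) (simp_all add: mat2_eq_iff)
  show "bij_betw of_cols Basis Basis"
  proof (rule bij_betw_of_card_eq)
    show "of_cols ` Basis = Basis"
      unfolding Basis_mat2 Basis_prod_def Basis_real2
      by (auto simp: image_iff mat2_eq_iff axis_def insert_commute image_Un)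
  qed (auto)
qed

lemma nn_integral_transpose:
  assumes "F \<in> borel_measurable borel"
  shows "(\<integral>\<^sup>+A. F (transpose A) \<partial>lborel) = (\<integral>\<^sup>+(A::real^2^2). F A \<partial>lborel)"
proof (rule nn_integral_lborel_Basis[OF _ _ assms])
  show "linear (transpose :: real^2^2 \<Rightarrow> _)"
    by (intro linearI) (simp_all add: mat2_eq_iff transpose_def)
  show "bij_betw transpose (Basis::(real^2^2) set) Basis"
  proof (rule bij_betw_of_card_eq)
    have *: "transpose (axis 1 (axis 1 1)) = (axis 1 (axis 1 1) :: real^2^2)"
      "transpose (axis 1 (axis 2 1)) = (axis 2 (axis 1 1) :: real^2^2)"
      "transpose (axis 2 (axis 1 1)) = (axis 1 (axis 2 1) :: real^2^2)"
      "transpose (axis 2 (axis 2 1)) = (axis 2 (axis 2 1) :: real^2^2)"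
      by (simp_all add: mat2_eq_iff transpose_def axis_def)
    show "transpose ` (Basis::(real^2^2) set) = Basis"
      unfolding Basis_mat2 by (auto simp: *)
  qed (auto)
qed

lemma continuous_on_mat_mult [continuous_intros]:
  fixes f g :: "'a::topological_space \<Rightarrow> real^2^2"
  assumes "continuous_on S f" "continuous_on S g"
  shows "continuous_on S (\<lambda>x. f x ** g x)"
  unfolding matrix_matrix_mult_def
  by (intro continuous_intros assms)

lemma continuous_on_mat_vec [continuous_intros]:
  fixes f :: "'a::topological_space \<Rightarrow> real^2^2" and g :: "'a \<Rightarrow> real^2"
  assumes "continuous_on S f" "continuous_on S g"
  shows "continuous_on S (\<lambda>x. f x *v g x)"
  unfolding matrix_vector_mult_def
  by (intro continuous_intros assms)

lemma measurable_mat_mult [measurable (raw)]: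
  fixes f g :: "'a \<Rightarrow> real^2^2"
  assumes "f \<in> borel_measurable M" "g \<in> borel_measurable M"
  shows "(\<lambda>x. f x ** g x) \<in> borel_measurable M"
  by (rule borel_measurable_continuous_Pair[OF assms])
     (auto intro!: continuous_intros continuous_on_fst continuous_on_snd)

lemma measurable_mat_vec [measurable (raw)]:
  fixes f :: "'a \<Rightarrow> real^2^2" and g :: "'a \<Rightarrow> real^2"
  assumes "f \<in> borel_measurable M" "g \<in> borel_measurable M"
  shows "(\<lambda>x. f x *v g x) \<in> borel_measurable M"
  by (rule borel_measurable_continuous_Pair[OF assms])
     (auto intro!: continuous_intros continuous_on_fst continuous_on_snd)

lemma measurable_vec_nth [measurable (raw)]:
  fixes f :: "'a \<Rightarrow> 'b::euclidean_space^'n"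
  assumes "f \<in> borel_measurable M"
  shows "(\<lambda>x. f x $ i) \<in> borel_measurable M"
  by (rule borel_measurable_continuous_on[OF _ assms]) (intro continuous_intros)

lemma measurable_det2 [measurable (raw)]:
  fixes f :: "'a \<Rightarrow> real^2^2"
  assumes [measurable]: "f \<in> borel_measurable M"
  shows "(\<lambda>x. det (f x)) \<in> borel_measurable M"
  unfolding det_2 by simp

lemma continuous_on_of_cols [continuous_intros]:
  assumes "continuous_on S f"
  shows "continuous_on S (\<lambda>x. of_cols (f x))"
  unfolding of_cols_def
proof (intro continuous_on_vec_lambda)
  fix i j :: 2
  show "continuous_on S (\<lambda>x. if j = 1 then fst (f x) $ i else snd (f x) $ i)"
    by (cases "j = 1") (auto intro!: continuous_intros assms)
qed

lemma measurable_of_cols [measurable]: "of_cols \<in> borel_measurable borel"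
  by (intro borel_measurable_continuous_onI continuous_intros)

lemma continuous_on_transpose [continuous_intros]:
  fixes f :: "'a::topological_space \<Rightarrow> real^2^2"
  assumes "continuous_on S f"
  shows "continuous_on S (\<lambda>x. transpose (f x))"
  unfolding transpose_def by (intro continuous_intros assms)

lemma nn_integral_mat_right:
  fixes F :: "real^2^2 \<Rightarrow> ennreal" and M :: "real^2^2"
  assumes F[measurable]: "F \<in> borel_measurable borel" and M: "det M \<noteq> 0"
  shows "ennreal ((det M)\<^sup>2) * (\<integral>\<^sup>+A. F (A ** M) \<partial>lborel) = (\<integral>\<^sup>+A. F A \<partial>lborel)"
proof -
  have "(\<integral>\<^sup>+A. F (A ** M) \<partial>lborel) = (\<integral>\<^sup>+p. F (of_cols p ** M) \<partial>lborel)"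
    by (rule nn_integral_of_cols[symmetric]) simp
  also have "\<dots> = (\<integral>\<^sup>+p. F (of_cols (M$1$1 *\<^sub>R fst p + M$2$1 *\<^sub>R snd p, M$1$2 *\<^sub>R fst p + M$2$2 *\<^sub>R snd p)) \<partial>lborel)"
    by (intro nn_integral_cong arg_cong[where f=F])
       (simp add: mat2_eq_iff mat2_mult_nth mult.commute)
  finally have "ennreal ((det M)\<^sup>2) * (\<integral>\<^sup>+A. F (A ** M) \<partial>lborel) = (\<integral>\<^sup>+p. F (of_cols p) \<partial>lborel)"
    using nn_integral_lborel_pair_linear[of "\<lambda>p. F (of_cols p)" "M$1$1" "M$2$2" "M$1$2" "M$2$1"] M
    by (simp add: det_2)
  then show ?thesis by (simp add: nn_integral_of_cols)
qed

lemma nn_integral_mat_left: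
  fixes F :: "real^2^2 \<Rightarrow> ennreal" and M :: "real^2^2"
  assumes F[measurable]: "F \<in> borel_measurable borel" and M: "det M \<noteq> 0"
  shows "ennreal ((det M)\<^sup>2) * (\<integral>\<^sup>+A. F (M ** A) \<partial>lborel) = (\<integral>\<^sup>+A. F A \<partial>lborel)"
proof -
  have [measurable]: "transpose \<in> borel_measurable (borel :: (real^2^2) measure)"
    by (intro borel_measurable_continuous_onI continuous_intros)
  have "(\<integral>\<^sup>+A. F (M ** A) \<partial>lborel) = (\<integral>\<^sup>+A. F (M ** transpose A) \<partial>lborel)"
    by (rule nn_integral_transpose[symmetric]) simp
  also have "\<dots> = (\<integral>\<^sup>+A. F (transpose (A ** transpose M)) \<partial>lborel)"
    by (simp add: matrix_transpose_mul)
  finally show ?thesis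
    using nn_integral_mat_right[of "\<lambda>A. F (transpose A)" "transpose M"] M
    by (simp add: nn_integral_transpose)
qed

definition adj :: "real^2^2 \<Rightarrow> real^2^2" where
  "adj A = (\<chi> i j. if i = 1 then (if j = 1 then A$2$2 else - A$1$2)
                   else (if j = 1 then - A$2$1 else A$1$1))"

lemma adj_nth [simp]: "adj A $ 1 $ 1 = A$2$2" "adj A $ 1 $ 2 = - A$1$2"
  "adj A $ 2 $ 1 = - A$2$1" "adj A $ 2 $ 2 = A$1$1"
  by (simp_all add: adj_def)

lemma det_adj [simp]: "det (adj A) = det A"
  by (simp add: det_2)

lemma mult_adj: "A ** adj A = det A *\<^sub>R mat 1" "adj A ** A = det A *\<^sub>R mat 1"
  by (simp_all add: mat2_eq_iff mat2_mult_nth det_2 mat_def)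

lemma adj_mult: "adj (A ** B) = adj B ** adj A"
  by (simp add: mat2_eq_iff mat2_mult_nth)

lemma adj_adj [simp]: "adj (adj A) = A"
  by (simp add: mat2_eq_iff)

lemma continuous_on_adj: "continuous_on S adj"
proof -
  have "continuous_on S (\<lambda>A::real^2^2. (\<chi> i j. if i = 1 then (if j = 1 then A$2$2 else - A$1$2)
                   else (if j = 1 then - A$2$1 else A$1$1)) :: real^2^2)"
  proof (intro continuous_on_vec_lambda)
    fix i j :: 2
    show "continuous_on S (\<lambda>A::real^2^2. if i = 1 then (if j = 1 then A$2$2 else - A$1$2)
                   else (if j = 1 then - A$2$1 else A$1$1))"
      by (cases "i = 1"; cases "j = 1") (auto intro!: continuous_intros)
  qed
  then show ?thesis by (simp add: adj_def[abs_def])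
qed

lemma measurable_adj [measurable]: "adj \<in> borel_measurable borel"
  by (intro borel_measurable_continuous_onI continuous_on_adj)

lemma nn_integral_adj:
  fixes F :: "real^2^2 \<Rightarrow> ennreal"
  assumes F[measurable]: "F \<in> borel_measurable borel"
  shows "(\<integral>\<^sup>+A. F (adj A) \<partial>lborel) = (\<integral>\<^sup>+A. F A \<partial>lborel)"
proof -
  define J :: "real^2^2" where "J = of_cols (axis 2 1, - axis 1 1)"
  define K :: "real^2^2" where "K = of_cols (- axis 2 1, axis 1 1)"
  have J: "det J = 1" "det K = 1" by (simp_all add: J_def K_def det_2 axis_def)
  have [measurable]: "transpose \<in> borel_measurable (borel :: (real^2^2) measure)"
    by (intro borel_measurable_continuous_onI continuous_intros)
  have "adj A = K ** transpose A ** J" for A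
    by (simp add: mat2_eq_iff mat2_mult_nth J_def K_def axis_def transpose_def)
  then have "(\<integral>\<^sup>+A. F (adj A) \<partial>lborel) = (\<integral>\<^sup>+A. F (K ** transpose A ** J) \<partial>lborel)" by simp
  also have "\<dots> = (\<integral>\<^sup>+A. F (K ** A ** J) \<partial>lborel)"
    by (rule nn_integral_transpose) simp
  also have "\<dots> = (\<integral>\<^sup>+A. F (A ** J) \<partial>lborel)"
    using nn_integral_mat_left[of "\<lambda>A. F (A ** J)" K] J by simp
  also have "\<dots> = (\<integral>\<^sup>+A. F A \<partial>lborel)"
    using nn_integral_mat_right[of "\<lambda>A. F A" J] J by simp
  finally show ?thesis .
qed

section \<open>Polar decomposition of Lebesgue measure\<close>

lemma nn_integral_inverse_cube:
  assumes D: "D > (0::real)"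
  shows "(\<integral>\<^sup>+r. ennreal (1 / r ^ 3) * indicator {D..} r \<partial>lborel) = ennreal (1 / (2 * D\<^sup>2))"
proof -
  have "(\<integral>\<^sup>+r. ennreal (1 / r ^ 3) * indicator {D..} r \<partial>lborel) = 0 - (- 1 / (2 * D\<^sup>2))"
  proof (rule nn_integral_FTC_atLeast)
    fix x assume x: "D \<le> x"
    then have "x > 0" using D by simp
    then show "((\<lambda>x. - 1 / (2 * x\<^sup>2)) has_real_derivative 1 / x ^ 3) (at x)"
      by (auto intro!: derivative_eq_intros simp: power2_eq_square power3_eq_cube divide_simps)
    show "0 \<le> 1 / x ^ 3" using \<open>x > 0\<close> by simp
  next
    show "((\<lambda>x::real. - 1 / (2 * x\<^sup>2)) \<longlongrightarrow> 0) at_top"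
      by (intro tendsto_divide_0 tendsto_const filterlim_at_top_imp_at_infinity
          filterlim_tendsto_pos_mult_at_top[of _ 2] filterlim_pow_at_top filterlim_ident) auto
  qed simp
  then show ?thesis by simp
qed

definition normalize_det :: "real^2^2 \<Rightarrow> real^2^2" where
  "normalize_det A = (1 / sqrt (det A)) *\<^sub>R A"

lemma det_scaleR2: "det (c *\<^sub>R (A::real^2^2)) = c\<^sup>2 * det A"
  by (simp add: det_2 power2_eq_square algebra_simps)

lemma det_normalize: "det A > 0 \<Longrightarrow> det (normalize_det A) = 1"
  by (simp add: normalize_det_def det_scaleR2 power_divide)

lemma normalize_scaleR:
  assumes "c > 0" shows "normalize_det (c *\<^sub>R A) = normalize_det A"
  using assms by (simp add: normalize_det_def det_scaleR2 real_sqrt_mult)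

lemma normalize_mult: "det B = 1 \<Longrightarrow> normalize_det (A ** B) = normalize_det A ** B"
  by (simp add: normalize_det_def det_mul mat2_eq_iff mat2_mult_nth add_divide_distrib)

lemma measurable_normalize [measurable]: "normalize_det \<in> borel_measurable borel"
  unfolding normalize_det_def[abs_def] by simp

text \<open>Multiplicative convolution of \<open>\<psi>\<close> with the window \<open>det A \<le> 1\<close>, computed in two ways, avoids
  identifying the distribution of the determinant separately: after the substitution \<open>t = r det A\<close>
  and the scaling of \<open>A\<close> by \<open>r powr (- 1 / 2)\<close> only the integral of \<open>1 / r ^ 3\<close> remains.\<close>

lemma nn_integral_det:
  fixes H :: "real^2^2 \<Rightarrow> ennreal" and \<psi> :: "real \<Rightarrow> ennreal"
  assumes [measurable]: "H \<in> borel_measurable borel" "\<psi> \<in> borel_measurable borel"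
  shows "(\<integral>\<^sup>+A. indicator {0<..} (det A) * H (normalize_det A) * \<psi> (det A) \<partial>lborel) =
    2 * (\<integral>\<^sup>+A. indicator {0<..1} (det A) * H (normalize_det A) \<partial>lborel) *
        (\<integral>\<^sup>+t. indicator {0<..} t * ennreal t * \<psi> t \<partial>lborel)"
proof -
  define h where "h A = indicator {0<..} (det A) * H (normalize_det A)" for A
  have [measurable]: "h \<in> borel_measurable borel" by (simp add: h_def[abs_def])
  have h_scale: "h (c *\<^sub>R A) = h A" if "c > 0" for c A
    using that by (simp add: h_def normalize_scaleR det_scaleR2 indicator_def zero_less_mult_iff)
  have h0: "h A = 0" if "det A \<le> 0" for A using that by (simp add: h_def)
  let ?C = "\<integral>\<^sup>+A. h A * indicator {..1} (det A) \<partial>lborel"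
  let ?T = "\<integral>\<^sup>+t. indicator {0<..} t * ennreal t * \<psi> t \<partial>lborel"
  have sub: "?T = (\<integral>\<^sup>+r. indicator {0<..} r * ennreal (D\<^sup>2 * r) * \<psi> (D * r) \<partial>lborel)"
    if D: "D > 0" for D :: real
  proof -
    have "?T = ennreal D * (\<integral>\<^sup>+r. indicator {0<..} (D * r) * ennreal (D * r) * \<psi> (D * r) \<partial>lborel)"
      using nn_integral_real_affine[of "\<lambda>t. indicator {0<..} t * ennreal t * \<psi> t" D 0] D by simp
    also have "\<dots> = (\<integral>\<^sup>+r. ennreal D * (indicator {0<..} (D * r) * ennreal (D * r) * \<psi> (D * r)) \<partial>lborel)"
      by (rule nn_integral_cmult[symmetric]) simp
    also have "\<dots> = (\<integral>\<^sup>+r. indicator {0<..} r * ennreal (D\<^sup>2 * r) * \<psi> (D * r) \<partial>lborel)"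
      using D by (intro nn_integral_cong)
        (auto simp: indicator_def zero_less_mult_iff power2_eq_square ennreal_mult mult_ac)
    finally show ?thesis .
  qed
  have "?C * ?T = (\<integral>\<^sup>+A. h A * indicator {..1} (det A) * ?T \<partial>lborel)"
    by (rule nn_integral_multc[symmetric]) simp
  also have "\<dots> = (\<integral>\<^sup>+A. \<integral>\<^sup>+r. h A * indicator {..1} (det A) *
      (indicator {0<..} r * ennreal ((det A)\<^sup>2 * r) * \<psi> (det A * r)) \<partial>lborel \<partial>lborel)"
  proof (rule nn_integral_cong)
    fix A :: "real^2^2"
    show "h A * indicator {..1} (det A) * ?T = (\<integral>\<^sup>+r. h A * indicator {..1} (det A) *
      (indicator {0<..} r * ennreal ((det A)\<^sup>2 * r) * \<psi> (det A * r)) \<partial>lborel)"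
    proof (cases "det A > 0")
      case True
      show ?thesis unfolding sub[OF True] by (rule nn_integral_cmult[symmetric]) simp
    qed (simp add: h0)
  qed
  also have "\<dots> = (\<integral>\<^sup>+r. \<integral>\<^sup>+A. h A * indicator {..1} (det A) *
      (indicator {0<..} r * ennreal ((det A)\<^sup>2 * r) * \<psi> (det A * r)) \<partial>lborel \<partial>lborel)"
    by (rule lborel_pair.Fubini'[symmetric]) simp
  also have "\<dots> = (\<integral>\<^sup>+r. \<integral>\<^sup>+A. h A * \<psi> (det A) * ennreal ((det A)\<^sup>2) *
      (ennreal (1 / r ^ 3) * indicator {det A..} r) \<partial>lborel \<partial>lborel)"
  proof (rule nn_integral_cong)
    fix r :: real
    show "(\<integral>\<^sup>+A. h A * indicator {..1} (det A) *
      (indicator {0<..} r * ennreal ((det A)\<^sup>2 * r) * \<psi> (det A * r)) \<partial>lborel)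
      = (\<integral>\<^sup>+A. h A * \<psi> (det A) * ennreal ((det A)\<^sup>2) *
      (ennreal (1 / r ^ 3) * indicator {det A..} r) \<partial>lborel)" (is "(\<integral>\<^sup>+A. ?f A \<partial>lborel) = (\<integral>\<^sup>+A. ?g A \<partial>lborel)")
    proof (cases "r > 0")
      case False
      have g: "?g A = 0" for A using False h0[of A] by (cases "det A > 0") auto
      have f: "?f A = 0" for A using False by auto
      show ?thesis by (intro nn_integral_cong) (rule trans[OF f g[symmetric]])
    next
      case r: True
      have "(\<integral>\<^sup>+A. ?f A \<partial>lborel) = ennreal (1 / r\<^sup>2) * (\<integral>\<^sup>+A. ?f ((1 / sqrt r) *\<^sub>R A) \<partial>lborel)"
      proof -
        have "\<bar>1 / sqrt r\<bar> ^ DIM(real^2^2) = ((1 / sqrt r)\<^sup>2)\<^sup>2"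
          using r by (simp add: abs_of_pos)
        also have "\<dots> = 1 / r\<^sup>2" using r by (simp add: power_divide)
        finally show ?thesis
          using nn_integral_lborel_affine[of ?f "1 / sqrt r" 0] r by simp
      qed
      also have "\<dots> = (\<integral>\<^sup>+A. ennreal (1 / r\<^sup>2) * ?f ((1 / sqrt r) *\<^sub>R A) \<partial>lborel)"
        by (rule nn_integral_cmult[symmetric]) simp
      also have "\<dots> = (\<integral>\<^sup>+A. ?g A \<partial>lborel)"
      proof (rule nn_integral_cong)
        fix A :: "real^2^2"
        have d: "det ((1 / sqrt r) *\<^sub>R A) = det A / r" 
          using r by (simp add: det_scaleR2 power_divide)
        have e: "ennreal (1 / r\<^sup>2) * ennreal ((det A / r)\<^sup>2 * r) = ennreal ((det A)\<^sup>2) * ennreal (1 / r ^ 3)"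
          using r by (simp add: ennreal_mult'[symmetric] power2_eq_square power3_eq_cube)
        have "ennreal (1 / r\<^sup>2) * ?f ((1 / sqrt r) *\<^sub>R A)
          = h A * indicator {..1} (det A / r) * (ennreal (1 / r\<^sup>2) * ennreal ((det A / r)\<^sup>2 * r)) * \<psi> (det A)"
          unfolding d using r h_scale[of "1 / sqrt r" A] by (simp add: mult_ac)
        also have "\<dots> = ?g A"
          unfolding e using r by (auto simp: indicator_def divide_simps mult_ac)
        finally show "ennreal (1 / r\<^sup>2) * ?f ((1 / sqrt r) *\<^sub>R A) = ?g A" .
      qed
      finally show ?thesis .
    qed
  qed
  also have "\<dots> = (\<integral>\<^sup>+A. \<integral>\<^sup>+r. h A * \<psi> (det A) * ennreal ((det A)\<^sup>2) *
      (ennreal (1 / r ^ 3) * indicator {det A..} r) \<partial>lborel \<partial>lborel)"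
  proof (rule lborel_pair.Fubini')
    have "(\<lambda>(A, r). h A * \<psi> (det A) * ennreal ((det A)\<^sup>2) * (ennreal (1 / r ^ 3) * indicator {det A..} r))
      = (\<lambda>(A, r). h A * \<psi> (det A) * ennreal ((det A)\<^sup>2) * (ennreal (1 / r ^ 3) * (if det A \<le> r then 1 else 0)))"
      by (auto simp: fun_eq_iff)
    then show "(\<lambda>(A, r). h A * \<psi> (det A) * ennreal ((det A)\<^sup>2) * (ennreal (1 / r ^ 3) * indicator {det A..} r))
      \<in> borel_measurable (lborel \<Otimes>\<^sub>M lborel)" by simp
  qed
  also have "\<dots> = (\<integral>\<^sup>+A. ennreal (1/2) * (h A * \<psi> (det A)) \<partial>lborel)"
  proof (rule nn_integral_cong)
    fix A :: "real^2^2"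
    show "(\<integral>\<^sup>+r. h A * \<psi> (det A) * ennreal ((det A)\<^sup>2) * (ennreal (1 / r ^ 3) * indicator {det A..} r) \<partial>lborel)
      = ennreal (1/2) * (h A * \<psi> (det A))"
    proof (cases "det A > 0")
      case True
      have "ennreal ((det A)\<^sup>2) * ennreal (1 / (2 * (det A)\<^sup>2)) = ennreal (1/2)"
        using True by (simp add: ennreal_mult'[symmetric])
      moreover have "(\<integral>\<^sup>+r. h A * \<psi> (det A) * ennreal ((det A)\<^sup>2) * (ennreal (1 / r ^ 3) * indicator {det A..} r) \<partial>lborel)
        = h A * \<psi> (det A) * ennreal ((det A)\<^sup>2) * (\<integral>\<^sup>+r. ennreal (1 / r ^ 3) * indicator {det A..} r \<partial>lborel)"
        by (rule nn_integral_cmult) simp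
      ultimately show ?thesis
        using nn_integral_inverse_cube[OF True] by (simp add: mult_ac)
    qed (simp add: h0)
  qed
  also have "\<dots> = ennreal (1/2) * (\<integral>\<^sup>+A. h A * \<psi> (det A) \<partial>lborel)"
    by (rule nn_integral_cmult) simp
  finally have "2 * (?C * ?T) = (2 * ennreal (1/2)) * (\<integral>\<^sup>+A. h A * \<psi> (det A) \<partial>lborel)"
    by (simp add: mult.assoc)
  also have "2 * ennreal (1/2) = 1"
    using ennreal_mult'[of 2 "1/2"] by simp
  also have "?C = (\<integral>\<^sup>+A. indicator {0<..1} (det A) * H (normalize_det A) \<partial>lborel)"
    by (intro nn_integral_cong) (auto simp: h_def indicator_def)
  finally show ?thesis by (simp add: h_def mult.assoc)
qed

section \<open>Lebesgue measure and hyperbolic area\<close>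

lemma nn_integral_complex_mult:
  assumes [measurable]: "F \<in> borel_measurable borel" and z: "\<zeta> \<noteq> 0"
  shows "(\<integral>\<^sup>+w. F w \<partial>lborel) = ennreal ((cmod \<zeta>)\<^sup>2) * (\<integral>\<^sup>+z. F (\<zeta> * z) \<partial>lborel)"
proof -
  let ?c = "\<lambda>p. Complex (fst p) (snd p)"
  have c: "(\<integral>\<^sup>+p. K (?c p) \<partial>lborel) = (\<integral>\<^sup>+z. K z \<partial>lborel)" if "K \<in> borel_measurable borel" for K :: "complex \<Rightarrow> ennreal"
  proof (rule nn_integral_lborel_Basis[OF _ _ that])
    show "linear ?c" by (intro linearI) (auto simp: complex_eq_iff)
    show "bij_betw ?c Basis Basis"
      by (rule bij_betw_of_card_eq) (auto simp: Basis_complex_def Basis_prod_def complex_eq_iff)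
  qed
  have [measurable]: "?c \<in> borel_measurable borel"
    unfolding Complex_eq by (intro borel_measurable_continuous_onI continuous_intros)
  have n: "(cmod \<zeta>)\<^sup>2 = \<bar>Re \<zeta> * Re \<zeta> - Im \<zeta> * (- Im \<zeta>)\<bar> ^ DIM(real)"
    unfolding cmod_power2 by (simp add: power2_eq_square)
  have "ennreal ((cmod \<zeta>)\<^sup>2) * (\<integral>\<^sup>+z. F (\<zeta> * z) \<partial>lborel) = 
     ennreal ((cmod \<zeta>)\<^sup>2) * (\<integral>\<^sup>+p. F (\<zeta> * ?c p) \<partial>lborel)"
    by (subst c[of "\<lambda>z. F (\<zeta> * z)"]) simp_all
  also have "(\<integral>\<^sup>+p. F (\<zeta> * ?c p) \<partial>lborel) =
     (\<integral>\<^sup>+p. F (?c (Re \<zeta> *\<^sub>R fst p + (- Im \<zeta>) *\<^sub>R snd p, Im \<zeta> *\<^sub>R fst p + Re \<zeta> *\<^sub>R snd p)) \<partial>lborel)"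
    by (intro nn_integral_cong arg_cong[where f=F]) (simp add: complex_eq_iff)
  also have "ennreal ((cmod \<zeta>)\<^sup>2) * \<dots> = (\<integral>\<^sup>+p. F (?c p) \<partial>lborel)"
    unfolding n using z
    by (intro nn_integral_lborel_pair_linear[of "\<lambda>p. F (?c p)"])
      (auto simp: complex_eq_iff simp flip: power2_eq_square)
  also have "\<dots> = (\<integral>\<^sup>+w. F w \<partial>lborel)" by (rule c) simp
  finally show ?thesis ..
qed

lemma nn_integral_disc_norm_square:
  assumes R: "R > 0"
  shows "(\<integral>\<^sup>+\<zeta>. ennreal ((cmod \<zeta>)\<^sup>2) * indicator {..R} ((cmod \<zeta>)\<^sup>2) \<partial>lborel) = ennreal (pi / 2 * R\<^sup>2)"
proof -
  let ?I = "\<lambda>(\<zeta>::complex) s. if 0 \<le> s \<and> s < (cmod \<zeta>)\<^sup>2 \<and> (cmod \<zeta>)\<^sup>2 \<le> R then 1 else 0 :: ennreal"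
  have "(\<integral>\<^sup>+\<zeta>. ennreal ((cmod \<zeta>)\<^sup>2) * indicator {..R} ((cmod \<zeta>)\<^sup>2) \<partial>lborel)
    = (\<integral>\<^sup>+\<zeta>. \<integral>\<^sup>+s. ?I \<zeta> s \<partial>lborel \<partial>lborel)"
  proof (rule nn_integral_cong)
    fix \<zeta> :: complex
    have "(\<integral>\<^sup>+s. ?I \<zeta> s \<partial>lborel) = (\<integral>\<^sup>+s. indicator {..R} ((cmod \<zeta>)\<^sup>2) * indicator {0..<(cmod \<zeta>)\<^sup>2} s \<partial>lborel)"
      by (intro nn_integral_cong) (auto simp: indicator_def)
    then show "ennreal ((cmod \<zeta>)\<^sup>2) * indicator {..R} ((cmod \<zeta>)\<^sup>2) = (\<integral>\<^sup>+s. ?I \<zeta> s \<partial>lborel)"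
      by (simp add: nn_integral_cmult mult.commute)
  qed
  also have "\<dots> = (\<integral>\<^sup>+s. \<integral>\<^sup>+\<zeta>. ?I \<zeta> s \<partial>lborel \<partial>lborel)"
    by (rule lborel_pair.Fubini'[symmetric]) simp
  also have "\<dots> = (\<integral>\<^sup>+s. ennreal (pi * (R - s)) * indicator {0..R} s \<partial>lborel)"
  proof (rule nn_integral_cong)
    fix s :: real
    show "(\<integral>\<^sup>+\<zeta>. ?I \<zeta> s \<partial>lborel) = ennreal (pi * (R - s)) * indicator {0..R} s"
    proof (cases "0 \<le> s \<and> s \<le> R")
      case True
      have cb: "emeasure lborel (cball (0::complex) (sqrt r)) = ennreal (pi * r)" if "r \<ge> 0" for r
        using emeasure_cball[of "sqrt r" "0::complex"] that by (simp add: unit_ball_vol_numeral eval_unit_ball_vol)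
      have "(\<integral>\<^sup>+\<zeta>. ?I \<zeta> s \<partial>lborel) = (\<integral>\<^sup>+\<zeta>. indicator (cball (0::complex) (sqrt R) - cball 0 (sqrt s)) \<zeta> \<partial>lborel)"
      proof (rule nn_integral_cong)
        fix \<zeta> :: complex
        have "s < (cmod \<zeta>)\<^sup>2 \<longleftrightarrow> sqrt s < cmod \<zeta>" "(cmod \<zeta>)\<^sup>2 \<le> R \<longleftrightarrow> cmod \<zeta> \<le> sqrt R"
          using real_sqrt_less_iff[of s "(cmod \<zeta>)\<^sup>2"] real_sqrt_le_iff[of "(cmod \<zeta>)\<^sup>2" R] by simp_all
        then show "?I \<zeta> s = indicator (cball (0::complex) (sqrt R) - cball 0 (sqrt s)) \<zeta>"
          using True by (auto simp: indicator_def)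
      qed
      also have "\<dots> = emeasure lborel (cball (0::complex) (sqrt R)) - emeasure lborel (cball (0::complex) (sqrt s))"
        using True cb[of s] emeasure_Diff[of lborel "cball (0::complex) (sqrt s)" "cball (0::complex) (sqrt R)"]
        by (simp add: cball_subset_cball_iff)
      also have "\<dots> = ennreal (pi * (R - s))"
        using True by (simp add: cb ennreal_minus right_diff_distrib)
      finally show ?thesis using True by simp
    next
      case False
      then have "?I \<zeta> s = 0" for \<zeta> by auto
      then show ?thesis using False by simp
    qed
  qed
  also have "\<dots> = ennreal (pi * (R * R - R\<^sup>2 / 2) - pi * (R * 0 - 0\<^sup>2 / 2))"
    by (rule nn_integral_FTC_Icc)
       (use R in \<open>auto intro!: derivative_eq_intros simp: algebra_simps\<close>)
  also have "pi * (R * R - R\<^sup>2 / 2) - pi * (R * 0 - 0\<^sup>2 / 2) = pi / 2 * R\<^sup>2"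
    by (simp add: power2_eq_square field_simps)
  finally show ?thesis .
qed

lemma act_eq: "act A z = (of_real (A$1$1) * z + of_real (A$1$2)) / (of_real (A$2$1) * z + of_real (A$2$2))"
  by (simp add: act_def moebius_def)

lemma measurable_act [measurable (raw)]:
  assumes [measurable]: "f \<in> borel_measurable M" "g \<in> borel_measurable M"
  shows "(\<lambda>x. act (f x) (g x)) \<in> borel_measurable M"
  unfolding act_eq by measurable

text \<open>In the coordinates \<open>(z, \<zeta>)\<close> in which \<open>A\<close> has the rows \<open>Im, Re\<close> of \<open>z \<zeta>\<close> and of
  \<open>\<zeta>\<close>, one has \<open>A i = z\<close> and \<open>det A = \<bar>\<zeta>\<bar>\<^sup>2 Im z\<close>.\<close>

lemma nn_integral_act_imaginary_unit:
  assumes F[measurable]: "F \<in> sets borel" and sub: "F \<subseteq> upper_half"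
  shows "(\<integral>\<^sup>+A. indicator {0<..1} (det A) * indicator F (act A \<i>) \<partial>lborel) = ennreal (pi / 2) * hyp_area F"
proof -
  define T :: "complex \<times> complex \<Rightarrow> real^2^2" where
    "T p = (\<chi> i j. if j = 1 then (if i = 1 then Im (fst p) else Im (snd p)) else
                    (if i = 1 then Re (fst p) else Re (snd p)))" for p
  have T: "T p $ 1 $ 1 = Im (fst p)" "T p $ 1 $ 2 = Re (fst p)" "T p $ 2 $ 1 = Im (snd p)" "T p $ 2 $ 2 = Re (snd p)" for p
    by (simp_all add: T_def)
  have bas: "T ` Basis = Basis"
  proof -
    have B: "(Basis :: (complex \<times> complex) set) = {(1, 0), (\<i>, 0), (0, 1), (0, \<i>)}"
      by (auto simp: Basis_prod_def Basis_complex_def)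
    have "T (1, 0) = axis 1 (axis 2 1)" "T (\<i>, 0) = axis 1 (axis 1 1)"
      "T (0, 1) = axis 2 (axis 2 1)" "T (0, \<i>) = axis 2 (axis 1 1)"
      by (simp_all add: mat2_eq_iff T axis_def)
    then show ?thesis unfolding Basis_mat2 B by (simp add: insert_commute)
  qed
  have lin: "linear T" by (intro linearI) (simp_all add: mat2_eq_iff T)
  then have [measurable]: "T \<in> borel_measurable borel"
    by (intro borel_measurable_continuous_onI linear_continuous_on) (simp add: linear_conv_bounded_linear)
  have act_T: "act (T (w, \<zeta>)) \<i> = w / \<zeta>" for w \<zeta>
  proof -
    have "of_real (Im w) * \<i> + of_real (Re w) = w" for w
      by (simp add: complex_eq_iff)
    then show ?thesis by (simp add: act_eq T)
  qed
  let ?f = "\<lambda>A. indicator {0<..1} (det A) * indicator F (act A \<i>) :: ennreal"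
  have [measurable]: "?f \<in> borel_measurable borel" by measurable
  have "(\<integral>\<^sup>+A. ?f A \<partial>lborel) = (\<integral>\<^sup>+p. ?f (T p) \<partial>lborel)"
    by (rule nn_integral_lborel_Basis[symmetric, OF lin]) (use bas in \<open>auto intro!: bij_betw_of_card_eq\<close>)
  also have "\<dots> = (\<integral>\<^sup>+\<zeta>. \<integral>\<^sup>+w. ?f (T (w, \<zeta>)) \<partial>lborel \<partial>lborel)"
    by (rule nn_integral_lborel_pair(2)) measurable
  also have "\<dots> = (\<integral>\<^sup>+\<zeta>. \<integral>\<^sup>+z. ennreal ((cmod \<zeta>)\<^sup>2) * (indicator {0<..1} ((cmod \<zeta>)\<^sup>2 * Im z) * indicator F z) \<partial>lborel \<partial>lborel)"
  proof (rule nn_integral_cong)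
    fix \<zeta> :: complex
    show "(\<integral>\<^sup>+w. ?f (T (w, \<zeta>)) \<partial>lborel) =
      (\<integral>\<^sup>+z. ennreal ((cmod \<zeta>)\<^sup>2) * (indicator {0<..1} ((cmod \<zeta>)\<^sup>2 * Im z) * indicator F z) \<partial>lborel)"
    proof (cases "\<zeta> = 0")
      case True
      then show ?thesis by (simp add: det_2 T)
    next
      case False
      have "(\<integral>\<^sup>+w. ?f (T (w, \<zeta>)) \<partial>lborel) = ennreal ((cmod \<zeta>)\<^sup>2) * (\<integral>\<^sup>+z. ?f (T (\<zeta> * z, \<zeta>)) \<partial>lborel)"
        by (rule nn_integral_complex_mult) (use False in \<open>simp_all\<close>)
      also have "\<dots> = (\<integral>\<^sup>+z. ennreal ((cmod \<zeta>)\<^sup>2) * ?f (T (\<zeta> * z, \<zeta>)) \<partial>lborel)"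
        by (rule nn_integral_cmult[symmetric]) simp
      also have "det (T (\<zeta> * z, \<zeta>)) = (cmod \<zeta>)\<^sup>2 * Im z" for z
        unfolding cmod_power2 by (simp add: det_2 T power2_eq_square algebra_simps)
      then have "(\<lambda>z. ennreal ((cmod \<zeta>)\<^sup>2) * ?f (T (\<zeta> * z, \<zeta>))) =
        (\<lambda>z. ennreal ((cmod \<zeta>)\<^sup>2) * (indicator {0<..1} ((cmod \<zeta>)\<^sup>2 * Im z) * indicator F z))"
        using False by (simp add: act_T)
      finally show ?thesis .
    qed
  qed
  also have "\<dots> = (\<integral>\<^sup>+z. \<integral>\<^sup>+\<zeta>. ennreal ((cmod \<zeta>)\<^sup>2) * (indicator {0<..1} ((cmod \<zeta>)\<^sup>2 * Im z) * indicator F z) \<partial>lborel \<partial>lborel)"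
    by (rule lborel_pair.Fubini'[symmetric]) simp
  also have "\<dots> = (\<integral>\<^sup>+z. ennreal (pi / 2) * (ennreal (1 / (Im z)\<^sup>2) * indicator F z) \<partial>lborel)"
  proof (rule nn_integral_cong)
    fix z :: complex
    show "(\<integral>\<^sup>+\<zeta>. ennreal ((cmod \<zeta>)\<^sup>2) * (indicator {0<..1} ((cmod \<zeta>)\<^sup>2 * Im z) * indicator F z) \<partial>lborel)
       = ennreal (pi / 2) * (ennreal (1 / (Im z)\<^sup>2) * indicator F z)"
    proof (cases "z \<in> F")
      case True
      then have z: "Im z > 0" using sub by (auto simp: upper_half_def)
      have "(\<integral>\<^sup>+\<zeta>. ennreal ((cmod \<zeta>)\<^sup>2) * (indicator {0<..1} ((cmod \<zeta>)\<^sup>2 * Im z) * indicator F z) \<partial>lborel)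
        = (\<integral>\<^sup>+\<zeta>. ennreal ((cmod \<zeta>)\<^sup>2) * indicator {..1 / Im z} ((cmod \<zeta>)\<^sup>2) \<partial>lborel)"
        using z True by (intro nn_integral_cong)
          (auto simp: indicator_def field_simps zero_less_mult_iff)
      also have "\<dots> = ennreal (pi / 2 * (1 / Im z)\<^sup>2)"
        by (rule nn_integral_disc_norm_square) (use z in simp)
      finally show ?thesis using True by (simp add: ennreal_mult'[symmetric] power_divide)
    qed simp
  qed
  also have "\<dots> = ennreal (pi / 2) * hyp_area F"
    unfolding hyp_area_def by (rule nn_integral_cmult) measurable
  finally show ?thesis .
qed

lemma borel_measurable_nn_integral_countable:
  fixes f :: "'i \<Rightarrow> 'a \<Rightarrow> ennreal"
  assumes "countable I" and [measurable]: "\<And>i. i \<in> I \<Longrightarrow> f i \<in> borel_measurable M"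
  shows "(\<lambda>x. \<integral>\<^sup>+i. f i x \<partial>count_space I) \<in> borel_measurable M"
proof cases
  assume "finite I" then show ?thesis
    by (simp add: nn_integral_count_space_finite)
next
  assume "infinite I"
  then have [simp]: "I \<noteq> {}" by auto
  note * = bij_betw_from_nat_into[OF \<open>countable I\<close> \<open>infinite I\<close>]
  have "\<And>f. (\<integral>\<^sup>+i. f i \<partial>count_space I) = (\<Sum>n. f (from_nat_into I n))"
    by (simp add: nn_integral_bij_count_space[symmetric, OF *] nn_integral_count_space_nat)
  then show ?thesis by (simp add: from_nat_into)
qed

section \<open>Discrete groups and their coset spaces\<close>

lemma carrier_SL2: "A \<in> G \<longleftrightarrow> det A = 1"
  by (simp add: SL2_def)

lemma mult_SL2: "A \<otimes>\<^bsub>SL2\<^esub> B = A ** B"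
  by (simp add: SL2_def)

lemma one_SL2: "\<one>\<^bsub>SL2\<^esub> = mat 1"
  by (simp add: SL2_def)

lemma adj_inverse:
  assumes "det A = 1" shows "adj A ** A = mat 1" "A ** adj A = mat 1"
  using assms by (simp_all add: mult_adj)

lemma inv_SL2: "A \<in> G \<Longrightarrow> inv\<^bsub>SL2\<^esub> A = adj A"
  by (rule group.inv_equality[OF group_SL2])
     (auto simp: carrier_SL2 mult_SL2 one_SL2 adj_inverse)

locale discrete_subgroup =
  fixes \<Gamma> :: "(real^2^2) set"
  assumes subgroup: "subgroup \<Gamma> SL2" and discrete: "discrete \<Gamma>"
begin

lemma det_mem: "\<gamma> \<in> \<Gamma> \<Longrightarrow> det \<gamma> = 1"
  using subgroup.subset[OF subgroup] by (auto simp: carrier_SL2)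

lemma one_mem: "mat 1 \<in> \<Gamma>"
  using subgroup.one_closed[OF subgroup] by (simp add: one_SL2)

lemma mult_mem: "\<gamma> \<in> \<Gamma> \<Longrightarrow> \<delta> \<in> \<Gamma> \<Longrightarrow> \<gamma> ** \<delta> \<in> \<Gamma>"
  using subgroup.m_closed[OF subgroup] by (simp add: mult_SL2)

lemma adj_mem: "\<gamma> \<in> \<Gamma> \<Longrightarrow> adj \<gamma> \<in> \<Gamma>"
  using subgroup.m_inv_closed[OF subgroup] inv_SL2 det_mem by (metis carrier_SL2)

lemma bij_mult: "\<gamma> \<in> \<Gamma> \<Longrightarrow> bij_betw (\<lambda>\<delta>. \<gamma> ** \<delta>) \<Gamma> \<Gamma>"
  by (rule bij_betwI[of _ _ _ "\<lambda>\<delta>. adj \<gamma> ** \<delta>"])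
     (auto simp: mult_mem adj_mem matrix_mul_assoc adj_inverse det_mem)

lemma bij_adj: "bij_betw adj \<Gamma> \<Gamma>"
  by (rule bij_betwI[of _ _ _ adj]) (auto simp: adj_mem)

lemma locally_injective:
  assumes "det x \<noteq> 0"
  obtains W where "open W" "x \<in> W" "\<And>A \<gamma>. A \<in> W \<Longrightarrow> \<gamma> \<in> \<Gamma> \<Longrightarrow> A ** \<gamma> \<in> W \<Longrightarrow> \<gamma> = mat 1"
proof -
  obtain e where e: "e > 0" "\<And>\<gamma>. \<gamma> \<in> \<Gamma> \<Longrightarrow> dist (mat 1) \<gamma> < e \<Longrightarrow> \<gamma> = mat 1"
    using isolated_inE_dist discreteD[OF discrete one_mem] by metis
  define D where "D = {p :: (real^2^2) \<times> (real^2^2). det (fst p) \<noteq> 0}"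
  define q where "q p = (1 / det (fst p)) *\<^sub>R (adj (fst p) ** snd p)" for p :: "(real^2^2) \<times> (real^2^2)"
  have cdet: "continuous_on UNIV (\<lambda>p :: (real^2^2) \<times> (real^2^2). det (fst p))"
    unfolding det_2 by (intro continuous_intros)
  have "open D" unfolding D_def
    using open_Collect_neq[OF cdet continuous_on_const, of 0] by simp
  have "continuous_on D q" unfolding q_def
    by (intro continuous_intros continuous_on_subset[OF cdet] continuous_on_compose2[OF continuous_on_adj[of UNIV]])
       (auto simp: D_def)
  then have "open (q -` ball (mat 1) e \<inter> D)"
    using \<open>open D\<close> continuous_on_open_vimage by blast
  moreover have "(x, x) \<in> q -` ball (mat 1) e \<inter> D"
    using assms e(1) by (simp add: q_def D_def mult_adj)
  ultimately obtain U V where UV: "open U" "open V" "x \<in> U" "x \<in> V" "U \<times> V \<subseteq> q -` ball (mat 1) e \<inter> D"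
    by (auto elim!: open_prod_elim)
  show ?thesis
  proof (rule that[of "U \<inter> V"])
    fix A \<gamma> assume A: "A \<in> U \<inter> V" "\<gamma> \<in> \<Gamma>" "A ** \<gamma> \<in> U \<inter> V"
    then have "(A, A ** \<gamma>) \<in> q -` ball (mat 1) e \<inter> D" using UV by auto
    then have "dist (mat 1) (q (A, A ** \<gamma>)) < e" "det A \<noteq> 0" by (auto simp: D_def)
    moreover have "q (A, A ** \<gamma>) = \<gamma>"
      using \<open>det A \<noteq> 0\<close> by (simp add: q_def matrix_mul_assoc mult_adj)
        (simp add: mat2_eq_iff mat2_mult_nth mat_def)
    ultimately show "\<gamma> = mat 1" using e A by auto
  qed (use UV in auto)
qed

lemma finite_bounded:
  assumes "bounded B" shows "finite (\<Gamma> \<inter> B)"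
proof (rule ccontr)
  assume inf: "infinite (\<Gamma> \<inter> B)"
  have "compact (closure B)" using assms by (simp add: compact_closure)
  then obtain x where x: "x islimpt (\<Gamma> \<inter> B)"
    using Heine_Borel_imp_Bolzano_Weierstrass[OF _ inf, of "closure B"] closure_subset[of B] by blast
  have "closed {A :: real^2^2. det A = 1}"
    unfolding det_2 by (intro closed_Collect_eq continuous_intros)
  moreover have "x islimpt {A. det A = 1}"
    using x by (rule islimpt_subset) (auto simp: det_mem)
  ultimately have "det x = 1" by (auto simp: closed_limpt)
  then obtain W where W: "open W" "x \<in> W" "\<And>A \<gamma>. A \<in> W \<Longrightarrow> \<gamma> \<in> \<Gamma> \<Longrightarrow> A ** \<gamma> \<in> W \<Longrightarrow> \<gamma> = mat 1"
    using locally_injective by (metis one_neq_zero)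
  obtain A where A: "A \<in> \<Gamma> \<inter> B" "A \<in> W" "A \<noteq> x"
    using x[unfolded islimpt_def, rule_format, of W] W by auto
  have "open (W - {A})" using W by auto
  then obtain C where C: "C \<in> \<Gamma> \<inter> B" "C \<in> W - {A}"
    using x[unfolded islimpt_def, rule_format, of "W - {A}"] W A by auto
  have "A ** (adj A ** C) = C" using A det_mem by (auto simp: matrix_mul_assoc adj_inverse)
  then have "adj A ** C = mat 1" using W(3)[of A "adj A ** C"] A C by (auto intro: mult_mem adj_mem)
  then have "C = A" using \<open>A ** (adj A ** C) = C\<close> by simp
  then show False using C by auto
qed

lemma countable_group: "countable \<Gamma>"
proof -
  have "\<Gamma> = (\<Union>n::nat. \<Gamma> \<inter> cball 0 (real n))"
    using real_arch_simple by auto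
  moreover have "countable (\<Union>n::nat. \<Gamma> \<inter> cball 0 (real n))"
    by (rule countable_UN, simp, rule countable_finite, rule finite_bounded, rule bounded_cball)
  ultimately show ?thesis by simp
qed

lemma mem_coset: "B \<in> coset \<Gamma> A \<longleftrightarrow> (\<exists>\<gamma>\<in>\<Gamma>. B = A ** \<gamma>)"
  by (auto simp: coset_def)

lemma self_mem_coset: "A \<in> coset \<Gamma> A"
  unfolding mem_coset using one_mem by (intro bexI[of _ "mat 1"]) auto

lemma coset_mult: "\<gamma> \<in> \<Gamma> \<Longrightarrow> coset \<Gamma> (A ** \<gamma>) = coset \<Gamma> A"
proof -
  assume g: "\<gamma> \<in> \<Gamma>"
  have "A ** \<gamma> ** \<delta> = A ** (\<gamma> ** \<delta>)" for \<delta> by (simp add: matrix_mul_assoc)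
  then have "coset \<Gamma> (A ** \<gamma>) = (\<lambda>\<delta>. A ** \<delta>) ` ((\<lambda>\<delta>. \<gamma> ** \<delta>) ` \<Gamma>)"
    by (auto simp: coset_def)
  then show ?thesis using bij_mult[OF g] by (simp add: bij_betw_def coset_def)
qed

lemma coset_eq: "B \<in> coset \<Gamma> A \<Longrightarrow> coset \<Gamma> B = coset \<Gamma> A"
  by (auto simp: mem_coset coset_mult)

lemma space_coset_borel: "space (coset_borel S \<Gamma>) = coset \<Gamma> ` S"
  unfolding coset_borel_def
  by (rule space_measure_of) (use openin_coset_topology in auto)

lemma sets_coset_borel: "sets (coset_borel S \<Gamma>) = sigma_sets (coset \<Gamma> ` S) {U. openin (coset_topology S \<Gamma>) U}"
  unfolding coset_borel_def
  by (rule sets_measure_of) (use openin_coset_topology in auto)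

lemma measurable_coset: "coset \<Gamma> \<in> restrict_space borel S \<rightarrow>\<^sub>M coset_borel S \<Gamma>"
  unfolding coset_borel_def
proof (rule measurable_measure_of)
  show "{U. openin (coset_topology S \<Gamma>) U} \<subseteq> Pow (coset \<Gamma> ` S)"
    using openin_coset_topology by auto
  show "coset \<Gamma> \<in> space (restrict_space borel S) \<rightarrow> coset \<Gamma> ` S"
    by (auto simp: space_restrict_space)
  fix U assume "U \<in> {U. openin (coset_topology S \<Gamma>) U}"
  then have "openin (top_of_set S) {A \<in> S. coset \<Gamma> A \<in> U}" by (simp add: openin_coset_topology)
  then obtain T where "open T" "{A \<in> S. coset \<Gamma> A \<in> U} = S \<inter> T"
    by (auto simp: openin_open)
  then show "coset \<Gamma> -` U \<inter> space (restrict_space borel S) \<in> sets (restrict_space borel S)"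
    by (auto simp: sets_restrict_space space_restrict_space intro!: image_eqI[of _ _ T])
qed

text \<open>The quotient map is a local homeomorphism, so picking the point of a coset in the first
  member of a countable cover by sets of injectivity is a Borel section.\<close>

lemma borel_section:
  assumes nz: "\<And>A. A \<in> S \<Longrightarrow> det A \<noteq> 0" and stable: "\<And>A \<gamma>. A \<in> S \<Longrightarrow> \<gamma> \<in> \<Gamma> \<Longrightarrow> A ** \<gamma> \<in> S"
  obtains s where "s \<in> coset_borel S \<Gamma> \<rightarrow>\<^sub>M borel" "\<And>K. K \<in> coset \<Gamma> ` S \<Longrightarrow> s K \<in> K"
proof -
  define \<W> where "\<W> = {W :: (real^2^2) set. open W \<and> (\<forall>A\<in>W. \<forall>\<gamma>\<in>\<Gamma>. A ** \<gamma> \<in> W \<longrightarrow> \<gamma> = mat 1)}"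
  obtain \<W>' where W': "\<W>' \<subseteq> \<W>" "countable \<W>'" "\<Union>\<W>' = \<Union>\<W>"
  proof (rule Lindelof[of \<W>])
    show "open W" if "W \<in> \<W>" for W using that by (simp add: \<W>_def)
  qed
  have "{} \<in> \<W>" by (auto simp: \<W>_def)
  define W where "W = from_nat_into (insert {} \<W>')"
  have W: "W n \<in> \<W>" for n
    using from_nat_into[of "insert {} \<W>'" n] W'(1) \<open>{} \<in> \<W>\<close> by (auto simp: W_def)
  have "range W = insert {} \<W>'"
    unfolding W_def using W'(2) by (intro range_from_nat_into) auto
  have cover: "\<exists>n. A \<in> W n" if A: "A \<in> S" for A
  proof -
    obtain U where "open U" "A \<in> U" "\<And>B \<gamma>. B \<in> U \<Longrightarrow> \<gamma> \<in> \<Gamma> \<Longrightarrow> B ** \<gamma> \<in> U \<Longrightarrow> \<gamma> = mat 1"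
      using locally_injective[OF nz[OF A]] by metis
    then have "U \<in> \<W>" unfolding \<W>_def by blast
    then have "A \<in> \<Union>\<W>" using \<open>A \<in> U\<close> by blast
    then obtain U where "U \<in> \<W>'" "A \<in> U" using W'(3) by blast
    then have "U \<in> range W" using \<open>range W = _\<close> by auto
    then show ?thesis using \<open>A \<in> U\<close> by auto
  qed
  let ?M = "coset_borel S \<Gamma>"
  have img: "coset \<Gamma> ` (S \<inter> U) \<in> sets ?M" if "open U" for U
  proof -
    have "open {A. A ** \<gamma> \<in> U}" for \<gamma> :: "real^2^2"
    proof -
      have "continuous_on UNIV (\<lambda>A::real^2^2. A ** \<gamma>)" by (intro continuous_intros)
      then show ?thesis using that continuous_on_open_vimage[of UNIV "\<lambda>A. A ** \<gamma>"]
        by (auto simp: vimage_def)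
    qed
    then have "open (\<Union>\<gamma>\<in>\<Gamma>. {A. A ** \<gamma> \<in> U})" by auto
    moreover have "{A \<in> S. coset \<Gamma> A \<in> coset \<Gamma> ` (S \<inter> U)} = S \<inter> (\<Union>\<gamma>\<in>\<Gamma>. {A. A ** \<gamma> \<in> U})"
    proof (intro equalityI subsetI)
      fix A assume A: "A \<in> {A \<in> S. coset \<Gamma> A \<in> coset \<Gamma> ` (S \<inter> U)}"
      then obtain B where B: "B \<in> S \<inter> U" "coset \<Gamma> A = coset \<Gamma> B" by auto
      then have "B \<in> coset \<Gamma> A" using self_mem_coset by auto
      then obtain \<gamma> where "\<gamma> \<in> \<Gamma>" "B = A ** \<gamma>" unfolding mem_coset by blast
      then show "A \<in> S \<inter> (\<Union>\<gamma>\<in>\<Gamma>. {A. A ** \<gamma> \<in> U})" using A B by auto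
    next
      fix A assume "A \<in> S \<inter> (\<Union>\<gamma>\<in>\<Gamma>. {A. A ** \<gamma> \<in> U})"
      then obtain \<gamma> where "A \<in> S" "\<gamma> \<in> \<Gamma>" "A ** \<gamma> \<in> U" by auto
      then show "A \<in> {A \<in> S. coset \<Gamma> A \<in> coset \<Gamma> ` (S \<inter> U)}"
        using stable[of A \<gamma>] coset_mult[of \<gamma> A, symmetric] by auto
    qed
    ultimately have "openin (coset_topology S \<Gamma>) (coset \<Gamma> ` (S \<inter> U))"
      unfolding openin_coset_topology by (auto simp: openin_open)
    then show ?thesis unfolding sets_coset_borel by blast
  qed
  have sub: "K \<subseteq> S" if "K \<in> coset \<Gamma> ` S" for K
    using that stable by (auto simp: mem_coset)
  have inj: "A = B" if K: "K \<in> coset \<Gamma> ` S" and "A \<in> K" "B \<in> K" "A \<in> W n" "B \<in> W n" for A B K n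
  proof -
    have "K = coset \<Gamma> A" using K \<open>A \<in> K\<close> coset_eq by blast
    then obtain \<gamma> where g: "\<gamma> \<in> \<Gamma>" "B = A ** \<gamma>" using \<open>B \<in> K\<close> by (auto simp: mem_coset)
    then have "\<gamma> = mat 1" using W[of n] that by (auto simp: \<W>_def)
    then show ?thesis using g by simp
  qed
  define N where "N K = (LEAST n. K \<inter> W n \<noteq> {})" for K
  define s where "s K = (SOME A. A \<in> K \<inter> W (N K))" for K
  have N: "K \<inter> W (N K) \<noteq> {}" if "K \<in> coset \<Gamma> ` S" for K
  proof -
    obtain A where A: "A \<in> S" "K = coset \<Gamma> A" using \<open>K \<in> _\<close> by auto
    then obtain n where "A \<in> W n" using cover by blast
    then have "K \<inter> W n \<noteq> {}" using A self_mem_coset by auto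
    then show ?thesis unfolding N_def by (rule LeastI)
  qed
  have s: "s K \<in> K \<inter> W (N K)" if "K \<in> coset \<Gamma> ` S" for K
    unfolding s_def by (rule someI_ex) (use N[OF that] in blast)
  have meet: "K \<in> coset \<Gamma> ` (S \<inter> U) \<longleftrightarrow> K \<inter> U \<noteq> {}" if K: "K \<in> coset \<Gamma> ` S" for K U
  proof
    assume "K \<in> coset \<Gamma> ` (S \<inter> U)" then show "K \<inter> U \<noteq> {}" using self_mem_coset by blast
  next
    assume "K \<inter> U \<noteq> {}"
    then obtain A where "A \<in> K" "A \<in> U" by auto
    then have "K = coset \<Gamma> A" "A \<in> S" using K sub[OF K] coset_eq by blast+
    then show "K \<in> coset \<Gamma> ` (S \<inter> U)" using \<open>A \<in> U\<close> by auto
  qed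
  have "s \<in> ?M \<rightarrow>\<^sub>M borel"
  proof (rule borel_measurableI)
    fix U :: "(real^2^2) set" assume U: "open U"
    have "s -` U \<inter> space ?M = (\<Union>n. coset \<Gamma> ` (S \<inter> (W n \<inter> U)) - (\<Union>m<n. coset \<Gamma> ` (S \<inter> W m)))"
      (is "?l = ?r")
    proof (intro equalityI subsetI)
      fix K assume "K \<in> ?l"
      then have K: "K \<in> coset \<Gamma> ` S" "s K \<in> U" by (auto simp: space_coset_borel)
      have "K \<in> coset \<Gamma> ` (S \<inter> (W (N K) \<inter> U))" using meet[OF K(1)] s[OF K(1)] K(2) by blast
      moreover have "K \<notin> coset \<Gamma> ` (S \<inter> W m)" if "m < N K" for m
        using meet[OF K(1)] not_less_Least[OF that[unfolded N_def]] by blast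
      ultimately show "K \<in> ?r" by blast
    next
      fix K assume "K \<in> ?r"
      then obtain n where n: "K \<in> coset \<Gamma> ` (S \<inter> (W n \<inter> U))" "\<And>m. m < n \<Longrightarrow> K \<notin> coset \<Gamma> ` (S \<inter> W m)" by blast
      then have K: "K \<in> coset \<Gamma> ` S" by auto
      have "K \<inter> (W n \<inter> U) \<noteq> {}" using n(1) meet[OF K] by blast
      moreover have "K \<inter> W m = {}" if "m < n" for m using n(2)[OF that] meet[OF K] by blast
      ultimately have "N K = n" unfolding N_def
        by (intro Least_equality) (auto simp: not_less[symmetric])
      obtain A where "A \<in> K" "A \<in> W n" "A \<in> U" using \<open>K \<inter> (W n \<inter> U) \<noteq> {}\<close> by auto
      then have "s K = A" using inj[OF K] s[OF K] \<open>N K = n\<close> by auto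
      then show "K \<in> ?l" using K \<open>A \<in> U\<close> by (auto simp: space_coset_borel)
    qed
    also have "\<dots> \<in> sets ?M"
      by (intro sets.countable_UN image_subsetI sets.Diff sets.finite_UN img open_Int U)
         (use W in \<open>auto simp: \<W>_def\<close>)
    finally show "s -` U \<inter> space ?M \<in> sets ?M" .
  qed
  then show ?thesis using that[of s] s by blast
qed

lemma nn_integral_group_mult:
  "\<gamma> \<in> \<Gamma> \<Longrightarrow> (\<integral>\<^sup>+\<delta>. F (A ** \<gamma> ** \<delta>) \<partial>count_space \<Gamma>) = (\<integral>\<^sup>+\<delta>. F (A ** \<delta>) \<partial>count_space \<Gamma>)"
  using nn_integral_bij_count_space[OF bij_mult, of \<gamma> "\<lambda>\<delta>. F (A ** \<delta>)"]
  by (simp add: matrix_mul_assoc)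

lemma nn_integral_group_coset:
  "B \<in> coset \<Gamma> A \<Longrightarrow> (\<integral>\<^sup>+\<delta>. F (B ** \<delta>) \<partial>count_space \<Gamma>) = (\<integral>\<^sup>+\<delta>. F (A ** \<delta>) \<partial>count_space \<Gamma>)"
  by (auto simp: mem_coset nn_integral_group_mult)

end

locale lattice_measure = discrete_subgroup +
  fixes \<mu> :: "(real^2^2) set measure"
  assumes invariant: "invariant_prob \<Gamma> \<mu>"
begin

lemma prob_space_mu: "prob_space \<mu>"
  and sets_mu: "sets \<mu> = sets (coset_borel G \<Gamma>)"
  using invariant by (auto simp: invariant_prob_def)

lemma space_mu: "space \<mu> = coset \<Gamma> ` G"
  using sets_eq_imp_space_eq[OF sets_mu] by (simp add: space_coset_borel)

lemma emeasure_space_mu: "emeasure \<mu> (space \<mu>) = 1"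
  using prob_space_mu by (rule prob_space.emeasure_space_1)

sublocale mu: sigma_finite_measure \<mu>
  using prob_space_mu by (simp add: prob_space.axioms(1) finite_measure.axioms(1) prob_space_def finite_measure_def)

definition sec :: "(real^2^2) set \<Rightarrow> real^2^2" where
  "sec = (SOME s. s \<in> coset_borel G \<Gamma> \<rightarrow>\<^sub>M borel \<and> (\<forall>K \<in> coset \<Gamma> ` G. s K \<in> K))"

lemma sec: "sec \<in> coset_borel G \<Gamma> \<rightarrow>\<^sub>M borel" "K \<in> coset \<Gamma> ` G \<Longrightarrow> sec K \<in> K"
proof -
  have "det A \<noteq> 0" if "A \<in> G" for A using that by (simp add: carrier_SL2)
  moreover have "A ** \<gamma> \<in> G" if "A \<in> G" "\<gamma> \<in> \<Gamma>" for A \<gamma>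
    using that by (simp add: carrier_SL2 det_mul det_mem)
  ultimately obtain s where "s \<in> coset_borel G \<Gamma> \<rightarrow>\<^sub>M borel" "\<And>K. K \<in> coset \<Gamma> ` G \<Longrightarrow> s K \<in> K"
    using borel_section[of G] by blast
  then have "\<exists>s. s \<in> coset_borel G \<Gamma> \<rightarrow>\<^sub>M borel \<and> (\<forall>K \<in> coset \<Gamma> ` G. s K \<in> K)" by blast
  from someI_ex[OF this] show "sec \<in> coset_borel G \<Gamma> \<rightarrow>\<^sub>M borel" "K \<in> coset \<Gamma> ` G \<Longrightarrow> sec K \<in> K"
    unfolding sec_def by auto
qed

lemma measurable_sec [measurable]: "sec \<in> borel_measurable \<mu>"
  using sec(1) measurable_cong_sets[OF sets_mu refl] by blast

lemma sec_space: "K \<in> space \<mu> \<Longrightarrow> sec K \<in> K" "K \<in> space \<mu> \<Longrightarrow> det (sec K) = 1"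
   "K \<in> space \<mu> \<Longrightarrow> K = coset \<Gamma> (sec K)"
proof -
  assume K: "K \<in> space \<mu>"
  show s: "sec K \<in> K" using sec(2) K by (simp add: space_mu)
  obtain A where A: "A \<in> G" "K = coset \<Gamma> A" using K by (auto simp: space_mu)
  then show "det (sec K) = 1" using s by (auto simp: mem_coset det_mul det_mem carrier_SL2)
  show "K = coset \<Gamma> (sec K)" using A s coset_eq by simp
qed

definition unfold_int :: "(real^2^2 \<Rightarrow> ennreal) \<Rightarrow> ennreal" where
  "unfold_int F = (\<integral>\<^sup>+K. \<integral>\<^sup>+\<gamma>. F (sec K ** \<gamma>) \<partial>count_space \<Gamma> \<partial>\<mu>)"

lemma measurable_group_sum [measurable (raw)]:
  fixes A :: "'a \<Rightarrow> real^2^2"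
  assumes [measurable]: "F \<in> borel_measurable borel" "A \<in> borel_measurable M"
  shows "(\<lambda>x. \<integral>\<^sup>+\<gamma>. F (A x ** \<gamma>) \<partial>count_space \<Gamma>) \<in> borel_measurable M"
  by (rule borel_measurable_nn_integral_countable[OF countable_group]) measurable

lemma left_translate:
  assumes g: "det g = 1"
  shows "(\<lambda>K. (\<lambda>A. g ** A) ` K) \<in> \<mu> \<rightarrow>\<^sub>M \<mu>" "distr \<mu> \<mu> (\<lambda>K. (\<lambda>A. g ** A) ` K) = \<mu>"
proof -
  let ?t = "\<lambda>g (K :: (real^2^2) set). (\<lambda>A. g ** A) ` K"
  have t: "?t g (coset \<Gamma> A) = coset \<Gamma> (g ** A)" for g A
    by (auto simp: coset_def image_image matrix_mul_assoc)
  have inv: "?t g (?t (adj g) K) = K" "?t (adj g) (?t g K) = K" for K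
    using g by (simp_all add: image_image matrix_mul_assoc adj_inverse)
  have sp: "?t h K \<in> space \<mu>" if "K \<in> space \<mu>" "det h = 1" for h K
    using that t by (auto simp: space_mu carrier_SL2 det_mul)
  have vim: "?t g -` E \<inter> space \<mu> = ?t (adj g) ` E" if "E \<in> sets \<mu>" for E
  proof (intro equalityI subsetI)
    fix K assume "K \<in> ?t g -` E \<inter> space \<mu>"
    then show "K \<in> ?t (adj g) ` E" using inv(2)[of K] by (metis IntD1 image_eqI vimage_eq)
  next
    fix K assume "K \<in> ?t (adj g) ` E"
    then obtain L where L: "L \<in> E" "K = ?t (adj g) L" by blast
    then have "?t g K \<in> E" using inv(1)[of L] by simp
    moreover have "K \<in> space \<mu>" using L sp[of L "adj g"] g sets.sets_into_space[OF that] by auto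
    ultimately show "K \<in> ?t g -` E \<inter> space \<mu>" by simp
  qed
  have E: "?t (adj g) ` E \<in> sets \<mu>" "emeasure \<mu> (?t (adj g) ` E) = emeasure \<mu> E" if "E \<in> sets \<mu>" for E
    using invariant that g unfolding invariant_prob_def by (auto simp: carrier_SL2)
  show m: "?t g \<in> \<mu> \<rightarrow>\<^sub>M \<mu>"
    by (rule measurableI) (use sp g vim E in auto)
  show "distr \<mu> \<mu> (?t g) = \<mu>"
    by (rule measure_eqI) (use m vim E in \<open>auto simp: emeasure_distr\<close>)
qed

lemma unfold_int_left:
  assumes g: "det g = 1" and [measurable]: "F \<in> borel_measurable borel"
  shows "unfold_int (\<lambda>A. F (g ** A)) = unfold_int F"
proof -
  let ?t = "\<lambda>K. (\<lambda>A. g ** A) ` K"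
  note [measurable] = left_translate(1)[OF g]
  let ?P = "\<lambda>K. \<integral>\<^sup>+\<gamma>. F (sec K ** \<gamma>) \<partial>count_space \<Gamma>"
  have "unfold_int F = (\<integral>\<^sup>+K. ?P K \<partial>distr \<mu> \<mu> ?t)"
    by (simp add: left_translate(2)[OF g] unfold_int_def)
  also have "\<dots> = (\<integral>\<^sup>+K. ?P (?t K) \<partial>\<mu>)"
    by (rule nn_integral_distr) measurable
  also have "\<dots> = (\<integral>\<^sup>+K. \<integral>\<^sup>+\<gamma>. F (g ** (sec K ** \<gamma>)) \<partial>count_space \<Gamma> \<partial>\<mu>)"
  proof (rule nn_integral_cong)
    fix K assume K: "K \<in> space \<mu>"
    then have "?t K \<in> space \<mu>" using left_translate(1)[OF g] by (auto simp: measurable_def)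
    then have "sec (?t K) \<in> ?t K" by (rule sec_space)
    moreover have "?t K = ?t (coset \<Gamma> (sec K))" using sec_space(3)[OF K] by simp
    moreover have "\<dots> = coset \<Gamma> (g ** sec K)" by (auto simp: coset_def image_image matrix_mul_assoc)
    ultimately have "sec (?t K) \<in> coset \<Gamma> (g ** sec K)" by metis
    then show "?P (?t K) = (\<integral>\<^sup>+\<gamma>. F (g ** (sec K ** \<gamma>)) \<partial>count_space \<Gamma>)"
      using nn_integral_group_coset[of _ _ F] by (simp add: matrix_mul_assoc)
  qed
  finally show ?thesis by (simp add: unfold_int_def)
qed

end

section \<open>The action on the upper half-plane\<close>

lemma act_denominator_nonzero:
  fixes A :: "real^2^2"
  assumes "det A \<noteq> 0" "z \<in> upper_half"
  shows "of_real (A$2$1) * z + of_real (A$2$2) \<noteq> (0::complex)"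
proof
  assume e: "of_real (A$2$1) * z + of_real (A$2$2) = (0::complex)"
  then have "Im (of_real (A$2$1) * z + of_real (A$2$2)) = 0" by simp
  then have "A$2$1 = 0" using assms by (auto simp: upper_half_def)
  then have "A$2$2 = 0" using e by simp
  then show False using \<open>A$2$1 = 0\<close> assms by (simp add: det_2)
qed

lemma Im_act:
  "Im (act A z) = det A * Im z / (cmod (of_real (A$2$1) * z + of_real (A$2$2)))\<^sup>2"
  unfolding act_eq Im_divide' cmod_power2 by (simp add: det_2 algebra_simps)

lemma act_upper_half: "det A > 0 \<Longrightarrow> z \<in> upper_half \<Longrightarrow> act A z \<in> upper_half"
  using act_denominator_nonzero[of A z] by (simp add: upper_half_def Im_act)

lemma act_mult:
  assumes "det B \<noteq> 0" "z \<in> upper_half"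
  shows "act (A ** B) z = act A (act B z)"
proof -
  define p where "p = of_real (B$1$1) * z + of_real (B$1$2)"
  define q where "q = of_real (B$2$1) * z + of_real (B$2$2)"
  have q: "q \<noteq> 0" unfolding q_def by (rule act_denominator_nonzero[OF assms])
  have *: "of_real a * (p / q) + of_real b = (of_real a * p + of_real b * q) / q" for a b
    using q by (simp add: field_simps)
  have "act A (act B z) = act A (p / q)" by (simp add: act_eq p_def q_def)
  also have "\<dots> = (of_real (A$1$1) * p + of_real (A$1$2) * q) / (of_real (A$2$1) * p + of_real (A$2$2) * q)"
    unfolding act_eq * using q by simp
  also have "\<dots> = act (A ** B) z"
    by (simp add: act_eq mat2_mult_nth p_def q_def algebra_simps)
  finally show ?thesis ..
qed

lemma act_scaleR: "c \<noteq> 0 \<Longrightarrow> act (c *\<^sub>R A) z = act A z"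
proof -
  assume c: "c \<noteq> 0"
  have "act (c *\<^sub>R A) z = (of_real c * (of_real (A$1$1) * z + of_real (A$1$2))) /
     (of_real c * (of_real (A$2$1) * z + of_real (A$2$2)))"
    by (simp add: act_eq algebra_simps)
  then show ?thesis using c by (simp add: act_eq)
qed

lemma act_one [simp]: "act (mat 1) z = z"
  by (simp add: act_eq mat_def)

lemma act_adj_act:
  assumes "det A = 1" "z \<in> upper_half"
  shows "act (adj A) (act A z) = z"
  using act_mult[of A z "adj A"] assms by (simp add: adj_inverse)

lemma act_uminus: "act (- A) z = act A z"
  using act_scaleR[of "-1" A z] by simp

lemma act_fixes_two_points:
  assumes det: "det A = 1" and z: "z \<in> upper_half" "w \<in> upper_half" "z \<noteq> w" and fix_z: "act A z = z" "act A w = w"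
  shows "A = mat 1 \<or> A = - mat 1"
proof -
  let ?a = "A$1$1" and ?b = "A$1$2" and ?c = "A$2$1" and ?d = "A$2$2"
  have *: "of_real ?c * x * x + (of_real ?d - of_real ?a) * x - of_real ?b = 0" if "x \<in> upper_half" "act A x = x" for x
  proof -
    have "of_real ?a * x + of_real ?b = x * (of_real ?c * x + of_real ?d)"
      using that(2) act_denominator_nonzero[of A x] that(1) det by (simp add: act_eq divide_eq_eq)
    then show ?thesis by (simp add: algebra_simps)
  qed
  have "(z - w) * (of_real ?c * (z + w) + (of_real ?d - of_real ?a)) = 0"
    using *[OF z(1) fix_z(1)] *[OF z(2) fix_z(2)] by (simp add: algebra_simps)
  then have e: "of_real ?c * (z + w) + (of_real ?d - of_real ?a) = 0" using z by simp
  then have "Im (of_real ?c * (z + w) + (of_real ?d - of_real ?a)) = 0" by simp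
  then have "?c * (Im z + Im w) = 0" by simp
  then have c: "?c = 0" using z by (auto simp: upper_half_def)
  then have ad: "?d = ?a" using e by (simp flip: of_real_diff)
  then have b: "?b = 0" using *[OF z(1) fix_z(1)] c by simp
  have "?a * ?a = 1" using det c ad by (simp add: det_2)
  then have "?a = 1 \<or> ?a = -1" by (simp add: square_eq_1_iff)
  then show ?thesis using b c ad by (auto simp: mat2_eq_iff mat_def)
qed

text \<open>For \<open>z = A i\<close> with \<open>det A = 1\<close> this is the sum of the squares of the entries of \<open>A\<close>; it
  is a proper function on the upper half-plane.\<close>

definition height :: "complex \<Rightarrow> real" where
  "height z = ((cmod z)\<^sup>2 + 1) / Im z"

definition lex_le :: "complex \<Rightarrow> complex \<Rightarrow> bool" where
  "lex_le z w \<longleftrightarrow> height z < height w \<or>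
     (height z = height w \<and> (Re z < Re w \<or> (Re z = Re w \<and> Im z \<le> Im w)))"

lemma lex_le_antisym: "lex_le z w \<Longrightarrow> lex_le w z \<Longrightarrow> z = w"
  by (auto simp: lex_le_def complex_eq_iff)

lemma lex_le_trans: "lex_le z w \<Longrightarrow> lex_le w v \<Longrightarrow> lex_le z v"
  by (auto simp: lex_le_def)

lemma lex_le_total: "lex_le z w \<or> lex_le w z"
  by (auto simp: lex_le_def)

lemma lex_le_refl: "lex_le z z"
  by (simp add: lex_le_def)

lemma finite_lex_min:
  assumes "finite S" "S \<noteq> {}" shows "\<exists>m\<in>S. \<forall>x\<in>S. lex_le m x"
  using assms
proof (induction rule: finite_ne_induct)
  case (singleton x) then show ?case by (simp add: lex_le_refl)
next
  case (insert x S)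
  then obtain m where "m \<in> S" "\<forall>y\<in>S. lex_le m y" by blast
  then show ?case using lex_le_total[of x m] lex_le_trans lex_le_refl by (metis insert_iff)
qed

context discrete_subgroup
begin

lemma act_mem: "\<gamma> \<in> \<Gamma> \<Longrightarrow> z \<in> upper_half \<Longrightarrow> act \<gamma> z \<in> upper_half"
  by (simp add: act_upper_half det_mem)

lemma finite_height:
  assumes z: "z \<in> upper_half"
  shows "finite {\<gamma> \<in> \<Gamma>. height (act \<gamma> z) \<le> R}"
proof -
  define y where "y = Im z"
  have y: "y > 0" using z by (simp add: y_def upper_half_def)
  define N where "N = sqrt (R * y)"
  define B where "B = {A :: real^2^2. norm A \<le> 2 * (N / y) + 2 * (N + N / y * cmod z)}"
  have "\<gamma> \<in> B" if g: "\<gamma> \<in> \<Gamma>" "height (act \<gamma> z) \<le> R" for \<gamma>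
  proof -
    define p where "p i = of_real (\<gamma>$i$1) * z + of_real (\<gamma>$i$2)" for i
    have q: "p 2 \<noteq> 0" unfolding p_def by (rule act_denominator_nonzero[OF _ z]) (simp add: det_mem g)
    have "Im (act \<gamma> z) = y / (cmod (p 2))\<^sup>2" using g by (simp add: Im_act p_def y_def det_mem)
    moreover have "(cmod (act \<gamma> z))\<^sup>2 = (cmod (p 1))\<^sup>2 / (cmod (p 2))\<^sup>2"
      by (simp add: act_eq p_def norm_divide power_divide)
    ultimately have "height (act \<gamma> z) = ((cmod (p 1))\<^sup>2 / (cmod (p 2))\<^sup>2 + 1) / (y / (cmod (p 2))\<^sup>2)"
      unfolding height_def by simp
    also have "\<dots> = ((cmod (p 1))\<^sup>2 + (cmod (p 2))\<^sup>2) / y"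
      using q y by (simp add: field_simps)
    finally have "height (act \<gamma> z) = ((cmod (p 1))\<^sup>2 + (cmod (p 2))\<^sup>2) / y" .
    then have "(cmod (p 1))\<^sup>2 + (cmod (p 2))\<^sup>2 \<le> R * y"
      using g y by (simp add: pos_divide_le_eq)
    then have "(cmod (p 1))\<^sup>2 \<le> R * y" "(cmod (p 2))\<^sup>2 \<le> R * y"
      using zero_le_power2[of "cmod (p 1)"] zero_le_power2[of "cmod (p 2)"] by linarith+
    then have pN: "cmod (p 1) \<le> N" "cmod (p 2) \<le> N"
      unfolding N_def by (auto intro: real_le_rsqrt)
    have one: "\<bar>\<gamma>$i$1\<bar> \<le> N / y" if "cmod (p i) \<le> N" for i
    proof -
      have "\<bar>\<gamma>$i$1\<bar> * y = \<bar>Im (p i)\<bar>" using y by (simp add: p_def y_def abs_mult)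
      also have "\<dots> \<le> N" using abs_Im_le_cmod[of "p i"] that by linarith
      finally show ?thesis using y by (simp add: field_simps)
    qed
    have two: "\<bar>\<gamma>$i$2\<bar> \<le> N + N / y * cmod z" if "cmod (p i) \<le> N" for i
    proof -
      have "\<bar>\<gamma>$i$2\<bar> = cmod (p i - of_real (\<gamma>$i$1) * z)" by (simp add: p_def)
      also have "\<dots> \<le> cmod (p i) + \<bar>\<gamma>$i$1\<bar> * cmod z"
        using norm_triangle_ineq4[of "p i" "of_real (\<gamma>$i$1) * z"] by (simp add: norm_mult)
      also have "\<dots> \<le> N + N / y * cmod z"
        using that one[OF that] by (intro add_mono mult_right_mono) auto
      finally show ?thesis .
    qed
    show ?thesis using norm_mat2_le[of \<gamma>]
      using one[OF pN(1)] one[OF pN(2)] two[OF pN(1)] two[OF pN(2)] by (simp add: B_def sum_2)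
  qed
  moreover have "bounded B" unfolding B_def bounded_iff by auto
  ultimately have "{\<gamma> \<in> \<Gamma>. height (act \<gamma> z) \<le> R} \<subseteq> \<Gamma> \<inter> B" "finite (\<Gamma> \<inter> B)"
    using finite_bounded[of B] by auto
  then show ?thesis by (rule finite_subset)
qed

lemma fundamental_set_exists: "\<exists>F. fundamental_set \<Gamma> F"
proof -
  define F where "F = upper_half \<inter> (\<Inter>\<gamma>\<in>\<Gamma>. {z. lex_le z (act \<gamma> z)})"
  have [measurable]: "height \<in> borel_measurable borel"
    unfolding height_def[abs_def] by measurable
  have 1: "upper_half \<in> sets borel" unfolding upper_half_def by measurable
  have "{z. lex_le z (act \<gamma> z)} \<in> sets borel" for \<gamma>
    unfolding lex_le_def by measurable
  then have "F \<in> sets borel" unfolding F_def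
    using 1 countable_group one_mem by (intro sets.Int sets.countable_INT') auto
  moreover have "\<exists>!w. w \<in> F \<and> (\<exists>\<gamma>\<in>\<Gamma>. w = act \<gamma> z)" if z: "z \<in> upper_half" for z
  proof (rule ex_ex1I)
    let ?S = "(\<lambda>\<gamma>. act \<gamma> z) ` {\<gamma> \<in> \<Gamma>. height (act \<gamma> z) \<le> height z}"
    have "finite ?S" using finite_height[OF z] by simp
    moreover have "z \<in> ?S" using one_mem by (intro image_eqI[of _ _ "mat 1"]) auto
    ultimately obtain m where m: "m \<in> ?S" "\<And>x. x \<in> ?S \<Longrightarrow> lex_le m x" using finite_lex_min[of ?S] by blast
    then obtain \<gamma>0 where g0: "\<gamma>0 \<in> \<Gamma>" "m = act \<gamma>0 z" "height m \<le> height z" by auto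
    have "lex_le m (act \<gamma> m)" if "\<gamma> \<in> \<Gamma>" for \<gamma>
    proof -
      have e: "act \<gamma> m = act (\<gamma> ** \<gamma>0) z" using g0 z by (simp add: act_mult det_mem)
      show ?thesis
      proof (cases "height (act \<gamma> m) \<le> height z")
        case True
        then show ?thesis using mult_mem[OF that g0(1)] e by (intro m(2)) auto
      qed (use g0 in \<open>simp add: lex_le_def\<close>)
    qed
    then show "\<exists>w. w \<in> F \<and> (\<exists>\<gamma>\<in>\<Gamma>. w = act \<gamma> z)"
      using g0 act_mem[OF g0(1) z] by (auto simp: F_def)
  next
    fix w w' assume "w \<in> F \<and> (\<exists>\<gamma>\<in>\<Gamma>. w = act \<gamma> z)" "w' \<in> F \<and> (\<exists>\<gamma>\<in>\<Gamma>. w' = act \<gamma> z)"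
    then obtain \<gamma> \<gamma>' where w: "w \<in> F" "w' \<in> F" "\<gamma> \<in> \<Gamma>" "\<gamma>' \<in> \<Gamma>" "w = act \<gamma> z" "w' = act \<gamma>' z" by blast
    have "act (\<beta> ** adj \<alpha>) (act \<alpha> z) = act \<beta> z" if "\<alpha> \<in> \<Gamma>" "\<beta> \<in> \<Gamma>" for \<alpha> \<beta>
      using that z act_mem[of \<alpha> z] by (simp add: act_mult det_mem act_adj_act)
    then have "w' = act (\<gamma>' ** adj \<gamma>) w" "w = act (\<gamma> ** adj \<gamma>') w'" using w by auto
    moreover have "\<gamma>' ** adj \<gamma> \<in> \<Gamma>" "\<gamma> ** adj \<gamma>' \<in> \<Gamma>" using w by (auto intro: mult_mem adj_mem)
    moreover have "lex_le v (act \<delta> v)" if "v \<in> F" "\<delta> \<in> \<Gamma>" for v \<delta> using that by (auto simp: F_def)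
    ultimately have "lex_le w w'" "lex_le w' w" using w(1,2) by metis+
    then show "w = w'" by (rule lex_le_antisym)
  qed
  moreover have "F \<subseteq> upper_half" by (auto simp: F_def)
  ultimately have "fundamental_set \<Gamma> F" unfolding fundamental_set_def by simp
  then show ?thesis by blast
qed

definition special_points :: "complex set" where
  "special_points = {z \<in> upper_half. \<exists>\<gamma>\<in>\<Gamma>. \<gamma> \<noteq> mat 1 \<and> \<gamma> \<noteq> - mat 1 \<and> act \<gamma> z = z}"

lemma countable_special_points: "countable special_points"
proof -
  have "special_points = (\<Union>\<gamma>\<in>\<Gamma> - {mat 1, - mat 1}. {z \<in> upper_half. act \<gamma> z = z})"
    by (auto simp: special_points_def)
  moreover have "countable {z \<in> upper_half. act \<gamma> z = z}" if "\<gamma> \<in> \<Gamma> - {mat 1, - mat 1}" for \<gamma>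
  proof (cases "{z \<in> upper_half. act \<gamma> z = z} = {}")
    case False
    then obtain z where z: "z \<in> upper_half" "act \<gamma> z = z" by auto
    have "{z \<in> upper_half. act \<gamma> z = z} \<subseteq> {z}"
      using act_fixes_two_points[of \<gamma> z] that z by (auto simp: det_mem)
    then show ?thesis by (meson countable_empty countable_insert countable_subset)
  qed (metis countable_empty)
  ultimately show ?thesis using countable_group by auto
qed

end

section \<open>The unfolding formula\<close>

context lattice_measure
begin

lemma unfold_int_cong:
  assumes "\<And>A. det A = 1 \<Longrightarrow> F A = F' A"
  shows "unfold_int F = unfold_int F'"
  unfolding unfold_int_def
  by (intro nn_integral_cong assms) (auto simp: det_mul sec_space det_mem)

lemma unfold_int_cmult:
  assumes [measurable]: "F \<in> borel_measurable borel"
  shows "unfold_int (\<lambda>A. c * F A) = c * unfold_int F"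
  unfolding unfold_int_def by (simp add: nn_integral_cmult)

lemma measurable_unfold_int:
  assumes [measurable]: "(\<lambda>(x, B). \<Phi> x B) \<in> borel_measurable (N \<Otimes>\<^sub>M borel)"
  shows "(\<lambda>x. unfold_int (\<Phi> x)) \<in> borel_measurable N"
    and "(\<lambda>(x, K). \<integral>\<^sup>+\<gamma>. \<Phi> x (sec K ** \<gamma>) \<partial>count_space \<Gamma>) \<in> borel_measurable (N \<Otimes>\<^sub>M \<mu>)"
proof -
  have "(\<lambda>p. \<integral>\<^sup>+\<gamma>. (\<lambda>(x, B). \<Phi> x B) (fst p, sec (snd p) ** \<gamma>) \<partial>count_space \<Gamma>) \<in> borel_measurable (N \<Otimes>\<^sub>M \<mu>)"
    by (rule borel_measurable_nn_integral_countable[OF countable_group]) measurable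
  then show 1[measurable]: "(\<lambda>(x, K). \<integral>\<^sup>+\<gamma>. \<Phi> x (sec K ** \<gamma>) \<partial>count_space \<Gamma>) \<in> borel_measurable (N \<Otimes>\<^sub>M \<mu>)"
    by (simp add: case_prod_beta')
  show "(\<lambda>x. unfold_int (\<Phi> x)) \<in> borel_measurable N"
    unfolding unfold_int_def by measurable
qed

lemma unfold_int_swap:
  assumes N: "sigma_finite_measure N"
    and [measurable]: "(\<lambda>(x, B). \<Phi> x B) \<in> borel_measurable (N \<Otimes>\<^sub>M borel)"
  shows "(\<integral>\<^sup>+x. unfold_int (\<Phi> x) \<partial>N) = unfold_int (\<lambda>B. \<integral>\<^sup>+x. \<Phi> x B \<partial>N)"
proof -
  interpret N: sigma_finite_measure N by fact
  interpret NK: pair_sigma_finite N \<mu> ..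
  have "(\<integral>\<^sup>+x. unfold_int (\<Phi> x) \<partial>N) = (\<integral>\<^sup>+K. \<integral>\<^sup>+x. \<integral>\<^sup>+\<gamma>. \<Phi> x (sec K ** \<gamma>) \<partial>count_space \<Gamma> \<partial>N \<partial>\<mu>)"
    unfolding unfold_int_def by (rule NK.Fubini'[symmetric]) (rule measurable_unfold_int(2), measurable)
  also have "\<dots> = unfold_int (\<lambda>B. \<integral>\<^sup>+x. \<Phi> x B \<partial>N)"
    unfolding unfold_int_def
  proof (rule nn_integral_cong, rule nn_integral_count_space_nn_integral[OF countable_group])
    fix K \<gamma>
    show "(\<lambda>x. \<Phi> x (sec K ** \<gamma>)) \<in> borel_measurable N"
      using measurable_compose[OF measurable_Pair2'[of "sec K ** \<gamma>" borel N] assms(2)] by simp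
  qed
  finally show ?thesis .
qed

text \<open>This is the Fubini proof of the uniqueness of Haar measure. For each \<open>A\<close> the left invariance of
  \<open>unfold_int\<close> moves the normalization of \<open>A\<close> from \<open>F\<close> to \<open>H\<close>; the inversion and right invariance
  of Lebesgue measure then separate the two variables.\<close>

lemma unfold_int_double:
  assumes [measurable]: "F \<in> borel_measurable borel" "H \<in> borel_measurable borel"
  shows "unfold_int H * (\<integral>\<^sup>+A. indicator {0<..} (det A) * F A \<partial>lborel) =
    2 * (\<integral>\<^sup>+A. indicator {0<..1} (det A) * H (normalize_det A) \<partial>lborel) *
        (\<integral>\<^sup>+t. indicator {0<..} t * ennreal t * unfold_int (\<lambda>A. F (sqrt t *\<^sub>R A)) \<partial>lborel)"
proof -
  let ?P = "\<lambda>A::real^2^2. indicator {0<..} (det A) :: ennreal"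
  have sf: "sigma_finite_measure (lborel :: (real^2^2) measure)" ..
  have "unfold_int H * (\<integral>\<^sup>+A. ?P A * F A \<partial>lborel) = unfold_int (\<lambda>B. (\<integral>\<^sup>+A. ?P A * F A \<partial>lborel) * H B)"
    using unfold_int_cmult[of H "\<integral>\<^sup>+A. ?P A * F A \<partial>lborel"] by (simp only: mult.commute assms)
  also have "\<dots> = unfold_int (\<lambda>B. \<integral>\<^sup>+A. ?P A * (H B * F (A ** B)) \<partial>lborel)"
  proof (rule unfold_int_cong)
    fix B :: "real^2^2" assume B: "det B = 1"
    have "(\<integral>\<^sup>+A. ?P A * F A \<partial>lborel) = (\<integral>\<^sup>+A. ?P A * F (A ** B) \<partial>lborel)"
      using nn_integral_mat_right[of "\<lambda>A. ?P A * F A" B] B by (simp add: det_mul)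
    then have "(\<integral>\<^sup>+A. ?P A * F A \<partial>lborel) * H B = H B * (\<integral>\<^sup>+A. ?P A * F (A ** B) \<partial>lborel)"
      by (simp add: mult.commute)
    also have "\<dots> = (\<integral>\<^sup>+A. H B * (?P A * F (A ** B)) \<partial>lborel)"
      by (rule nn_integral_cmult[symmetric]) simp
    finally show "(\<integral>\<^sup>+A. ?P A * F A \<partial>lborel) * H B = (\<integral>\<^sup>+A. ?P A * (H B * F (A ** B)) \<partial>lborel)"
      by (simp add: mult_ac)
  qed
  also have "\<dots> = (\<integral>\<^sup>+A. unfold_int (\<lambda>B. ?P A * (H B * F (A ** B))) \<partial>lborel)"
    by (rule unfold_int_swap[OF sf, symmetric]) measurable
  also have "\<dots> = (\<integral>\<^sup>+A. unfold_int (\<lambda>B. ?P A * (H (normalize_det (adj A) ** B) * F (sqrt (det A) *\<^sub>R B))) \<partial>lborel)"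
  proof (rule nn_integral_cong)
    fix A :: "real^2^2"
    show "unfold_int (\<lambda>B. ?P A * (H B * F (A ** B))) =
       unfold_int (\<lambda>B. ?P A * (H (normalize_det (adj A) ** B) * F (sqrt (det A) *\<^sub>R B)))"
    proof (cases "det A > 0")
      case True
      let ?g = "normalize_det (adj A)"
      have "A ** ?g = (1 / sqrt (det A)) *\<^sub>R (A ** adj A)"
        by (simp add: normalize_det_def mat2_eq_iff mat2_mult_nth add_divide_distrib diff_divide_distrib)
      also have "\<dots> = sqrt (det A) *\<^sub>R mat 1"
        using True by (simp add: mult_adj real_div_sqrt)
      finally have g: "A ** ?g = sqrt (det A) *\<^sub>R mat 1" .
      have g: "A ** (?g ** B) = sqrt (det A) *\<^sub>R B" for B :: "real^2^2"
      proof -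
        have "A ** (?g ** B) = (sqrt (det A) *\<^sub>R mat 1) ** B" using g by (simp add: matrix_mul_assoc)
        also have "\<dots> = sqrt (det A) *\<^sub>R B" unfolding mat2_eq_iff mat2_mult_nth by (simp add: mat_def)
        finally show ?thesis .
      qed
      have "unfold_int (\<lambda>B. ?P A * (H B * F (A ** B))) = 
        unfold_int (\<lambda>B. ?P A * (H (?g ** B) * F (A ** (?g ** B))))"
        by (rule unfold_int_left[symmetric]) (use True in \<open>auto simp: det_normalize\<close>)
      then show ?thesis by (simp add: g)
    next
      case False
      then have "?P A = 0" by simp
      then show ?thesis by (simp only: mult_zero_left)
    qed
  qed
  also have "\<dots> = unfold_int (\<lambda>B. \<integral>\<^sup>+A. ?P A * (H (normalize_det (adj A) ** B) * F (sqrt (det A) *\<^sub>R B)) \<partial>lborel)"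
    by (rule unfold_int_swap[OF sf]) measurable
  also have "\<dots> = unfold_int (\<lambda>B. \<integral>\<^sup>+A. ?P A * (H (normalize_det A) * F (sqrt (det A) *\<^sub>R B)) \<partial>lborel)"
  proof (rule unfold_int_cong)
    fix B :: "real^2^2" assume B: "det B = 1"
    have "(\<integral>\<^sup>+A. ?P A * (H (normalize_det (adj A) ** B) * F (sqrt (det A) *\<^sub>R B)) \<partial>lborel)
       = (\<integral>\<^sup>+A. ?P A * (H (normalize_det A ** B) * F (sqrt (det A) *\<^sub>R B)) \<partial>lborel)"
      using nn_integral_adj[of "\<lambda>A. ?P A * (H (normalize_det A ** B) * F (sqrt (det A) *\<^sub>R B))"] by simp
    also have "\<dots> = (\<integral>\<^sup>+A. ?P A * (H (normalize_det A) * F (sqrt (det A) *\<^sub>R B)) \<partial>lborel)"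
      using nn_integral_mat_right[of "\<lambda>A. ?P A * (H (normalize_det A) * F (sqrt (det A) *\<^sub>R B))" B] B
      by (simp add: det_mul normalize_mult)
    finally show "(\<integral>\<^sup>+A. ?P A * (H (normalize_det (adj A) ** B) * F (sqrt (det A) *\<^sub>R B)) \<partial>lborel)
      = (\<integral>\<^sup>+A. ?P A * (H (normalize_det A) * F (sqrt (det A) *\<^sub>R B)) \<partial>lborel)" .
  qed
  also have "\<dots> = (\<integral>\<^sup>+A. unfold_int (\<lambda>B. ?P A * (H (normalize_det A) * F (sqrt (det A) *\<^sub>R B))) \<partial>lborel)"
    by (rule unfold_int_swap[OF sf, symmetric]) measurable
  also have "\<dots> = (\<integral>\<^sup>+A. ?P A * H (normalize_det A) * unfold_int (\<lambda>B. F (sqrt (det A) *\<^sub>R B)) \<partial>lborel)"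
    by (simp add: unfold_int_cmult mult.assoc)
  also have "\<dots> = 2 * (\<integral>\<^sup>+A. indicator {0<..1} (det A) * H (normalize_det A) \<partial>lborel) *
        (\<integral>\<^sup>+t. indicator {0<..} t * ennreal t * unfold_int (\<lambda>A. F (sqrt t *\<^sub>R A)) \<partial>lborel)"
    by (rule nn_integral_det) (measurable, rule measurable_unfold_int, measurable)
  finally show ?thesis .
qed

end

lemma emeasure_lborel_open_pos:
  fixes U :: "'a::euclidean_space set"
  assumes "open U" "x \<in> U" shows "emeasure lborel U > 0"
proof -
  obtain r where r: "r > 0" "ball x r \<subseteq> U" using assms open_contains_ball by blast
  have "0 < emeasure lborel (ball x r)" using r by (simp add: emeasure_ball)
  also have "\<dots> \<le> emeasure lborel U" using r assms by (intro emeasure_mono) auto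
  finally show ?thesis .
qed

lemma adj_scaleR: "adj (c *\<^sub>R A) = c *\<^sub>R adj A"
  by (simp add: mat2_eq_iff)

lemma mat_uminus_mult: "(- A) ** B = - (A ** B)" for A B :: "real^2^2"
  by (simp add: mat2_eq_iff mat2_mult_nth)

context lattice_measure
begin

text \<open>Any nonnegative \<open>H\<close> with \<open>0 < window_const < \<infinity>\<close> would do here.\<close>

definition window :: "real^2^2 \<Rightarrow> ennreal" where
  "window = indicator (cball 0 3)"

lemma measurable_window [measurable]: "window \<in> borel_measurable borel"
  unfolding window_def by (rule borel_measurable_indicator) simp

definition window_const :: ennreal where
  "window_const = (\<integral>\<^sup>+A. indicator {0<..1} (det A) * window (normalize_det A) \<partial>lborel)"

lemma window_const_finite: "window_const < \<infinity>"
proof -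
  have "norm A \<le> 3" if "0 < det A" "det A \<le> 1" "norm (normalize_det A) \<le> 3" for A :: "real^2^2"
  proof -
    have "norm A = sqrt (det A) * norm (normalize_det A)" using that by (simp add: normalize_det_def)
    also have "\<dots> \<le> 1 * 3" using that by (intro mult_mono) auto
    finally show ?thesis by simp
  qed
  then have "window_const \<le> (\<integral>\<^sup>+A. indicator (cball 0 3) (A::real^2^2) \<partial>lborel)"
    unfolding window_const_def window_def by (intro nn_integral_mono) (auto simp: indicator_def)
  also have "\<dots> < \<infinity>" using emeasure_lborel_cball_finite[of "0::real^2^2" 3] by simp
  finally show ?thesis .
qed

lemma window_const_pos: "window_const > 0"
proof -
  define U where "U = {A :: real^2^2. 0 < det A} \<inter> {A. det A < 1} \<inter> {A. norm A < 3 * sqrt (det A)}"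
  have "open U" unfolding U_def det_2
    by (intro open_Int open_Collect_less continuous_intros)
  moreover have "(1/2) *\<^sub>R mat 1 \<in> U"
  proof -
    let ?A = "(1/2) *\<^sub>R mat 1 :: real^2^2"
    have d: "det ?A = (1/2)\<^sup>2" by (simp add: det_2 mat_def power2_eq_square)
    have "norm ?A \<le> 1" using norm_mat2_le[of ?A] by (simp add: mat_def)
    moreover have "sqrt (det ?A) = 1 / 2" unfolding d by simp
    ultimately have "norm ?A < 3 * sqrt (det ?A)" by linarith
    moreover have "0 < det ?A" "det ?A < 1" unfolding d by (simp_all add: power2_eq_square)
    ultimately show ?thesis unfolding U_def by blast
  qed
  ultimately have "0 < emeasure lborel U" by (rule emeasure_lborel_open_pos)
  also have "emeasure lborel U = (\<integral>\<^sup>+A. indicator U A \<partial>lborel)" using \<open>open U\<close> by simp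
  also have "\<dots> \<le> window_const" unfolding window_const_def window_def
    by (intro nn_integral_mono) (auto simp: indicator_def U_def normalize_det_def divide_simps mult.commute)
  finally show ?thesis .
qed

definition orbit_count :: "complex set \<Rightarrow> ennreal" where
  "orbit_count F = unfold_int (\<lambda>A. indicator F (act (adj A) \<i>))"

lemma window_area:
  assumes F[measurable]: "F \<in> sets borel" and sub: "F \<subseteq> upper_half"
  shows "unfold_int window * (ennreal (pi / 2) * hyp_area F) = window_const * orbit_count F"
proof -
  let ?F = "\<lambda>A::real^2^2. indicator {0<..1} (det A) * indicator F (act (adj A) \<i>) :: ennreal"
  have 1: "(\<integral>\<^sup>+A. indicator {0<..} (det A) * ?F A \<partial>lborel) = ennreal (pi / 2) * hyp_area F"
  proof -
    have "(\<integral>\<^sup>+A. indicator {0<..} (det A) * ?F A \<partial>lborel) = (\<integral>\<^sup>+A. ?F A \<partial>lborel)"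
      by (intro nn_integral_cong) (auto simp: indicator_def)
    also have "\<dots> = (\<integral>\<^sup>+A. indicator {0<..1} (det A) * indicator F (act A \<i>) \<partial>lborel)"
      using nn_integral_adj[of "\<lambda>A. indicator {0<..1} (det A) * indicator F (act A \<i>)"] by simp
    finally show ?thesis using nn_integral_act_imaginary_unit[OF assms] by simp
  qed
  have 2: "unfold_int (\<lambda>A. ?F (sqrt t *\<^sub>R A)) = indicator {..1} t * orbit_count F" if t: "t > 0" for t
  proof -
    have "unfold_int (\<lambda>A. ?F (sqrt t *\<^sub>R A)) = unfold_int (\<lambda>A. indicator {..1} t * indicator F (act (adj A) \<i>))"
      using t by (intro unfold_int_cong) (simp add: det_scaleR2 adj_scaleR act_scaleR indicator_def)
    also have "\<dots> = indicator {..1} t * orbit_count F" unfolding orbit_count_def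
      by (rule unfold_int_cmult) measurable
    finally show ?thesis .
  qed
  have "(\<integral>\<^sup>+t. indicator {0<..} t * ennreal t * unfold_int (\<lambda>A. ?F (sqrt t *\<^sub>R A)) \<partial>lborel)
    = (\<integral>\<^sup>+t. (ennreal t * indicator {0..1} t) * orbit_count F \<partial>lborel)"
    using 2 by (intro nn_integral_cong) (auto simp: indicator_def not_less)
  also have "\<dots> = (\<integral>\<^sup>+t. ennreal t * indicator {0..1} t \<partial>lborel) * orbit_count F"
    by (rule nn_integral_multc) measurable
  also have "(\<integral>\<^sup>+t. ennreal t * indicator {0..1} t \<partial>lborel) = ennreal (1\<^sup>2 / 2 - 0\<^sup>2 / (2::real))"
    by (rule nn_integral_FTC_Icc) (auto intro!: derivative_eq_intros)
  finally have 3: "(\<integral>\<^sup>+t. indicator {0<..} t * ennreal t * unfold_int (\<lambda>A. ?F (sqrt t *\<^sub>R A)) \<partial>lborel)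
    = ennreal (1/2) * orbit_count F" by simp
  have "unfold_int window * (ennreal (pi / 2) * hyp_area F) = 2 * window_const * (ennreal (1/2) * orbit_count F)"
    using unfold_int_double[of ?F window] unfolding 1 3 window_const_def by simp
  also have "\<dots> = (2 * ennreal (1/2)) * (window_const * orbit_count F)" by (simp only: mult_ac)
  also have "2 * ennreal (1/2) = 1" using ennreal_mult'[of 2 "1/2"] by simp
  finally show ?thesis by simp
qed

lemma AE_not_special: "AE K in \<mu>. act (adj (sec K)) \<i> \<notin> special_points"
proof -
  have B: "special_points \<in> sets borel"
    by (rule sets.countable[OF _ countable_special_points]) simp
  note [measurable] = B
  have "hyp_area special_points = 0"
  proof -
    have "AE z in lborel. z \<notin> special_points"
      using countable_special_points countable_imp_null_set_lborel AE_not_in by blast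
    then show ?thesis unfolding hyp_area_def
      by (subst nn_integral_0_iff_AE) (auto elim!: AE_mp)
  qed
  then have "window_const * orbit_count special_points = 0"
    using window_area[OF B] by (auto simp: special_points_def)
  then have "orbit_count special_points = 0" using window_const_pos by (metis less_irrefl mult_eq_0_iff)
  then have "AE K in \<mu>. (\<integral>\<^sup>+\<gamma>. indicator special_points (act (adj (sec K ** \<gamma>)) \<i>) \<partial>count_space \<Gamma>) = (0::ennreal)"
    unfolding orbit_count_def unfold_int_def by (subst (asm) nn_integral_0_iff_AE) measurable
  then show ?thesis
  proof eventually_elim
    fix K assume "(\<integral>\<^sup>+\<gamma>. indicator special_points (act (adj (sec K ** \<gamma>)) \<i>) \<partial>count_space \<Gamma>) = (0::ennreal)"
    then have "\<forall>\<gamma>\<in>\<Gamma>. indicator special_points (act (adj (sec K ** \<gamma>)) \<i>) = (0::ennreal)"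
      by (subst (asm) nn_integral_0_iff_AE) (auto simp: AE_count_space)
    from bspec[OF this one_mem] show "act (adj (sec K)) \<i> \<notin> special_points"
      by (simp add: indicator_def split: if_splits)
  qed
qed

end

locale lattice_neg = lattice_measure +
  assumes neg_mem: "- mat 1 \<in> \<Gamma>"
begin

lemma uminus_mem: "\<gamma> \<in> \<Gamma> \<Longrightarrow> - \<gamma> \<in> \<Gamma>"
  using mult_mem[OF neg_mem, of \<gamma>] by (simp add: mat_uminus_mult)

lemma orbit_count_fundamental:
  assumes F: "fundamental_set \<Gamma> F"
  shows "orbit_count F = 2"
proof -
  have i: "\<i> \<in> upper_half" by (simp add: upper_half_def)
  have "orbit_count F = (\<integral>\<^sup>+K. 2 \<partial>\<mu>)"
    unfolding orbit_count_def unfold_int_def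
  proof (rule nn_integral_cong_AE, use AE_not_special AE_space in eventually_elim)
    fix K assume K: "act (adj (sec K)) \<i> \<notin> special_points" "K \<in> space \<mu>"
    let ?z = "act (adj (sec K)) \<i>"
    have z: "?z \<in> upper_half" using K i by (simp add: act_upper_half sec_space)
    obtain w \<gamma>0 where w: "w \<in> F" "\<gamma>0 \<in> \<Gamma>" "w = act \<gamma>0 ?z"
      and uniq: "\<And>v \<gamma>. v \<in> F \<Longrightarrow> \<gamma> \<in> \<Gamma> \<Longrightarrow> v = act \<gamma> ?z \<Longrightarrow> v = w"
      using F z unfolding fundamental_set_def by metis
    have iff: "act \<gamma> ?z \<in> F \<longleftrightarrow> \<gamma> \<in> {\<gamma>0, - \<gamma>0}" if g: "\<gamma> \<in> \<Gamma>" for \<gamma>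
    proof
      assume "act \<gamma> ?z \<in> F"
      then have "act \<gamma> ?z = act \<gamma>0 ?z" using uniq g w by blast
      then have "act (adj \<gamma>0 ** \<gamma>) ?z = ?z" using w g z by (simp add: act_mult act_adj_act det_mem)
      then have "adj \<gamma>0 ** \<gamma> = mat 1 \<or> adj \<gamma>0 ** \<gamma> = - mat 1"
        using K(1) z mult_mem[OF adj_mem[OF w(2)] g] by (auto simp: special_points_def)
      moreover have "\<gamma> = \<gamma>0 ** (adj \<gamma>0 ** \<gamma>)" using w by (simp add: matrix_mul_assoc adj_inverse det_mem)
      moreover have "\<gamma>0 ** (- mat 1) = - \<gamma>0" by (simp add: mat2_eq_iff mat2_mult_nth mat_def)
      ultimately show "\<gamma> \<in> {\<gamma>0, - \<gamma>0}" by (metis insert_iff matrix_mul_rid)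
    qed (use w in \<open>auto simp: act_uminus\<close>)
    have ne: "\<gamma>0 \<noteq> - \<gamma>0"
    proof
      assume "\<gamma>0 = - \<gamma>0"
      then have "\<gamma>0 = 0" by (simp add: eq_neg_iff_add_eq_0 flip: scaleR_2)
      then show False using det_mem[OF w(2)] by (simp add: det_2)
    qed
    have "(\<integral>\<^sup>+\<gamma>. indicator F (act (adj (sec K ** \<gamma>)) \<i>) \<partial>count_space \<Gamma>)
      = (\<integral>\<^sup>+\<gamma>. indicator F (act (adj \<gamma>) ?z) \<partial>count_space \<Gamma>)"
      using K i by (intro nn_integral_cong) (simp add: adj_mult act_mult sec_space)
    also have "\<dots> = (\<integral>\<^sup>+\<gamma>. indicator F (act \<gamma> ?z) \<partial>count_space \<Gamma>)"
      by (rule nn_integral_bij_count_space[OF bij_adj])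
    also have "\<dots> = (\<Sum>\<gamma>\<in>{\<gamma>0, - \<gamma>0}. indicator F (act \<gamma> ?z))"
      using iff w uminus_mem by (intro nn_integral_count_space') auto
    also have "\<dots> = 2" using ne w by (simp add: act_uminus)
    finally show "(\<integral>\<^sup>+\<gamma>. indicator F (act (adj (sec K ** \<gamma>)) \<i>) \<partial>count_space \<Gamma>) = (2::ennreal)" .
  qed
  then show ?thesis using emeasure_space_mu by simp
qed

lemma c_lat_window:
  shows "c_lat \<Gamma> > 0" and "unfold_int window = 2 * window_const * ennreal (c_lat \<Gamma>)"
proof -
  obtain C where C: "C > 0" "window_const = ennreal C"
    using window_const_pos window_const_finite that[of "enn2real window_const"]
    by (simp add: enn2real_positive_iff)
  obtain F where F: "fundamental_set \<Gamma> F" using fundamental_set_exists by blast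
  have *: "unfold_int window * (ennreal (pi / 2) * hyp_area F) = ennreal (2 * C)" if "fundamental_set \<Gamma> F" for F
    using window_area[of F] that orbit_count_fundamental[OF that] C
    by (simp add: fundamental_set_def ennreal_mult' mult.commute)
  have fin: "unfold_int window \<noteq> \<infinity>"
  proof
    assume "unfold_int window = \<infinity>"
    then show False using *[OF F] C by (cases "hyp_area F = 0") (auto simp: ennreal_top_mult)
  qed
  then obtain h where h: "unfold_int window = ennreal h" "h \<ge> 0" by (cases "unfold_int window") auto
  have h0: "h > 0" using *[OF F] h C by (cases "h = 0") auto
  have V: "hyp_area F = ennreal (4 * C / (pi * h))" if "fundamental_set \<Gamma> F" for F
  proof -
    have "hyp_area F \<noteq> \<infinity>"
    proof
      assume "hyp_area F = \<infinity>"
      then show False using *[OF that] h h0 C by (simp add: ennreal_mult_top)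
    qed
    then obtain v where v: "hyp_area F = ennreal v" "v \<ge> 0" by (cases "hyp_area F") auto
    have "ennreal (h * (pi / 2 * v)) = ennreal (2 * C)"
    proof -
      have "ennreal (h * (pi / 2 * v)) = ennreal h * (ennreal (pi / 2) * ennreal v)"
        using h v by (subst ennreal_mult', simp, subst ennreal_mult') simp_all
      then show ?thesis using *[OF that] v h by simp
    qed
    then have "h * (pi / 2 * v) = 2 * C" using v h C by (subst (asm) ennreal_inj) auto
    then have "v = 4 * C / (pi * h)" using h0 by (simp add: field_simps)
    then show ?thesis using v by simp
  qed
  have "(THE V. \<exists>F. fundamental_set \<Gamma> F \<and> V = hyp_area F) = ennreal (4 * C / (pi * h))"
    using F V by (intro the_equality) auto
  then have q: "quotient_area \<Gamma> = 4 * C / (pi * h)" using C h0 by (simp add: quotient_area_def)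
  have c: "c_lat \<Gamma> = h / (2 * C)" unfolding c_lat_def q using C h0 by (simp add: field_simps)
  then show "c_lat \<Gamma> > 0" using C h0 by simp
  show "unfold_int window = 2 * window_const * ennreal (c_lat \<Gamma>)"
  proof -
    have "ennreal h = ennreal (2 * C * c_lat \<Gamma>)" using c C by simp
    also have "\<dots> = 2 * window_const * ennreal (c_lat \<Gamma>)" using C by (simp add: ennreal_mult')
    finally show ?thesis using h by simp
  qed
qed

theorem unfolding_formula:
  assumes [measurable]: "F \<in> borel_measurable borel"
  shows "(\<integral>\<^sup>+t. indicator {0<..} t * ennreal t * unfold_int (\<lambda>A. F (sqrt t *\<^sub>R A)) \<partial>lborel)
    = ennreal (c_lat \<Gamma>) * (\<integral>\<^sup>+A. indicator {0<..} (det A) * F A \<partial>lborel)"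
proof -
  have "2 * window_const * (\<integral>\<^sup>+t. indicator {0<..} t * ennreal t * unfold_int (\<lambda>A. F (sqrt t *\<^sub>R A)) \<partial>lborel)
    = 2 * window_const * (ennreal (c_lat \<Gamma>) * (\<integral>\<^sup>+A. indicator {0<..} (det A) * F A \<partial>lborel))"
    using unfold_int_double[of F window] c_lat_window(2) by (simp add: window_const_def mult.assoc)
  moreover have "2 * window_const \<noteq> 0" "2 * window_const \<noteq> \<infinity>"
    using window_const_pos window_const_finite by (auto simp: ennreal_mult_eq_top_iff)
  ultimately show ?thesis by (simp add: ennreal_mult_cancel_left)
qed

end

section \<open>Plane geometry\<close>

lemma wedge_mult: "wedge (A *v x) (A *v y) = det A * wedge x y"
  by (simp add: wedge_eq mat2_vec_nth det_2 algebra_simps)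

lemma wedge_uminus [simp]: "wedge (- x) y = - wedge x y" "wedge x (- y) = - wedge x y"
  by (simp_all add: wedge_eq algebra_simps)

lemma wedge_self [simp]: "wedge x x = 0"
  by (simp add: wedge_eq)

lemma vec2_eq_iff: "(x::real^2) = y \<longleftrightarrow> x$1 = y$1 \<and> x$2 = y$2"
  by (simp add: vec_eq_iff forall_2)

lemma wedge_eq_0_parallel:
  assumes "wedge x y = 0" "x \<noteq> 0"
  obtains s where "y = s *\<^sub>R x"
proof -
  have *: "x$1 * y$2 = y$1 * x$2" using assms by (simp add: wedge_eq)
  show ?thesis
  proof (cases "x$1 = 0")
    case False
    then show ?thesis using that[of "y$1 / x$1"] * by (simp add: vec2_eq_iff field_simps)
  next
    case True
    then have "x$2 \<noteq> 0" using assms by (simp add: vec2_eq_iff)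
    then show ?thesis using that[of "y$2 / x$2"] * True by (simp add: vec2_eq_iff field_simps)
  qed
qed

lemma mat_vec_scaleR [simp]: "(A::real^2^2) *v (c *\<^sub>R x) = c *\<^sub>R (A *v x)"
    "(c *\<^sub>R (A::real^2^2)) *v x = c *\<^sub>R (A *v x)"
  by (simp_all add: vec2_eq_iff mat2_vec_nth algebra_simps)

lemma mat_vec_uminus: "(A::real^2^2) *v (- x) = - (A *v x)" "(- A) *v x = - (A *v x)"
  by (simp_all add: vec2_eq_iff mat2_vec_nth)

lemma adj_mult_vec: "det A = 1 \<Longrightarrow> adj A *v (A *v x) = x" "det A = 1 \<Longrightarrow> A *v (adj A *v x) = x"
  by (simp_all add: matrix_vector_mul_assoc adj_inverse)

definition shear :: "real \<Rightarrow> real^2 \<Rightarrow> real^2^2" where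
  "shear k v = of_cols (vector [1 - k * v$1 * v$2, - k * v$2 * v$2], vector [k * v$1 * v$1, 1 + k * v$1 * v$2])"

lemma shear_nth: "shear k v $ 1 $ 1 = 1 - k * v$1 * v$2" "shear k v $ 1 $ 2 = k * v$1 * v$1"
  "shear k v $ 2 $ 1 = - k * v$2 * v$2" "shear k v $ 2 $ 2 = 1 + k * v$1 * v$2"
  by (simp_all add: shear_def vector_def)

lemma shear_vec: "shear k v *v x = x + (k * wedge v x) *\<^sub>R v"
  by (simp add: vec2_eq_iff mat2_vec_nth shear_nth wedge_eq algebra_simps)

lemma det_shear [simp]: "det (shear k v) = 1"
  by (simp add: det_2 shear_nth algebra_simps)

lemma shear_mult: "shear j v ** shear k v = shear (j + k) v"
  by (simp add: mat2_eq_iff mat2_mult_nth shear_nth algebra_simps)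

lemma shear_0 [simp]: "shear 0 v = mat 1"
  by (simp add: mat2_eq_iff shear_nth mat_def)

lemma adj_shear: "adj (shear k v) = shear (- k) v"
  by (simp add: mat2_eq_iff shear_nth)

lemma stabilizer_shear:
  assumes det: "det A = 1" and v: "v \<noteq> 0" "A *v v = v"
  obtains k where "A = shear k v"
proof -
  have e: "A$1$1 * v$1 + A$1$2 * v$2 = v$1" "A$2$1 * v$1 + A$2$2 * v$2 = v$2"
    using v(2) by (simp_all add: vec2_eq_iff mat2_vec_nth)
  have d: "A$1$1 * A$2$2 - A$1$2 * A$2$1 = 1" using det by (simp add: det_2)
  show ?thesis
  proof (cases "v$1 = 0")
    case False
    define k where "k = A$1$2 / (v$1 * v$1)"
    have b: "A$1$2 = k * v$1 * v$1" using False by (simp add: k_def)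
    have "(A$1$1 - (1 - k * v$1 * v$2)) * v$1 = 0" using e(1) unfolding b by (simp add: algebra_simps)
    then have a: "A$1$1 = 1 - k * v$1 * v$2" using False by simp
    have "A$2$2 - k * v$1 * v$2 * A$2$2 - k * v$1 * (A$2$1 * v$1) = 1"
      using d unfolding a b by (simp add: algebra_simps)
    moreover have "A$2$1 * v$1 = v$2 - A$2$2 * v$2" using e(2) by simp
    ultimately have "A$2$2 - k * v$1 * v$2 * A$2$2 - k * v$1 * (v$2 - A$2$2 * v$2) = 1" by metis
    then have dd: "A$2$2 = 1 + k * v$1 * v$2" by (simp add: algebra_simps)
    have "(A$2$1 + k * v$2 * v$2) * v$1 = 0" using e(2) unfolding dd by (simp add: algebra_simps)
    then have "A$2$1 = - k * v$2 * v$2" using False by simp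
    then show ?thesis using that[of k] a b dd by (simp add: mat2_eq_iff shear_nth)
  next
    case True
    then have v2: "v$2 \<noteq> 0" using v by (simp add: vec2_eq_iff)
    then have "A$1$2 = 0" "A$2$2 = 1" using e True by auto
    then have "A$1$1 = 1" using d by simp
    then show ?thesis using that[of "- A$2$1 / (v$2 * v$2)"] \<open>A$1$2 = 0\<close> \<open>A$2$2 = 1\<close> True v2
      by (simp add: mat2_eq_iff shear_nth)
  qed
qed

text \<open>The slopes of two non-parallel points of the set differ by at least \<open>\<eta> / R\<^sup>2\<close>.\<close>

lemma card_separated_directions_aux:
  fixes S :: "(real^2) set" and i j :: 2
  assumes \<eta>: "\<eta> > 0" and R: "R > 0"
    and S: "\<And>p. p \<in> S \<Longrightarrow> p \<noteq> 0 \<and> norm p \<le> R \<and> \<bar>p$j\<bar> \<le> \<bar>p$i\<bar>"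
    and ij: "\<And>p q. \<bar>wedge p q\<bar> = \<bar>p$i * q$j - p$j * q$i\<bar>" "\<And>p. p$i = 0 \<Longrightarrow> p$j = 0 \<Longrightarrow> p = (0::real^2)"
    and sep: "\<And>p q. p \<in> S \<Longrightarrow> q \<in> S \<Longrightarrow> q \<noteq> p \<Longrightarrow> q \<noteq> - p \<Longrightarrow> \<bar>wedge p q\<bar> \<ge> \<eta>"
  shows "finite S \<and> real (card S) \<le> 4 * (R\<^sup>2 / \<eta>) + 6"
proof -
  define L where "L = R\<^sup>2 / \<eta>"
  have L: "L > 0" using \<eta> R by (simp add: L_def)
  define N where "N = \<lceil>L\<rceil>"
  define g where "g p = (\<lfloor>p$j / p$i * L\<rfloor>, p$i > 0)" for p :: "real^2"
  have pi: "p$i \<noteq> 0" if "p \<in> S" for p using S[OF that] ij(2)[of p] by auto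
  have "inj_on g S"
  proof (rule inj_onI)
    fix p q assume pq: "p \<in> S" "q \<in> S" "g p = g q"
    have "\<bar>p$j / p$i * L - q$j / q$i * L\<bar> < 1"
      using pq(3) floor_correct[of "p$j / p$i * L"] floor_correct[of "q$j / q$i * L"]
      unfolding g_def by simp linarith
    then have "\<bar>p$j / p$i - q$j / q$i\<bar> * L < 1"
      by (simp only: left_diff_distrib[symmetric] abs_mult abs_of_pos[OF L])
    then have s: "\<bar>p$j / p$i - q$j / q$i\<bar> < \<eta> / R\<^sup>2"
      using \<eta> R by (simp add: L_def field_simps)
    have "\<bar>p$i\<bar> \<le> R" "\<bar>q$i\<bar> \<le> R"
      using S[OF pq(1)] S[OF pq(2)] component_le_norm_cart[of p i] component_le_norm_cart[of q i] by auto
    then have "\<bar>p$i\<bar> * \<bar>q$i\<bar> \<le> R\<^sup>2" using R by (simp add: power2_eq_square mult_mono)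
    moreover have "\<bar>p$i * q$j - p$j * q$i\<bar> = (\<bar>p$i\<bar> * \<bar>q$i\<bar>) * \<bar>p$j / p$i - q$j / q$i\<bar>"
    proof -
      have "p$i * q$j - p$j * q$i = - ((p$i * q$i) * (p$j / p$i - q$j / q$i))"
        using pi[OF pq(1)] pi[OF pq(2)] by (simp add: field_simps)
      then show ?thesis by (simp add: abs_mult)
    qed
    ultimately have "\<bar>wedge p q\<bar> \<le> R\<^sup>2 * \<bar>p$j / p$i - q$j / q$i\<bar>"
      unfolding ij(1) by (simp add: mult_right_mono)
    also have "\<dots> < R\<^sup>2 * (\<eta> / R\<^sup>2)" using s R by (intro mult_strict_left_mono) auto
    finally have "\<bar>wedge p q\<bar> < \<eta>" using R by simp
    then have "q = p \<or> q = - p" using sep[OF pq(1,2)] by force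
    then show "p = q" using pq(3) pi[OF pq(1)] by (auto simp: g_def)
  qed
  moreover have img: "g ` S \<subseteq> {-N..N} \<times> UNIV"
  proof
    fix z assume "z \<in> g ` S"
    then obtain p where p: "p \<in> S" "z = g p" by blast
    have "\<bar>p$j / p$i\<bar> \<le> 1" using S[OF p(1)] pi[OF p(1)] by (simp add: divide_le_eq)
    then have "\<bar>p$j / p$i\<bar> * L \<le> 1 * L" using L by (intro mult_right_mono) auto
    then have "\<bar>p$j / p$i * L\<bar> \<le> L" by (simp only: abs_mult abs_of_pos[OF L] mult_1)
    then have "- L \<le> p$j / p$i * L" "p$j / p$i * L \<le> L" by (meson abs_le_iff minus_le_iff)+
    then have "- N \<le> \<lfloor>p$j / p$i * L\<rfloor>" "\<lfloor>p$j / p$i * L\<rfloor> \<le> N" unfolding N_def by linarith+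
    then show "z \<in> {-N..N} \<times> UNIV" using p by (simp add: g_def)
  qed
  ultimately have fin: "finite S" and "card S \<le> card ({-N..N} \<times> (UNIV::bool set))"
    using finite_imageD finite_subset[OF img] card_inj_on_le[OF _ img] by auto
  then have "card S \<le> nat (2 * N + 1) * 2" by (simp add: card_cartesian_product)
  then have "int (card S) \<le> int (nat (2 * N + 1) * 2)" by (simp only: of_nat_le_iff)
  also have "\<dots> = (2 * N + 1) * 2" using L by (simp add: N_def)
  finally have "int (card S) \<le> (2 * N + 1) * 2" .
  then have "real_of_int (int (card S)) \<le> real_of_int ((2 * N + 1) * 2)" by (simp only: of_int_le_iff)
  moreover have "of_int N \<le> L + 1" unfolding N_def by linarith
  ultimately have "real (card S) \<le> 4 * L + 6" by simp
  then show ?thesis using fin by (simp add: L_def)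
qed

lemma card_separated_directions:
  fixes S :: "(real^2) set"
  assumes \<eta>: "\<eta> > 0" and R: "R > 0"
    and S: "\<And>p. p \<in> S \<Longrightarrow> p \<noteq> 0 \<and> norm p \<le> R"
    and sep: "\<And>p q. p \<in> S \<Longrightarrow> q \<in> S \<Longrightarrow> q \<noteq> p \<Longrightarrow> q \<noteq> - p \<Longrightarrow> \<bar>wedge p q\<bar> \<ge> \<eta>"
  shows "finite S \<and> real (card S) \<le> 8 * (R\<^sup>2 / \<eta>) + 12"
proof -
  let ?S1 = "{p \<in> S. \<bar>p$2\<bar> \<le> \<bar>p$1\<bar>}" and ?S2 = "{p \<in> S. \<bar>p$1\<bar> \<le> \<bar>p$2\<bar>}"
  have 1: "finite ?S1 \<and> real (card ?S1) \<le> 4 * (R\<^sup>2 / \<eta>) + 6"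
    by (rule card_separated_directions_aux[OF \<eta> R, of _ 2 1])
       (use S sep in \<open>auto simp: wedge_eq vec2_eq_iff abs_minus_commute mult.commute\<close>)
  have 2: "finite ?S2 \<and> real (card ?S2) \<le> 4 * (R\<^sup>2 / \<eta>) + 6"
    by (rule card_separated_directions_aux[OF \<eta> R, of _ 1 2])
       (use S sep in \<open>auto simp: wedge_eq vec2_eq_iff abs_minus_commute mult.commute\<close>)
  have S: "S = ?S1 \<union> ?S2" by auto
  have "card S \<le> card ?S1 + card ?S2" using card_Un_le[of ?S1 ?S2, folded S] .
  then have "real (card S) \<le> real (card ?S1) + real (card ?S2)" by linarith
  moreover have "finite S" using finite_UnI[of ?S1 ?S2, folded S] 1 2 by blast
  ultimately show ?thesis using 1 2 by linarith
qed

section \<open>Scaled discrete orbits\<close>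

lemma nn_integral_count_space_infsum:
  fixes f :: "'a \<Rightarrow> real"
  assumes "\<And>x. x \<in> A \<Longrightarrow> 0 \<le> f x" "f summable_on A"
  shows "(\<integral>\<^sup>+x. ennreal (f x) \<partial>count_space A) = ennreal (infsum f A)"
proof -
  have "Infinite_Sum.abs_summable_on f A"
    using assms(2) summable_on_iff_abs_summable_on_real by blast
  then have "Infinite_Set_Sum.abs_summable_on f A"
    by (rule iffD1[OF abs_summable_equivalent])
  then show ?thesis
    using assms(1) by (simp add: nn_integral_conv_infsetsum infsetsum_infsum)
qed

lemma integrable_bounded_support:
  fixes h :: "'a::euclidean_space \<Rightarrow> real"
  assumes [measurable]: "h \<in> borel_measurable borel" and "bounded (range h)" "bounded {x. h x \<noteq> 0}"
  shows "integrable lborel h"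
proof -
  obtain M where M: "\<And>x. \<bar>h x\<bar> \<le> M" using assms(2) by (auto simp: bounded_iff)
  obtain R where R: "\<And>x. h x \<noteq> 0 \<Longrightarrow> norm x \<le> R" using assms(3) by (auto simp: bounded_iff)
  have "integrable lborel (\<lambda>x. M * indicator (cball (0::'a) R) x)"
    using emeasure_lborel_cball_finite[of "0::'a" R] by (intro integrable_mult_right integrable_real_indicator) auto
  then show ?thesis
  proof (rule Bochner_Integration.integrable_bound)
    show "AE x in lborel. norm (h x) \<le> norm (M * indicator (cball 0 R) x)"
    proof (rule AE_I2)
      fix x show "norm (h x) \<le> norm (M * indicator (cball 0 R) x)"
        using M[of x] R[of x] by (cases "h x = 0") (auto simp: indicator_def)
    qed
  qed simp
qed

lemma compact_support_bounded:
  fixes h :: "'a::euclidean_space \<Rightarrow> real"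
  shows "compact_support h \<longleftrightarrow> bounded {x. h x \<noteq> 0}"
  unfolding compact_support_def by simp

context lattice_neg
begin

definition scaled_orbit :: "(real^2) set \<Rightarrow> bool" where
  "scaled_orbit \<Lambda> \<longleftrightarrow> discrete_orbit \<Gamma> \<Lambda> \<and> scaled \<Gamma> \<mu> \<Lambda>"

lemma scaled_orbitE:
  assumes "scaled_orbit \<Lambda>"
  obtains v where "v \<noteq> 0" "v \<in> \<Lambda>" "\<Lambda> = (\<lambda>\<gamma>. \<gamma> *v v) ` \<Gamma>"
proof -
  obtain v where v: "v \<noteq> 0" "\<Lambda> = (\<lambda>\<gamma>. \<gamma> *v v) ` \<Gamma>"
    using assms by (auto simp: scaled_orbit_def discrete_orbit_def)
  moreover have "v \<in> \<Lambda>" unfolding v(2) using one_mem by (intro image_eqI[of _ _ "mat 1"]) auto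
  ultimately show ?thesis using that by blast
qed

context
  fixes \<Lambda> assumes orbit: "scaled_orbit \<Lambda>"
begin

lemma countable_orbit: "countable \<Lambda>"
  using scaled_orbitE[OF orbit] countable_group by (metis countable_image)

lemma orbit_nonzero: "x \<in> \<Lambda> \<Longrightarrow> x \<noteq> 0"
proof
  assume x: "x \<in> \<Lambda>" "x = 0"
  obtain v \<gamma> where v: "v \<noteq> 0" "\<gamma> \<in> \<Gamma>" "x = \<gamma> *v v" using scaled_orbitE[OF orbit] x by (metis imageE)
  then have "adj \<gamma> *v 0 = v" using x adj_mult_vec(1)[OF det_mem] by metis
  then show False using v by simp
qed

lemma orbit_mult:
  assumes g: "\<gamma> \<in> \<Gamma>" "x \<in> \<Lambda>" shows "\<gamma> *v x \<in> \<Lambda>"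
proof -
  obtain v where v: "\<Lambda> = (\<lambda>\<gamma>. \<gamma> *v v) ` \<Gamma>" using scaled_orbitE[OF orbit] by metis
  then obtain \<delta> where "\<delta> \<in> \<Gamma>" "x = \<delta> *v v" using g by auto
  then show ?thesis using g unfolding v
    by (auto simp: matrix_vector_mul_assoc intro!: imageI mult_mem)
qed

lemma orbit_transitive:
  assumes "x \<in> \<Lambda>" "y \<in> \<Lambda>" obtains \<gamma> where "\<gamma> \<in> \<Gamma>" "y = \<gamma> *v x"
proof -
  obtain v where v: "\<Lambda> = (\<lambda>\<gamma>. \<gamma> *v v) ` \<Gamma>" using scaled_orbitE[OF orbit] by metis
  obtain \<alpha> \<beta> where a: "\<alpha> \<in> \<Gamma>" "x = \<alpha> *v v" "\<beta> \<in> \<Gamma>" "y = \<beta> *v v" using assms v by auto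
  then have "y = \<beta> *v (adj \<alpha> *v x)" by (simp add: adj_mult_vec det_mem)
  then have "y = (\<beta> ** adj \<alpha>) *v x" by (simp only: matrix_vector_mul_assoc)
  then show ?thesis using that[of "\<beta> ** adj \<alpha>"] a mult_mem adj_mem by blast
qed

lemma orbit_eq: "x \<in> \<Lambda> \<Longrightarrow> \<Lambda> = (\<lambda>\<gamma>. \<gamma> *v x) ` \<Gamma>"
  using orbit_transitive orbit_mult by (auto simp: image_iff) metis

lemma orbit_uminus: "x \<in> \<Lambda> \<Longrightarrow> - x \<in> \<Lambda>"
  using orbit_mult[OF neg_mem, of x] by (simp add: mat_vec_uminus)

lemma bij_orbit: "\<gamma> \<in> \<Gamma> \<Longrightarrow> bij_betw (\<lambda>x. \<gamma> *v x) \<Lambda> \<Lambda>"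
  by (rule bij_betwI[of _ _ _ "\<lambda>x. adj \<gamma> *v x"]) (auto simp: orbit_mult adj_mem adj_mult_vec det_mem)

lemma nn_integral_orbit_coset:
  assumes "B \<in> coset \<Gamma> A"
  shows "(\<integral>\<^sup>+x. h (B *v x) \<partial>count_space \<Lambda>) = (\<integral>\<^sup>+x. h (A *v x) \<partial>count_space \<Lambda>)"
proof -
  obtain \<gamma> where "\<gamma> \<in> \<Gamma>" "B = A ** \<gamma>" using assms by (auto simp: mem_coset)
  then show ?thesis
    using nn_integral_bij_count_space[OF bij_orbit, of \<gamma> "\<lambda>x. h (A *v x)"]
    by (simp add: matrix_vector_mul_assoc)
qed

lemma rep_mem: "K \<in> coset \<Gamma> ` S \<Longrightarrow> rep K \<in> K"
proof -
  assume "K \<in> coset \<Gamma> ` S"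
  then obtain A where "A \<in> K" using self_mem_coset by auto
  then show ?thesis unfolding rep_def by (rule someI)
qed

lemma veech_formula:
  fixes h :: "real^2 \<Rightarrow> real"
  assumes h[measurable]: "h \<in> borel_measurable borel" and nonneg: "\<And>x. 0 \<le> h x"
    and bdd: "bounded (range h)" "bounded {x. h x \<noteq> 0}"
  shows "(\<integral>\<^sup>+K. \<integral>\<^sup>+x. ennreal (h (sec K *v x)) \<partial>count_space \<Lambda> \<partial>\<mu>) =
    ennreal (c_lat \<Gamma>) * (\<integral>\<^sup>+x. ennreal (h x) \<partial>lborel)"
proof -
  have V: "AE K in \<mu>. (\<lambda>x. h (rep K *v x)) summable_on \<Lambda>"
    "integrable \<mu> (\<lambda>K. \<Sum>\<^sub>\<infinity>x\<in>\<Lambda>. h (rep K *v x))"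
    "(\<integral>K. (\<Sum>\<^sub>\<infinity>x\<in>\<Lambda>. h (rep K *v x)) \<partial>\<mu>) = c_lat \<Gamma> * (\<integral>x. h x \<partial>lborel)"
    using orbit h bdd unfolding scaled_orbit_def scaled_def veech_constant_def compact_support_bounded by blast+
  have "(\<integral>\<^sup>+K. \<integral>\<^sup>+x. ennreal (h (sec K *v x)) \<partial>count_space \<Lambda> \<partial>\<mu>) =
    (\<integral>\<^sup>+K. ennreal (\<Sum>\<^sub>\<infinity>x\<in>\<Lambda>. h (rep K *v x)) \<partial>\<mu>)"
  proof (rule nn_integral_cong_AE, use V(1) AE_space in eventually_elim)
    fix K assume K: "(\<lambda>x. h (rep K *v x)) summable_on \<Lambda>" "K \<in> space \<mu>"
    have "rep K \<in> coset \<Gamma> (sec K)" using K rep_mem sec_space by (metis space_mu)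
    then have "(\<integral>\<^sup>+x. ennreal (h (sec K *v x)) \<partial>count_space \<Lambda>) = (\<integral>\<^sup>+x. ennreal (h (rep K *v x)) \<partial>count_space \<Lambda>)"
      by (rule nn_integral_orbit_coset[symmetric])
    then show "(\<integral>\<^sup>+x. ennreal (h (sec K *v x)) \<partial>count_space \<Lambda>) = ennreal (\<Sum>\<^sub>\<infinity>x\<in>\<Lambda>. h (rep K *v x))"
      using K(1) nonneg by (simp add: nn_integral_count_space_infsum)
  qed
  also have "\<dots> = ennreal (\<integral>K. (\<Sum>\<^sub>\<infinity>x\<in>\<Lambda>. h (rep K *v x)) \<partial>\<mu>)"
    using V(2) nonneg by (intro nn_integral_eq_integral) (auto intro!: infsum_nonneg)
  also have "\<dots> = ennreal (c_lat \<Gamma>) * ennreal (\<integral>x. h x \<partial>lborel)"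
    unfolding V(3) using c_lat_window(1) nonneg by (simp add: ennreal_mult')
  also have "ennreal (\<integral>x. h x \<partial>lborel) = (\<integral>\<^sup>+x. ennreal (h x) \<partial>lborel)"
    using integrable_bounded_support[OF h bdd] nonneg by (intro nn_integral_eq_integral[symmetric]) auto
  finally show ?thesis .
qed

end

lemma orbit_multiple:
  assumes O: "scaled_orbit \<Lambda>1" "scaled_orbit \<Lambda>2" and x: "x \<in> \<Lambda>1" "s *\<^sub>R x \<in> \<Lambda>2"
  shows "s = 1 \<or> s = - 1"
proof -
  have s: "s \<noteq> 0" using orbit_nonzero[OF O(2) x(2)] by auto
  have bij: "bij_betw (\<lambda>x. s *\<^sub>R x) \<Lambda>1 \<Lambda>2"
    unfolding bij_betw_def
  proof
    show "inj_on (\<lambda>x. s *\<^sub>R x) \<Lambda>1" using s by (simp add: inj_on_def)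
    have "\<Lambda>2 = (\<lambda>\<gamma>. s *\<^sub>R (\<gamma> *v x)) ` \<Gamma>" using orbit_eq[OF O(2) x(2)] by simp
    then show "(\<lambda>x. s *\<^sub>R x) ` \<Lambda>1 = \<Lambda>2" by (subst orbit_eq[OF O(1) x(1)]) (simp add: image_image)
  qed
  define h :: "real^2 \<Rightarrow> real" where "h = indicator (cball 0 1)"
  have h: "h \<in> borel_measurable borel" "\<And>x. 0 \<le> h x" "bounded (range h)" "bounded {x. h x \<noteq> 0}"
    unfolding h_def
    by (rule borel_measurable_indicator, simp) (auto simp: bounded_iff indicator_def intro!: exI[of _ 1])
  have [measurable]: "h \<in> borel_measurable borel" by fact
  let ?I = "\<integral>\<^sup>+x. ennreal (h x) \<partial>lborel"
  have hs: "(\<lambda>x. h (s *\<^sub>R x)) \<in> borel_measurable borel" "bounded (range (\<lambda>x. h (s *\<^sub>R x)))"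
    "bounded {x. h (s *\<^sub>R x) \<noteq> 0}"
  proof -
    show "(\<lambda>x. h (s *\<^sub>R x)) \<in> borel_measurable borel" by measurable
    show "bounded (range (\<lambda>x. h (s *\<^sub>R x)))"
      using h(3) by (rule bounded_subset) auto
    show "bounded {x. h (s *\<^sub>R x) \<noteq> 0}"
      using s unfolding h_def by (auto simp: bounded_iff indicator_def field_simps intro!: exI[of _ "1 / \<bar>s\<bar>"])
  qed
  have "ennreal (c_lat \<Gamma>) * ?I = (\<integral>\<^sup>+K. \<integral>\<^sup>+x. ennreal (h (sec K *v x)) \<partial>count_space \<Lambda>2 \<partial>\<mu>)"
    by (rule veech_formula[OF O(2) h, symmetric])
  also have "\<dots> = (\<integral>\<^sup>+K. \<integral>\<^sup>+x. ennreal (h (s *\<^sub>R (sec K *v x))) \<partial>count_space \<Lambda>1 \<partial>\<mu>)"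
    using nn_integral_bij_count_space[OF bij, of "\<lambda>x. ennreal (h (sec K *v x))" for K]
    by (intro nn_integral_cong) simp
  also have "\<dots> = ennreal (c_lat \<Gamma>) * (\<integral>\<^sup>+x. ennreal (h (s *\<^sub>R x)) \<partial>lborel)"
    by (rule veech_formula[OF O(1) hs(1) h(2) hs(2,3)])
  finally have "ennreal (c_lat \<Gamma>) * ?I = ennreal (c_lat \<Gamma>) * (\<integral>\<^sup>+x. ennreal (h (s *\<^sub>R x)) \<partial>lborel)" .
  then have 1: "?I = (\<integral>\<^sup>+x. ennreal (h (s *\<^sub>R x)) \<partial>lborel)"
    using c_lat_window(1) by (simp add: ennreal_mult_cancel_left)
  have "?I = emeasure lborel (cball (0::real^2) 1)"
  proof -
    have "?I = (\<integral>\<^sup>+x. indicator (cball (0::real^2) 1) x \<partial>lborel)"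
      unfolding h_def by (intro nn_integral_cong) (simp add: indicator_def)
    then show ?thesis by simp
  qed
  also have "\<dots> = ennreal pi" using emeasure_cball[of 1 "0::real^2"] by (simp add: eval_unit_ball_vol)
  finally have 2: "?I = ennreal pi" .
  have "?I = ennreal (\<bar>s\<bar>\<^sup>2) * (\<integral>\<^sup>+x. ennreal (h (s *\<^sub>R x)) \<partial>lborel)"
    using nn_integral_lborel_affine[of "\<lambda>x. ennreal (h x)" s 0] s by simp
  then have "ennreal pi = ennreal (s\<^sup>2 * pi)" using 1 2 by (simp add: ennreal_mult')
  then have "s\<^sup>2 = 1" by (subst (asm) ennreal_inj) auto
  then show ?thesis by (simp add: power2_eq_1_iff)
qed

lemma orbit_parallel:
  assumes O: "scaled_orbit \<Lambda>1" "scaled_orbit \<Lambda>2" and x: "x \<in> \<Lambda>1" "y \<in> \<Lambda>2" "wedge x y = 0"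
  shows "y = x \<or> y = - x"
proof -
  obtain s where "y = s *\<^sub>R x" using wedge_eq_0_parallel[OF x(3) orbit_nonzero[OF O(1) x(1)]] by blast
  then show ?thesis using orbit_multiple[OF O x(1), of s] x by auto
qed

lemma homothetic_orbits:
  assumes O: "scaled_orbit \<Lambda>1" "scaled_orbit \<Lambda>2"
  shows "homothetic \<Lambda>1 \<Lambda>2 \<longleftrightarrow> \<Lambda>1 = \<Lambda>2"
proof
  assume "homothetic \<Lambda>1 \<Lambda>2"
  then obtain r where r: "r \<noteq> 0" "\<Lambda>1 = (\<lambda>x. r *\<^sub>R x) ` \<Lambda>2" by (auto simp: homothetic_def)
  obtain v where v: "v \<in> \<Lambda>2" using scaled_orbitE[OF O(2)] by metis
  then have "r *\<^sub>R v \<in> \<Lambda>1" using r by auto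
  then have "r = 1 \<or> r = -1" using orbit_multiple[OF O(2,1) v] by blast
  then have "r *\<^sub>R v \<in> \<Lambda>2" using v orbit_uminus[OF O(2)] by auto
  then show "\<Lambda>1 = \<Lambda>2" using orbit_eq[OF O(1) \<open>r *\<^sub>R v \<in> \<Lambda>1\<close>] orbit_eq[OF O(2)] by metis
next
  assume "\<Lambda>1 = \<Lambda>2"
  then show "homothetic \<Lambda>1 \<Lambda>2" unfolding homothetic_def by (intro exI[of _ 1]) auto
qed

end

text \<open>Shearing along \<open>v\<close> decomposes the set into countably many pieces of the same measure.\<close>

lemma nn_integral_strip_infinite:
  fixes v :: "real^2"
  assumes v: "v \<noteq> 0"
  shows "(\<integral>\<^sup>+A. indicator {0<..1} (det A) * indicator (cball 0 1) (A *v v) \<partial>lborel) = \<infinity>"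
proof -
  define n where "n = v$1 * v$1 + v$2 * v$2"
  have n: "n > 0" using v unfolding n_def
    by (metis add_pos_nonneg add_nonneg_pos mult_eq_0_iff not_real_square_gt_zero vec2_eq_iff zero_index zero_le_square)
  define w :: "real^2" where "w = vector [- v$2 / n, v$1 / n]"
  have w: "wedge v w = 1"
  proof -
    have "wedge v w = (v$1 * v$1 + v$2 * v$2) / n" by (simp add: w_def wedge_eq vector_def add_divide_distrib)
    then have "wedge v w = n / n" unfolding n_def .
    then show ?thesis using n by simp
  qed
  define E where "E k = {A :: real^2^2. 0 < det A \<and> det A \<le> 1 \<and> norm (A *v v) \<le> 1 \<and>
     k * ((A *v v) \<bullet> (A *v v)) \<le> (A *v v) \<bullet> (A *v w) \<and>
     (A *v v) \<bullet> (A *v w) < (k + 1) * ((A *v v) \<bullet> (A *v v))}" for k :: real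
  have [measurable]: "E k \<in> sets borel" for k
  proof -
    have "E k = {A \<in> space borel. 0 < det A \<and> det A \<le> 1 \<and> norm (A *v v) \<le> 1 \<and>
     k * ((A *v v) \<bullet> (A *v v)) \<le> (A *v v) \<bullet> (A *v w) \<and>
     (A *v v) \<bullet> (A *v w) < (k + 1) * ((A *v v) \<bullet> (A *v v))}" by (simp add: E_def)
    then show ?thesis by simp
  qed
  have shift: "A ** shear k v \<in> E k \<longleftrightarrow> A \<in> E 0" for A k
  proof -
    have "(A ** shear k v) *v v = A *v v" by (simp add: matrix_vector_mul_assoc[symmetric] shear_vec)
    moreover have "(A ** shear k v) *v w = A *v w + k *\<^sub>R (A *v v)"
      by (simp add: matrix_vector_mul_assoc[symmetric] shear_vec w matrix_vector_right_distrib)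
    ultimately show ?thesis by (simp add: E_def det_mul inner_add_right algebra_simps)
  qed
  have eq: "emeasure lborel (E k) = emeasure lborel (E 0)" for k
  proof -
    have "emeasure lborel (E k) = (\<integral>\<^sup>+A. indicator (E k) A \<partial>lborel)" by simp
    also have "\<dots> = (\<integral>\<^sup>+A. indicator (E k) (A ** shear k v) \<partial>lborel)"
      using nn_integral_mat_right[of "indicator (E k)" "shear k v"] by simp
    also have "\<dots> = (\<integral>\<^sup>+A. indicator (E 0) A \<partial>lborel)"
      using shift by (intro nn_integral_cong) (simp add: indicator_def)
    finally show ?thesis by simp
  qed
  have pos: "emeasure lborel (E 0) > 0"
  proof -
    define U where "U = {A :: real^2^2. 0 < det A} \<inter> {A. det A < 1} \<inter> {A. norm (A *v v) < 1} \<inter>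
      {A. 0 < (A *v v) \<bullet> (A *v w)} \<inter> {A. (A *v v) \<bullet> (A *v w) < (A *v v) \<bullet> (A *v v)}"
    have "open U" unfolding U_def det_2
      by (intro open_Int open_Collect_less continuous_intros)
    define A where "A = of_cols (vector [1/2, 0], vector [1/4, 1]) ** adj (of_cols (v, w))"
    have d: "det (of_cols (v, w)) = 1" using w by (simp add: wedge_det)
    have "adj (of_cols (v, w)) *v v = vector [1, 0]" "adj (of_cols (v, w)) *v w = vector [0, 1]"
      using w by (simp_all add: vec2_eq_iff mat2_vec_nth vector_def wedge_eq algebra_simps)
    then have A: "A *v v = vector [1/2, 0]" "A *v w = vector [1/4, 1]"
      unfolding A_def matrix_vector_mul_assoc[symmetric] by (simp_all add: vec2_eq_iff mat2_vec_nth vector_def)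
    have "det A = 1/2" unfolding A_def det_mul det_adj d by (simp add: det_2 vector_def)
    moreover have "norm (vector [1/2, 0] :: real^2) < 1"
      using norm_le_l1_cart[of "vector [1/2, 0] :: real^2"] by (simp add: sum_2 vector_def)
    ultimately have "A \<in> U" unfolding U_def by (simp add: A inner_vec_def sum_2 vector_def)
    then have "0 < emeasure lborel U" using \<open>open U\<close> by (rule emeasure_lborel_open_pos[rotated])
    also have "\<dots> \<le> emeasure lborel (E 0)" by (intro emeasure_mono) (auto simp: U_def E_def)
    finally show ?thesis .
  qed
  have disj: "disjoint_family_on (\<lambda>k::nat. E (real k)) UNIV"
    unfolding disjoint_family_on_def
  proof (intro ballI impI)
    have "E (real i) \<inter> E (real j) = {}" if "i < j" for i j :: nat
    proof -
      have False if "A \<in> E (real i)" "A \<in> E (real j)" for A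
      proof -
        have "(real i + 1) * ((A *v v) \<bullet> (A *v v)) \<le> real j * ((A *v v) \<bullet> (A *v v))"
          using \<open>i < j\<close> by (intro mult_right_mono) auto
        then show False using that by (auto simp: E_def)
      qed
      then show ?thesis by auto
    qed
    then show "E (real i) \<inter> E (real j) = {}" if "i \<noteq> j" for i j :: nat
      using that by (metis Int_commute linorder_neqE_nat)
  qed
  have "\<infinity> = (\<integral>\<^sup>+k. emeasure lborel (E (real k)) \<partial>count_space (UNIV :: nat set))"
    using pos unfolding eq[of "real k" for k] by (simp add: ennreal_mult_top)
  also have "\<dots> = emeasure lborel (\<Union>k::nat. E (real k))"
    by (rule emeasure_UN_countable[symmetric, OF _ _ disj]) auto
  also have "\<dots> = (\<integral>\<^sup>+A. indicator (\<Union>k::nat. E (real k)) A \<partial>lborel)" by simp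
  also have "\<dots> \<le> (\<integral>\<^sup>+A. indicator {0<..1} (det A) * indicator (cball 0 1) (A *v v) \<partial>lborel)"
    by (intro nn_integral_mono) (auto simp: indicator_def E_def)
  finally show ?thesis by (simp add: top_unique)
qed

lemma nn_integral_disc_scaled:
  fixes t :: real
  assumes t: "t > 0"
  shows "ennreal t * (\<integral>\<^sup>+x. indicator (cball 0 1) (sqrt t *\<^sub>R x) \<partial>(lborel :: (real^2) measure)) = ennreal pi"
proof -
  have m: "(indicator (cball 0 1) :: real^2 \<Rightarrow> ennreal) \<in> borel_measurable borel"
    by (rule borel_measurable_indicator) simp
  have "ennreal pi = (\<integral>\<^sup>+x. indicator (cball 0 1) x \<partial>(lborel :: (real^2) measure))"
    using emeasure_cball[of 1 "0::real^2"] by (simp add: eval_unit_ball_vol)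
  also have "\<dots> = ennreal t * (\<integral>\<^sup>+x. indicator (cball 0 1) (sqrt t *\<^sub>R x) \<partial>(lborel :: (real^2) measure))"
    using nn_integral_lborel_affine[OF m, of "sqrt t" 0] t by simp
  finally show ?thesis ..
qed

context lattice_neg
begin

context
  fixes \<Lambda> assumes orbit: "scaled_orbit \<Lambda>"
begin

text \<open>If the stabilizer of \<open>x\<close> were trivial, the sum over the orbit would be a sum over \<open>\<Gamma>\<close>, and
  unfolding it would give the infinite measure of the preceding lemma.\<close>

lemma stabilizer_nontrivial:
  assumes x: "x \<in> \<Lambda>"
  obtains k where "k \<noteq> 0" "shear k x \<in> \<Gamma>"
proof -
  have x0: "x \<noteq> 0" using orbit_nonzero[OF orbit x] .
  have "\<exists>\<gamma>\<in>\<Gamma>. \<gamma> *v x = x \<and> \<gamma> \<noteq> mat 1"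
  proof (rule ccontr)
    assume triv: "\<not> ?thesis"
    have bij: "bij_betw (\<lambda>\<gamma>. \<gamma> *v x) \<Gamma> \<Lambda>"
      unfolding bij_betw_def
    proof
      show "(\<lambda>\<gamma>. \<gamma> *v x) ` \<Gamma> = \<Lambda>" using orbit_eq[OF orbit x] by simp
      show "inj_on (\<lambda>\<gamma>. \<gamma> *v x) \<Gamma>"
      proof (rule inj_onI)
        fix \<gamma> \<delta> assume g: "\<gamma> \<in> \<Gamma>" "\<delta> \<in> \<Gamma>" "\<gamma> *v x = \<delta> *v x"
        then have "(adj \<gamma> ** \<delta>) *v x = x"
          by (metis adj_mult_vec(1) det_mem matrix_vector_mul_assoc)
        then have "adj \<gamma> ** \<delta> = mat 1" using triv g mult_mem adj_mem by blast
        then have "\<gamma> ** (adj \<gamma> ** \<delta>) = \<gamma>" by simp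
        then show "\<gamma> = \<delta>" using g by (simp add: matrix_mul_assoc adj_inverse det_mem)
      qed
    qed
    have cm[measurable]: "(indicator (cball 0 1) :: real^2 \<Rightarrow> ennreal) \<in> borel_measurable borel"
      by (rule borel_measurable_indicator) simp
    have cr[measurable]: "(indicator (cball 0 1) :: real^2 \<Rightarrow> real) \<in> borel_measurable borel"
      by (rule borel_measurable_indicator) simp
    define F :: "real^2^2 \<Rightarrow> ennreal"
      where "F A = indicator {0<..1} (det A) * indicator (cball 0 1) (A *v x)" for A
    have [measurable]: "F \<in> borel_measurable borel" unfolding F_def[abs_def] by measurable
    have *: "ennreal t * unfold_int (\<lambda>A. F (sqrt t *\<^sub>R A)) = indicator {..1} t * ennreal (c_lat \<Gamma> * pi)"
      if t: "t > 0" for t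
    proof -
      define h :: "real^2 \<Rightarrow> real" where "h y = indicator (cball 0 1) (sqrt t *\<^sub>R y)" for y
      have h: "h \<in> borel_measurable borel" "\<And>y. 0 \<le> h y" "bounded (range h)" "bounded {y. h y \<noteq> 0}"
      proof -
        show "h \<in> borel_measurable borel" unfolding h_def[abs_def] by measurable
        show "bounded (range h)" by (auto simp: h_def bounded_iff indicator_def intro!: exI[of _ 1])
        show "bounded {y. h y \<noteq> 0}" using t
          by (auto simp: h_def bounded_iff indicator_def field_simps intro!: exI[of _ "1 / sqrt t"])
      qed (simp add: h_def)
      have he: "ennreal (h y) = indicator (cball 0 1) (sqrt t *\<^sub>R y)" for y
        by (simp add: h_def indicator_def)
      have "unfold_int (\<lambda>A. F (sqrt t *\<^sub>R A)) =
        unfold_int (\<lambda>A. indicator {..1} t * ennreal (h (A *v x)))"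
        using t by (intro unfold_int_cong) (simp add: F_def det_scaleR2 he indicator_def)
      also have "\<dots> = indicator {..1} t * unfold_int (\<lambda>A. ennreal (h (A *v x)))"
        by (intro unfold_int_cmult measurable_compose[OF _ measurable_ennreal]
            measurable_compose[OF _ h(1)]) measurable
      also have "unfold_int (\<lambda>A. ennreal (h (A *v x))) = 
        (\<integral>\<^sup>+K. \<integral>\<^sup>+y. ennreal (h (sec K *v y)) \<partial>count_space \<Lambda> \<partial>\<mu>)"
        unfolding unfold_int_def
        using nn_integral_bij_count_space[OF bij, of "\<lambda>y. ennreal (h (sec K *v y))" for K]
        by (simp add: matrix_vector_mul_assoc)
      also have "\<dots> = ennreal (c_lat \<Gamma>) * (\<integral>\<^sup>+y. ennreal (h y) \<partial>lborel)"
        by (rule veech_formula[OF orbit h])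
      finally have "ennreal t * unfold_int (\<lambda>A. F (sqrt t *\<^sub>R A)) = 
        indicator {..1} t * (ennreal (c_lat \<Gamma>) * (ennreal t * (\<integral>\<^sup>+y. ennreal (h y) \<partial>lborel)))"
        by (simp only: mult_ac)
      also have "ennreal t * (\<integral>\<^sup>+y. ennreal (h y) \<partial>lborel) = ennreal pi"
        unfolding he by (rule nn_integral_disc_scaled[OF t])
      finally show ?thesis using c_lat_window(1) by (simp add: ennreal_mult')
    qed
    have "(\<integral>\<^sup>+t. indicator {0<..} t * ennreal t * unfold_int (\<lambda>A. F (sqrt t *\<^sub>R A)) \<partial>lborel)
      \<le> (\<integral>\<^sup>+t. ennreal (c_lat \<Gamma> * pi) * indicator {0..1::real} t \<partial>lborel)"
    proof (rule nn_integral_mono)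
      fix t :: real
      show "indicator {0<..} t * ennreal t * unfold_int (\<lambda>A. F (sqrt t *\<^sub>R A)) \<le>
        ennreal (c_lat \<Gamma> * pi) * indicator {0..1} t"
        using *[of t] by (cases "t > 0") (simp_all add: mult.assoc indicator_def)
    qed
    also have "\<dots> < \<infinity>" by (simp add: nn_integral_cmult_indicator)
    finally have "ennreal (c_lat \<Gamma>) * (\<integral>\<^sup>+A. indicator {0<..} (det A) * F A \<partial>lborel) < \<infinity>"
      by (simp add: unfolding_formula)
    moreover have "(\<integral>\<^sup>+A. indicator {0<..} (det A) * F A \<partial>lborel) = \<infinity>"
    proof -
      have "(\<integral>\<^sup>+A. indicator {0<..} (det A) * F A \<partial>lborel) = (\<integral>\<^sup>+A. F A \<partial>lborel)"
        by (intro nn_integral_cong) (auto simp: F_def indicator_def)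
      then show ?thesis unfolding F_def using nn_integral_strip_infinite[OF x0] by simp
    qed
    ultimately show False using c_lat_window(1) by (simp add: ennreal_mult_top)
  qed
  then obtain \<gamma> where g: "\<gamma> \<in> \<Gamma>" "\<gamma> *v x = x" "\<gamma> \<noteq> mat 1" by blast
  then obtain k where "\<gamma> = shear k x" using stabilizer_shear[OF det_mem x0] by metis
  then show ?thesis using that[of k] g by (cases "k = 0") auto
qed

lemma shear_multiple:
  assumes "shear k x \<in> \<Gamma>" shows "shear (of_int n * k) x \<in> \<Gamma>"
proof -
  have nat: "shear (real m * k) x \<in> \<Gamma>" for m :: nat
  proof (induction m)
    case (Suc m)
    then show ?case using mult_mem[OF assms Suc] by (simp add: shear_mult algebra_simps)
  qed (simp add: one_mem)
  show ?thesis
  proof (cases "n \<ge> 0")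
    case True
    then show ?thesis using nat[of "nat n"] by simp
  next
    case False
    then show ?thesis using adj_mem[OF nat[of "nat (- n)"]] by (simp add: adj_shear)
  qed
qed

lemma wedge_gap:
  obtains \<delta> where "\<delta> > 0" "\<And>x y. x \<in> \<Lambda> \<Longrightarrow> y \<in> \<Lambda> \<Longrightarrow> wedge x y \<noteq> 0 \<Longrightarrow> \<bar>wedge x y\<bar> \<ge> \<delta>"
proof -
  obtain v where v: "v \<noteq> 0" "v \<in> \<Lambda>" using scaled_orbitE[OF orbit] by metis
  obtain \<tau> where t: "\<tau> \<noteq> 0" "shear \<tau> v \<in> \<Gamma>" using stabilizer_nontrivial[OF v(2)] by blast
  have "discrete \<Lambda>" using orbit by (simp add: scaled_orbit_def discrete_orbit_def)
  then obtain e where e: "e > 0" "\<And>y. y \<in> \<Lambda> \<Longrightarrow> dist v y < e \<Longrightarrow> y = v"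
    using isolated_inE_dist discreteD v by metis
  define \<delta> where "\<delta> = e / (\<bar>\<tau>\<bar> * norm v + 1 / norm v)"
  have d: "\<delta> > 0" using e v by (simp add: \<delta>_def add_nonneg_pos)
  define J :: "real^2" where "J = vector [- v$2, v$1]"
  define n where "n = v$1 * v$1 + v$2 * v$2"
  have nv: "n = (norm v)\<^sup>2" by (simp add: n_def norm_vec_def L2_set_def sum_2 power2_eq_square)
  then have n: "n > 0" using v by simp
  have J: "norm J = norm v" by (simp add: J_def norm_vec_def L2_set_def sum_2 vector_def add.commute)
  have base: "\<bar>wedge v y\<bar> \<ge> \<delta>" if y: "y \<in> \<Lambda>" "wedge v y \<noteq> 0" for y
  proof (rule ccontr)
    assume less: "\<not> \<bar>wedge v y\<bar> \<ge> \<delta>"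
    define w where "w = wedge v y"
    have w: "w \<noteq> 0" "\<bar>w\<bar> < \<delta>" using y less by (auto simp: w_def)
    define \<alpha> where "\<alpha> = (v$1 * y$1 + v$2 * y$2) / n"
    have yv: "y = \<alpha> *\<^sub>R v + (w / n) *\<^sub>R J"
    proof -
      have "n * y$1 = (v$1 * y$1 + v$2 * y$2) * v$1 - w * v$2" "n * y$2 = (v$1 * y$1 + v$2 * y$2) * v$2 + w * v$1"
        by (simp_all add: n_def w_def wedge_eq algebra_simps)
      then have "y$1 = ((v$1 * y$1 + v$2 * y$2) * v$1 - w * v$2) / n" "y$2 = ((v$1 * y$1 + v$2 * y$2) * v$2 + w * v$1) / n"
        using n by (simp_all add: field_simps)
      then show ?thesis
        by (simp add: vec2_eq_iff J_def vector_def \<alpha>_def add_divide_distrib diff_divide_distrib algebra_simps)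
    qed
    define k where "k = round ((1 - \<alpha>) / (\<tau> * w))"
    define y' where "y' = shear (of_int k * \<tau>) v *v y"
    have y': "y' \<in> \<Lambda>" unfolding y'_def by (intro orbit_mult[OF orbit] shear_multiple t y)
    have "y' - v = (\<alpha> + of_int k * \<tau> * w - 1) *\<^sub>R v + (w / n) *\<^sub>R J"
      unfolding y'_def shear_vec w_def[symmetric] by (subst yv) (simp add: algebra_simps)
    then have "norm (y' - v) \<le> \<bar>\<alpha> + of_int k * \<tau> * w - 1\<bar> * norm v + \<bar>w / n\<bar> * norm v"
      using norm_triangle_ineq[of "(\<alpha> + of_int k * \<tau> * w - 1) *\<^sub>R v" "(w / n) *\<^sub>R J"] J by simp
    moreover have "\<bar>\<alpha> + of_int k * \<tau> * w - 1\<bar> \<le> \<bar>\<tau>\<bar> * \<bar>w\<bar>"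
    proof -
      have "\<alpha> + of_int k * \<tau> * w - 1 = (of_int k - (1 - \<alpha>) / (\<tau> * w)) * (\<tau> * w)"
        using t w by (simp add: field_simps)
      then have "\<bar>\<alpha> + of_int k * \<tau> * w - 1\<bar> = \<bar>of_int k - (1 - \<alpha>) / (\<tau> * w)\<bar> * (\<bar>\<tau>\<bar> * \<bar>w\<bar>)"
        by (simp only: abs_mult)
      also have "\<dots> \<le> 1 * (\<bar>\<tau>\<bar> * \<bar>w\<bar>)"
        using of_int_round_abs_le[of "(1 - \<alpha>) / (\<tau> * w)"] unfolding k_def by (intro mult_right_mono) auto
      finally show ?thesis by simp
    qed
    ultimately have "norm (y' - v) \<le> \<bar>\<tau>\<bar> * \<bar>w\<bar> * norm v + \<bar>w / n\<bar> * norm v"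
      by (smt (verit) mult_right_mono norm_ge_zero)
    also have "\<dots> = \<bar>w\<bar> * (\<bar>\<tau>\<bar> * norm v + 1 / norm v)"
      using n v by (simp add: nv power2_eq_square field_simps)
    also have "\<dots> < \<delta> * (\<bar>\<tau>\<bar> * norm v + 1 / norm v)"
      using w v by (intro mult_strict_right_mono) (auto simp: add_nonneg_pos)
    also have "\<dots> = e"
    proof -
      have "\<bar>\<tau>\<bar> * norm v + 1 / norm v > 0" using v by (simp add: add_nonneg_pos)
      then show ?thesis unfolding \<delta>_def by simp
    qed
    finally have "y' = v" using e(2)[OF y'] by (simp add: dist_norm norm_minus_commute)
    then have "wedge v y' = 0" by simp
    moreover have "wedge v y' = w"
      unfolding y'_def shear_vec w_def by (simp add: wedge_eq algebra_simps)
    ultimately show False using w by simp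
  qed
  show ?thesis
  proof (rule that[OF d])
    fix x y assume xy: "x \<in> \<Lambda>" "y \<in> \<Lambda>" "wedge x y \<noteq> 0"
    obtain \<gamma> where g: "\<gamma> \<in> \<Gamma>" "v = \<gamma> *v x" using orbit_transitive[OF orbit xy(1) v(2)] by blast
    then have "wedge v (\<gamma> *v y) = wedge x y" by (simp add: wedge_mult det_mem)
    then show "\<bar>wedge x y\<bar> \<ge> \<delta>" using base[of "\<gamma> *v y"] orbit_mult[OF orbit g(1) xy(2)] xy by simp
  qed
qed

lemma orbit_count_bound:
  assumes R: "R > 0"
  obtains C where "C > 0" "\<And>A. 0 < det A \<Longrightarrow> det A \<le> 1 \<Longrightarrow>
    finite {x \<in> \<Lambda>. norm (A *v x) \<le> R} \<and> real (card {x \<in> \<Lambda>. norm (A *v x) \<le> R}) \<le> C / det A"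
proof -
  obtain \<delta> where d: "\<delta> > 0" "\<And>x y. x \<in> \<Lambda> \<Longrightarrow> y \<in> \<Lambda> \<Longrightarrow> wedge x y \<noteq> 0 \<Longrightarrow> \<bar>wedge x y\<bar> \<ge> \<delta>"
    using wedge_gap by blast
  let ?C = "8 * (R\<^sup>2 / \<delta>) + 12"
  show ?thesis
  proof (rule that[of ?C])
    show "?C > 0" using R d by (intro add_nonneg_pos) auto
    fix A :: "real^2^2" assume A: "0 < det A" "det A \<le> 1"
    let ?X = "{x \<in> \<Lambda>. norm (A *v x) \<le> R}"
    have inj: "x = y" if "A *v x = A *v y" for x y
    proof -
      have "adj A *v (A *v x) = adj A *v (A *v y)" using that by simp
      then show ?thesis using A by (simp add: matrix_vector_mul_assoc mult_adj)
    qed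
    have "finite ((\<lambda>x. A *v x) ` ?X) \<and> real (card ((\<lambda>x. A *v x) ` ?X)) \<le> 8 * (R\<^sup>2 / (\<delta> * det A)) + 12"
    proof (rule card_separated_directions[OF _ R])
      show "\<delta> * det A > 0" using d A by simp
      show "p \<noteq> 0 \<and> norm p \<le> R" if "p \<in> (\<lambda>x. A *v x) ` ?X" for p
        using that orbit_nonzero[OF orbit] inj[of _ 0] by auto
      fix p q assume "p \<in> (\<lambda>x. A *v x) ` ?X" "q \<in> (\<lambda>x. A *v x) ` ?X" and ne: "q \<noteq> p" "q \<noteq> - p"
      then obtain x y where xy: "x \<in> \<Lambda>" "y \<in> \<Lambda>" "p = A *v x" "q = A *v y" by auto
      then have "wedge x y \<noteq> 0" using orbit_parallel[OF orbit orbit xy(1,2)] ne by (auto simp: mat_vec_uminus)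
      then have "\<delta> \<le> \<bar>wedge x y\<bar>" using d(2) xy by blast
      then show "\<bar>wedge p q\<bar> \<ge> \<delta> * det A" using xy A by (simp add: wedge_mult abs_mult mult.commute)
    qed
    moreover have "inj_on (\<lambda>x. A *v x) ?X" using inj by (auto simp: inj_on_def)
    ultimately have "finite ?X" "real (card ?X) \<le> 8 * (R\<^sup>2 / (\<delta> * det A)) + 12"
      by (simp_all add: finite_image_iff card_image)
    moreover have "8 * (R\<^sup>2 / (\<delta> * det A)) + 12 \<le> ?C / det A"
      using A d by (simp add: field_simps)
    ultimately show "finite ?X \<and> real (card ?X) \<le> ?C / det A" by linarith
  qed
qed

end

end

section \<open>Sums over pairs\<close>

definition app :: "real^2^2 \<Rightarrow> (real^2) \<times> (real^2) \<Rightarrow> (real^2) \<times> (real^2)" where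
  "app A p = (A *v fst p, A *v snd p)"

definition pair_wedge :: "(real^2) \<times> (real^2) \<Rightarrow> real" where
  "pair_wedge p = wedge (fst p) (snd p)"

definition mat_cols :: "real^2^2 \<Rightarrow> (real^2) \<times> (real^2)" where
  "mat_cols A = app A (axis 1 1, axis 2 1)"

lemma mat_cols_of_cols [simp]: "mat_cols (of_cols p) = p"
  by (simp add: mat_cols_def app_def prod_eq_iff vec2_eq_iff mat2_vec_nth axis_def)

lemma of_cols_app: "of_cols (app A p) = A ** of_cols p"
  by (simp add: app_def of_cols_mult)

lemma mat_cols_mult: "mat_cols (A ** of_cols p) = app A p"
  by (metis mat_cols_of_cols of_cols_app)

lemma det_of_cols: "det (of_cols p) = pair_wedge p"
  by (simp add: pair_wedge_def wedge_det)

lemma app_app: "app A (app B p) = app (A ** B) p"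
  by (simp add: app_def matrix_vector_mul_assoc)

lemma app_scaleR: "app (c *\<^sub>R A) p = c *\<^sub>R app A p"
  by (simp add: app_def)

lemma pair_wedge_app: "pair_wedge (app A p) = det A * pair_wedge p"
  by (simp add: pair_wedge_def app_def wedge_mult)

lemma measurable_app [measurable (raw)]:
  assumes "f \<in> borel_measurable M" "g \<in> borel_measurable M"
  shows "(\<lambda>x. app (f x) (g x)) \<in> borel_measurable M"
  unfolding app_def using assms by measurable

lemma measurable_mat_cols [measurable]: "mat_cols \<in> borel_measurable borel"
  unfolding mat_cols_def[abs_def] by measurable

lemma measurable_wedge [measurable (raw)]:
  assumes [measurable]: "f \<in> borel_measurable M" "g \<in> borel_measurable M"
  shows "(\<lambda>x. wedge (f x) (g x)) \<in> borel_measurable M"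
  unfolding wedge_eq by measurable

lemma measurable_pair_wedge [measurable]: "pair_wedge \<in> borel_measurable borel"
  unfolding pair_wedge_def[abs_def] by measurable

lemma nn_integral_count_space_Un:
  fixes f :: "'a \<Rightarrow> ennreal"
  assumes "A \<inter> B = {}"
  shows "(\<integral>\<^sup>+x. f x \<partial>count_space (A \<union> B)) = (\<integral>\<^sup>+x. f x \<partial>count_space A) + (\<integral>\<^sup>+x. f x \<partial>count_space B)"
proof -
  have "(\<integral>\<^sup>+x. f x \<partial>count_space (A \<union> B)) = (\<integral>\<^sup>+x. f x * indicator (A \<union> B) x \<partial>count_space UNIV)"
    by (rule nn_integral_count_space_indicator) auto
  also have "\<dots> = (\<integral>\<^sup>+x. f x * indicator A x + f x * indicator B x \<partial>count_space UNIV)"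
    using assms by (intro nn_integral_cong) (auto simp: indicator_def)
  also have "\<dots> = (\<integral>\<^sup>+x. f x * indicator A x \<partial>count_space UNIV) + (\<integral>\<^sup>+x. f x * indicator B x \<partial>count_space UNIV)"
    by (rule nn_integral_add) auto
  finally show ?thesis by (simp add: nn_integral_count_space_indicator)
qed

lemma nn_integral_count_space_Times:
  fixes f :: "'a \<times> 'b \<Rightarrow> ennreal"
  assumes "countable A" "countable B"
  shows "(\<integral>\<^sup>+p. f p \<partial>count_space (A \<times> B)) = (\<integral>\<^sup>+x. \<integral>\<^sup>+y. f (x, y) \<partial>count_space B \<partial>count_space A)"
proof -
  interpret B: sigma_finite_measure "count_space B"
    using assms(2) by (rule sigma_finite_measure_count_space_countable)
  have e: "count_space A \<Otimes>\<^sub>M count_space B = count_space (A \<times> B)"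
    using assms by (rule pair_measure_countable)
  have "f \<in> borel_measurable (count_space A \<Otimes>\<^sub>M count_space B)" unfolding e by simp
  from B.nn_integral_fst[OF this] show ?thesis by (simp add: e)
qed

context lattice_neg
begin

context
  fixes p :: "(real^2) \<times> (real^2)"
  assumes pos: "pair_wedge p > 0"
begin

lemma unfolding_pair:
  assumes [measurable]: "F \<in> borel_measurable borel"
  shows "(\<integral>\<^sup>+t. indicator {0<..1} t * ennreal (t\<^sup>2) * unfold_int (\<lambda>A. F (sqrt t *\<^sub>R app A p)) \<partial>lborel) =
    ennreal (c_lat \<Gamma>) * (\<integral>\<^sup>+q. indicator {0<..pair_wedge p} (pair_wedge q) * ennreal (pair_wedge q / pair_wedge p ^ 3) * F q \<partial>lborel)"
proof -
  define c where "c = pair_wedge p"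
  have c: "c > 0" using pos by (simp add: c_def)
  define H where "H A = indicator {..1} (det A) * ennreal (det A) * F (app A p)" for A
  have [measurable]: "H \<in> borel_measurable borel" unfolding H_def[abs_def] by measurable
  define \<Phi> where "\<Phi> B = indicator {0<..1} (det B / c) * ennreal (det B / c) * F (mat_cols B)" for B
  have [measurable]: "\<Phi> \<in> borel_measurable borel" unfolding \<Phi>_def[abs_def] by measurable
  have "(\<integral>\<^sup>+t. indicator {0<..1} t * ennreal (t\<^sup>2) * unfold_int (\<lambda>A. F (sqrt t *\<^sub>R app A p)) \<partial>lborel) =
    (\<integral>\<^sup>+t. indicator {0<..} t * ennreal t * unfold_int (\<lambda>A. H (sqrt t *\<^sub>R A)) \<partial>lborel)"
  proof (rule nn_integral_cong)
    fix t :: real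
    show "indicator {0<..1} t * ennreal (t\<^sup>2) * unfold_int (\<lambda>A. F (sqrt t *\<^sub>R app A p)) =
      indicator {0<..} t * ennreal t * unfold_int (\<lambda>A. H (sqrt t *\<^sub>R A))"
    proof (cases "t > 0")
      case True
      have "unfold_int (\<lambda>A. H (sqrt t *\<^sub>R A)) = unfold_int (\<lambda>A. (indicator {..1} t * ennreal t) * F (sqrt t *\<^sub>R app A p))"
        using True by (intro unfold_int_cong) (simp add: H_def det_scaleR2 app_scaleR)
      also have "\<dots> = (indicator {..1} t * ennreal t) * unfold_int (\<lambda>A. F (sqrt t *\<^sub>R app A p))"
        by (rule unfold_int_cmult) measurable
      finally show ?thesis using True
        by (simp add: power2_eq_square ennreal_mult' indicator_def mult_ac)
    qed simp
  qed
  also have "\<dots> = ennreal (c_lat \<Gamma>) * (\<integral>\<^sup>+A. indicator {0<..} (det A) * H A \<partial>lborel)"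
    by (rule unfolding_formula) measurable
  also have "(\<integral>\<^sup>+A. indicator {0<..} (det A) * H A \<partial>lborel) = (\<integral>\<^sup>+A. \<Phi> (A ** of_cols p) \<partial>lborel)"
    using c by (intro nn_integral_cong)
      (auto simp: H_def \<Phi>_def det_mul det_of_cols mat_cols_mult indicator_def c_def[symmetric])
  also have "\<dots> = ennreal (1 / c\<^sup>2) * (ennreal (c\<^sup>2) * (\<integral>\<^sup>+A. \<Phi> (A ** of_cols p) \<partial>lborel))"
    using c by (simp add: mult.assoc[symmetric] ennreal_mult'[symmetric])
  also have "\<dots> = ennreal (1 / c\<^sup>2) * (\<integral>\<^sup>+A. \<Phi> A \<partial>lborel)"
    using nn_integral_mat_right[of \<Phi> "of_cols p"] c by (simp add: det_of_cols c_def)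
  also have "(\<integral>\<^sup>+A. \<Phi> A \<partial>lborel) = (\<integral>\<^sup>+q. \<Phi> (of_cols q) \<partial>lborel)"
    by (rule nn_integral_of_cols[symmetric]) measurable
  also have "ennreal (1 / c\<^sup>2) * \<dots> = (\<integral>\<^sup>+q. ennreal (1 / c\<^sup>2) * \<Phi> (of_cols q) \<partial>lborel)"
    by (rule nn_integral_cmult[symmetric]) measurable
  also have "\<dots> = (\<integral>\<^sup>+q. indicator {0<..c} (pair_wedge q) * ennreal (pair_wedge q / c ^ 3) * F q \<partial>lborel)"
  proof (rule nn_integral_cong)
    fix q
    show "ennreal (1 / c\<^sup>2) * \<Phi> (of_cols q) = indicator {0<..c} (pair_wedge q) * ennreal (pair_wedge q / c ^ 3) * F q"
    proof (cases "0 < pair_wedge q")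
      case True
      have "ennreal (1 / c\<^sup>2) * ennreal (pair_wedge q / c) = ennreal (pair_wedge q / c ^ 3)"
        using c True by (simp add: ennreal_mult'[symmetric] power2_eq_square power3_eq_cube)
      moreover have "indicator {0<..1} (pair_wedge q / c) = (indicator {0<..c} (pair_wedge q) :: ennreal)"
        using c by (simp add: indicator_def field_simps)
      moreover have "ennreal (1 / c\<^sup>2) * \<Phi> (of_cols q) =
        indicator {0<..1} (pair_wedge q / c) * (ennreal (1 / c\<^sup>2) * ennreal (pair_wedge q / c)) * F q"
        unfolding \<Phi>_def det_of_cols mat_cols_of_cols by (simp only: mult_ac)
      ultimately show ?thesis by simp
    next
      case False
      then have "\<not> 0 < pair_wedge q / c" using c by (simp add: zero_less_divide_iff)
      then show ?thesis using False by (simp add: \<Phi>_def det_of_cols)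
    qed
  qed
  finally show ?thesis by (simp add: c_def)
qed

end

context
  fixes \<Lambda>1 \<Lambda>2 assumes O1: "scaled_orbit \<Lambda>1" and O2: "scaled_orbit \<Lambda>2"
begin

abbreviation "\<E> \<equiv> pair_equiv \<Gamma> \<Lambda>1 \<Lambda>2"

definition pos_pairs :: "((real^2) \<times> (real^2)) set" where
  "pos_pairs = {p \<in> \<Lambda>1 \<times> \<Lambda>2. pair_wedge p > 0}"

definition neg_pairs :: "((real^2) \<times> (real^2)) set" where
  "neg_pairs = {p \<in> \<Lambda>1 \<times> \<Lambda>2. pair_wedge p < 0}"

definition null_pairs :: "((real^2) \<times> (real^2)) set" where
  "null_pairs = {p \<in> \<Lambda>1 \<times> \<Lambda>2. pair_wedge p = 0}"

lemma countable_pairs: "countable (\<Lambda>1 \<times> \<Lambda>2)"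
  using countable_orbit[OF O1] countable_orbit[OF O2] by auto

lemma app_pairs: "\<gamma> \<in> \<Gamma> \<Longrightarrow> p \<in> \<Lambda>1 \<times> \<Lambda>2 \<Longrightarrow> app \<gamma> p \<in> \<Lambda>1 \<times> \<Lambda>2"
  using orbit_mult[OF O1] orbit_mult[OF O2] by (auto simp: app_def)

lemma pair_equiv_iff: "(p, q) \<in> \<E> \<longleftrightarrow> p \<in> \<Lambda>1 \<times> \<Lambda>2 \<and> q \<in> \<Lambda>1 \<times> \<Lambda>2 \<and> (\<exists>\<gamma>\<in>\<Gamma>. p = app \<gamma> q)"
  by (auto simp: pair_equiv_def app_def prod_eq_iff)

lemma equiv_E: "equiv (\<Lambda>1 \<times> \<Lambda>2) \<E>"
proof (rule equivI)
  show "\<E> \<subseteq> (\<Lambda>1 \<times> \<Lambda>2) \<times> (\<Lambda>1 \<times> \<Lambda>2)" by (auto simp: pair_equiv_def)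
  show "refl_on (\<Lambda>1 \<times> \<Lambda>2) \<E>"
    unfolding refl_on_def using one_mem by (auto simp: pair_equiv_iff app_def intro!: bexI[of _ "mat 1"])
  show "sym \<E>"
  proof (rule symI)
    fix p q assume "(p, q) \<in> \<E>"
    then obtain \<gamma> where g: "p \<in> \<Lambda>1 \<times> \<Lambda>2" "q \<in> \<Lambda>1 \<times> \<Lambda>2" "\<gamma> \<in> \<Gamma>" "p = app \<gamma> q"
      unfolding pair_equiv_iff by blast
    then have "q = app (adj \<gamma>) p" by (simp add: app_def adj_mult_vec det_mem)
    then show "(q, p) \<in> \<E>" unfolding pair_equiv_iff using g adj_mem by blast
  qed
  show "trans \<E>"
  proof (rule transI)
    fix p q r assume "(p, q) \<in> \<E>" "(q, r) \<in> \<E>"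
    then obtain \<gamma> \<delta> where g: "p \<in> \<Lambda>1 \<times> \<Lambda>2" "r \<in> \<Lambda>1 \<times> \<Lambda>2" "\<gamma> \<in> \<Gamma>" "p = app \<gamma> q" "\<delta> \<in> \<Gamma>" "q = app \<delta> r"
      unfolding pair_equiv_iff by blast
    then have "p = app (\<gamma> ** \<delta>) r" by (simp add: app_app)
    then show "(p, r) \<in> \<E>" unfolding pair_equiv_iff using g mult_mem by blast
  qed
qed

lemma pair_equiv_wedge: "(p, q) \<in> \<E> \<Longrightarrow> pair_wedge p = pair_wedge q"
  unfolding pair_equiv_iff by (auto simp: pair_wedge_app det_mem)

definition pair_rep :: "((real^2) \<times> (real^2)) set \<Rightarrow> (real^2) \<times> (real^2)" where
  "pair_rep C = (SOME p. p \<in> C)"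

lemma pair_rep:
  assumes C: "C \<in> pos_pairs // \<E>"
  shows "pair_rep C \<in> C" "C = \<E> `` {pair_rep C}" "pair_rep C \<in> pos_pairs"
proof -
  obtain p where p: "p \<in> pos_pairs" "C = \<E> `` {p}" using C by (auto simp: quotient_def)
  then have "p \<in> C" using equiv_class_self[OF equiv_E] by (auto simp: pos_pairs_def)
  then show 1: "pair_rep C \<in> C" unfolding pair_rep_def by (rule someI)
  then have 2: "(p, pair_rep C) \<in> \<E>" using p by auto
  then show "C = \<E> `` {pair_rep C}" using equiv_class_eq[OF equiv_E 2] p(2) by metis
  show "pair_rep C \<in> pos_pairs"
    using p 2 pair_equiv_wedge[OF 2] by (auto simp: pos_pairs_def pair_equiv_def)
qed

lemma countable_classes: "countable (pos_pairs // \<E>)"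
proof -
  have "pos_pairs // \<E> = (\<lambda>p. \<E> `` {p}) ` pos_pairs" by (auto simp: quotient_def)
  moreover have "countable pos_pairs"
    using countable_pairs by (rule countable_subset[rotated]) (auto simp: pos_pairs_def)
  ultimately show ?thesis by simp
qed

lemma bij_classes: "bij_betw (\<lambda>(C, \<gamma>). app \<gamma> (pair_rep C)) (pos_pairs // \<E> \<times> \<Gamma>) pos_pairs"
  unfolding bij_betw_def
proof
  show "inj_on (\<lambda>(C, \<gamma>). app \<gamma> (pair_rep C)) (pos_pairs // \<E> \<times> \<Gamma>)"
  proof (rule inj_onI, clarify)
    fix C \<gamma> D \<delta> assume *: "C \<in> pos_pairs // \<E>" "D \<in> pos_pairs // \<E>" "\<gamma> \<in> \<Gamma>" "\<delta> \<in> \<Gamma>"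
      "app \<gamma> (pair_rep C) = app \<delta> (pair_rep D)"
    have rC: "pair_rep C \<in> \<Lambda>1 \<times> \<Lambda>2" "pair_rep D \<in> \<Lambda>1 \<times> \<Lambda>2"
      using pair_rep(3)[OF *(1)] pair_rep(3)[OF *(2)] by (simp_all add: pos_pairs_def)
    have "(app \<gamma> (pair_rep C), pair_rep C) \<in> \<E>" "(app \<delta> (pair_rep D), pair_rep D) \<in> \<E>"
      unfolding pair_equiv_iff
      by (intro conjI app_pairs rC *(3) bexI[OF refl *(3)], intro conjI app_pairs rC *(4) bexI[OF refl *(4)])
    then have "\<E> `` {pair_rep C} = \<E> `` {pair_rep D}"
      using *(5) equiv_class_eq[OF equiv_E] by metis
    then have CD: "C = D" using pair_rep(2) * by metis
    let ?N = "of_cols (pair_rep C)"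
    have "det ?N \<noteq> 0" using pair_rep(3)[OF *(1)] by (simp add: det_of_cols pos_pairs_def)
    moreover have "\<gamma> ** ?N = \<delta> ** ?N" using *(5) CD by (metis of_cols_app)
    then have "\<gamma> ** ?N ** adj ?N = \<delta> ** ?N ** adj ?N" by simp
    then have "det ?N *\<^sub>R \<gamma> = det ?N *\<^sub>R \<delta>"
    proof -
      have "B ** ?N ** adj ?N = det ?N *\<^sub>R B" for B :: "real^2^2"
      proof -
        have "B ** ?N ** adj ?N = B ** (det ?N *\<^sub>R mat 1)"
          by (simp add: matrix_mul_assoc[symmetric] mult_adj)
        also have "\<dots> = det ?N *\<^sub>R B" unfolding mat2_eq_iff mat2_mult_nth by (simp add: mat_def)
        finally show ?thesis .
      qed
      then show ?thesis using \<open>\<gamma> ** ?N ** adj ?N = \<delta> ** ?N ** adj ?N\<close> by metis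
    qed
    ultimately show "C = D \<and> \<gamma> = \<delta>" using CD by simp
  qed
  show "(\<lambda>(C, \<gamma>). app \<gamma> (pair_rep C)) ` (pos_pairs // \<E> \<times> \<Gamma>) = pos_pairs"
  proof (intro equalityI subsetI)
    fix p assume "p \<in> (\<lambda>(C, \<gamma>). app \<gamma> (pair_rep C)) ` (pos_pairs // \<E> \<times> \<Gamma>)"
    then obtain C \<gamma> where "C \<in> pos_pairs // \<E>" "\<gamma> \<in> \<Gamma>" "p = app \<gamma> (pair_rep C)" by auto
    then show "p \<in> pos_pairs" using pair_rep(3)[of C] app_pairs[of \<gamma> "pair_rep C"]
      by (simp add: pos_pairs_def pair_wedge_app det_mem)
  next
    fix p assume p: "p \<in> pos_pairs"
    then have C: "\<E> `` {p} \<in> pos_pairs // \<E>" by (rule quotientI)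
    then have "(p, pair_rep (\<E> `` {p})) \<in> \<E>" using pair_rep(1) by blast
    then obtain \<gamma> where "\<gamma> \<in> \<Gamma>" "p = app \<gamma> (pair_rep (\<E> `` {p}))" unfolding pair_equiv_iff by blast
    then show "p \<in> (\<lambda>(C, \<gamma>). app \<gamma> (pair_rep C)) ` (pos_pairs // \<E> \<times> \<Gamma>)"
      using C by (intro image_eqI[of _ _ "(\<E> `` {p}, \<gamma>)"]) auto
  qed
qed

definition class_sum :: "real \<Rightarrow> ennreal" where
  "class_sum t = (\<integral>\<^sup>+C. indicator {t..} (pair_wedge (pair_rep C)) *
     ennreal (1 / pair_wedge (pair_rep C) ^ 3) \<partial>count_space (pos_pairs // \<E>))"

lemma measurable_class_sum [measurable]: "class_sum \<in> borel_measurable borel"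
proof -
  have "(\<lambda>t. indicator {t..} c * ennreal d) \<in> borel_measurable borel" for c d :: real
  proof -
    have "(\<lambda>t. indicator {t..} c * ennreal d) = (\<lambda>t. indicator {..c} t * ennreal d)"
      by (auto simp: indicator_def)
    then show ?thesis by simp
  qed
  then show ?thesis unfolding class_sum_def[abs_def]
    by (intro borel_measurable_nn_integral_countable countable_classes)
qed

definition pair_integral :: "((real^2) \<times> (real^2)) set \<Rightarrow> ((real^2) \<times> (real^2) \<Rightarrow> ennreal) \<Rightarrow> ennreal" where
  "pair_integral D F = (\<integral>\<^sup>+t. indicator {0<..1} t * ennreal (t\<^sup>2) *
     (\<integral>\<^sup>+K. \<integral>\<^sup>+p. F (sqrt t *\<^sub>R app (sec K) p) \<partial>count_space D \<partial>\<mu>) \<partial>lborel)"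

lemma pair_integral_pos:
  assumes [measurable]: "F \<in> borel_measurable borel"
  shows "pair_integral pos_pairs F = ennreal (c_lat \<Gamma>) *
    (\<integral>\<^sup>+q. indicator {0<..} (pair_wedge q) * ennreal (pair_wedge q) * class_sum (pair_wedge q) * F q \<partial>lborel)"
proof -
  let ?C = "pos_pairs // \<E>"
  let ?w = "\<lambda>C. pair_wedge (pair_rep C)"
  have "(\<integral>\<^sup>+K. \<integral>\<^sup>+p. F (sqrt t *\<^sub>R app (sec K) p) \<partial>count_space pos_pairs \<partial>\<mu>) =
    (\<integral>\<^sup>+C. unfold_int (\<lambda>A. F (sqrt t *\<^sub>R app A (pair_rep C))) \<partial>count_space ?C)" for t
  proof -
    have "(\<integral>\<^sup>+p. F (sqrt t *\<^sub>R app A p) \<partial>count_space pos_pairs) =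
      (\<integral>\<^sup>+C. \<integral>\<^sup>+\<gamma>. F (sqrt t *\<^sub>R app (A ** \<gamma>) (pair_rep C)) \<partial>count_space \<Gamma> \<partial>count_space ?C)" for A
      using nn_integral_bij_count_space[OF bij_classes, of "\<lambda>p. F (sqrt t *\<^sub>R app A p)"]
      by (simp add: nn_integral_count_space_Times countable_classes countable_group app_app)
    then have "(\<integral>\<^sup>+K. \<integral>\<^sup>+p. F (sqrt t *\<^sub>R app (sec K) p) \<partial>count_space pos_pairs \<partial>\<mu>) =
      (\<integral>\<^sup>+K. \<integral>\<^sup>+C. \<integral>\<^sup>+\<gamma>. F (sqrt t *\<^sub>R app (sec K ** \<gamma>) (pair_rep C)) \<partial>count_space \<Gamma> \<partial>count_space ?C \<partial>\<mu>)"
      by simp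
    also have "\<dots> = (\<integral>\<^sup>+C. \<integral>\<^sup>+K. \<integral>\<^sup>+\<gamma>. F (sqrt t *\<^sub>R app (sec K ** \<gamma>) (pair_rep C)) \<partial>count_space \<Gamma> \<partial>\<mu> \<partial>count_space ?C)"
      by (rule nn_integral_count_space_nn_integral[OF countable_classes])
         (rule borel_measurable_nn_integral_countable[OF countable_group], measurable)
    finally show ?thesis by (simp add: unfold_int_def)
  qed
  then have "pair_integral pos_pairs F = (\<integral>\<^sup>+t. \<integral>\<^sup>+C. indicator {0<..1} t * ennreal (t\<^sup>2) *
     unfold_int (\<lambda>A. F (sqrt t *\<^sub>R app A (pair_rep C))) \<partial>count_space ?C \<partial>lborel)"
    by (simp add: pair_integral_def nn_integral_cmult)
  also have "\<dots> = (\<integral>\<^sup>+C. \<integral>\<^sup>+t. indicator {0<..1} t * ennreal (t\<^sup>2) *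
     unfold_int (\<lambda>A. F (sqrt t *\<^sub>R app A (pair_rep C))) \<partial>lborel \<partial>count_space ?C)"
  proof (rule nn_integral_count_space_nn_integral[OF countable_classes])
    fix C
    have [measurable]: "(\<lambda>t. unfold_int (\<lambda>A. F (sqrt t *\<^sub>R app A (pair_rep C)))) \<in> borel_measurable lborel"
      by (rule measurable_unfold_int(1)) measurable
    show "(\<lambda>t. indicator {0<..1} t * ennreal (t\<^sup>2) * unfold_int (\<lambda>A. F (sqrt t *\<^sub>R app A (pair_rep C))))
      \<in> borel_measurable lborel" by measurable
  qed
  also have "\<dots> = (\<integral>\<^sup>+C. ennreal (c_lat \<Gamma>) * (\<integral>\<^sup>+q. indicator {0<..?w C} (pair_wedge q) *
      ennreal (pair_wedge q / ?w C ^ 3) * F q \<partial>lborel) \<partial>count_space ?C)"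
    using pair_rep(3) by (intro nn_integral_cong unfolding_pair) (auto simp: pos_pairs_def)
  also have "\<dots> = ennreal (c_lat \<Gamma>) * (\<integral>\<^sup>+C. (\<integral>\<^sup>+q. indicator {0<..?w C} (pair_wedge q) *
      ennreal (pair_wedge q / ?w C ^ 3) * F q \<partial>lborel) \<partial>count_space ?C)"
    by (rule nn_integral_cmult) simp
  also have "(\<integral>\<^sup>+C. (\<integral>\<^sup>+q. indicator {0<..?w C} (pair_wedge q) *
      ennreal (pair_wedge q / ?w C ^ 3) * F q \<partial>lborel) \<partial>count_space ?C) = 
    (\<integral>\<^sup>+q. (\<integral>\<^sup>+C. indicator {0<..?w C} (pair_wedge q) *
      ennreal (pair_wedge q / ?w C ^ 3) * F q \<partial>count_space ?C) \<partial>lborel)"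
    by (rule nn_integral_count_space_nn_integral[OF countable_classes, symmetric]) measurable
  also have "\<dots> = (\<integral>\<^sup>+q. indicator {0<..} (pair_wedge q) * ennreal (pair_wedge q) * class_sum (pair_wedge q) * F q \<partial>lborel)"
  proof (rule nn_integral_cong)
    fix q
    have "(\<integral>\<^sup>+C. indicator {0<..?w C} (pair_wedge q) * ennreal (pair_wedge q / ?w C ^ 3) * F q \<partial>count_space ?C)
      = (\<integral>\<^sup>+C. (indicator {0<..} (pair_wedge q) * ennreal (pair_wedge q) * F q) *
       (indicator {pair_wedge q..} (?w C) * ennreal (1 / ?w C ^ 3)) \<partial>count_space ?C)"
    proof (rule nn_integral_cong)
      fix C assume "C \<in> space (count_space ?C)"
      then have w: "?w C > 0" using pair_rep(3)[of C] by (simp add: pos_pairs_def)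
      have "ennreal (pair_wedge q / ?w C ^ 3) = ennreal (pair_wedge q) * ennreal (1 / ?w C ^ 3)"
        using w by (subst ennreal_mult''[symmetric]) auto
      then show "indicator {0<..?w C} (pair_wedge q) * ennreal (pair_wedge q / ?w C ^ 3) * F q =
        (indicator {0<..} (pair_wedge q) * ennreal (pair_wedge q) * F q) *
       (indicator {pair_wedge q..} (?w C) * ennreal (1 / ?w C ^ 3))"
        by (simp add: indicator_def mult_ac)
    qed
    also have "\<dots> = (indicator {0<..} (pair_wedge q) * ennreal (pair_wedge q) * F q) * class_sum (pair_wedge q)"
      unfolding class_sum_def by (rule nn_integral_cmult) simp
    finally show "(\<integral>\<^sup>+C. indicator {0<..?w C} (pair_wedge q) * ennreal (pair_wedge q / ?w C ^ 3) * F q \<partial>count_space ?C)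
      = indicator {0<..} (pair_wedge q) * ennreal (pair_wedge q) * class_sum (pair_wedge q) * F q"
      by (simp only: mult_ac)
  qed
  finally show ?thesis .
qed

text \<open>Since \<open>- I \<in> \<Gamma>\<close>, the reflection \<open>(x, y) \<mapsto> (x, - y)\<close> exchanges positive and negative pairs.\<close>

lemma pair_integral_neg:
  assumes [measurable]: "F \<in> borel_measurable borel"
  shows "pair_integral neg_pairs F = ennreal (c_lat \<Gamma>) *
    (\<integral>\<^sup>+q. indicator {..<0} (pair_wedge q) * ennreal \<bar>pair_wedge q\<bar> * class_sum \<bar>pair_wedge q\<bar> * F q \<partial>lborel)"
proof -
  define \<sigma> where "\<sigma> q = (fst q, - snd q)" for q :: "(real^2) \<times> (real^2)"
  have [measurable]: "\<sigma> \<in> borel_measurable borel" unfolding \<sigma>_def[abs_def] by measurable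
  have \<sigma>: "\<sigma> (\<sigma> q) = q" "pair_wedge (\<sigma> q) = - pair_wedge q" "c *\<^sub>R app A (\<sigma> q) = \<sigma> (c *\<^sub>R app A q)" for q c A
    by (simp_all add: \<sigma>_def pair_wedge_def app_def mat_vec_uminus)
  have mem: "\<sigma> q \<in> \<Lambda>1 \<times> \<Lambda>2" if "q \<in> \<Lambda>1 \<times> \<Lambda>2" for q
    using that orbit_uminus[OF O2] by (auto simp: \<sigma>_def)
  have bij: "bij_betw \<sigma> pos_pairs neg_pairs"
    by (rule bij_betwI[of _ _ _ \<sigma>]) (use mem in \<open>auto simp: pos_pairs_def neg_pairs_def \<sigma>\<close>)
  have "pair_integral neg_pairs F = pair_integral pos_pairs (\<lambda>q. F (\<sigma> q))"
    unfolding pair_integral_def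
    using nn_integral_bij_count_space[OF bij, of "\<lambda>p. F (c *\<^sub>R app A p)" for c A]
    by (simp add: \<sigma>(3))
  also have "\<dots> = ennreal (c_lat \<Gamma>) * (\<integral>\<^sup>+q. indicator {0<..} (pair_wedge q) * ennreal (pair_wedge q) * class_sum (pair_wedge q) * F (\<sigma> q) \<partial>lborel)"
    by (rule pair_integral_pos) measurable
  also have "(\<integral>\<^sup>+q. indicator {0<..} (pair_wedge q) * ennreal (pair_wedge q) * class_sum (pair_wedge q) * F (\<sigma> q) \<partial>lborel)
    = (\<integral>\<^sup>+q. indicator {..<0} (pair_wedge (\<sigma> q)) * ennreal \<bar>pair_wedge (\<sigma> q)\<bar> * class_sum \<bar>pair_wedge (\<sigma> q)\<bar> * F (\<sigma> q) \<partial>lborel)"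
    by (intro nn_integral_cong) (auto simp: \<sigma> indicator_def)
  also have "\<dots> = (\<integral>\<^sup>+q. indicator {..<0} (pair_wedge q) * ennreal \<bar>pair_wedge q\<bar> * class_sum \<bar>pair_wedge q\<bar> * F q \<partial>lborel)"
    using nn_integral_lborel_pair_linear[of
      "\<lambda>q. indicator {..<0} (pair_wedge q) * ennreal \<bar>pair_wedge q\<bar> * class_sum \<bar>pair_wedge q\<bar> * F q" 1 "-1" 0 0]
    by (simp add: \<sigma>_def)
  finally show ?thesis .
qed

lemma pair_integral_null:
  fixes f :: "(real^2) \<times> (real^2) \<Rightarrow> real"
  assumes [measurable]: "f \<in> borel_measurable borel" and nonneg: "\<And>p. 0 \<le> f p"
    and bdd: "bounded (range f)" "bounded {p. f p \<noteq> 0}"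
  shows "pair_integral null_pairs (\<lambda>p. ennreal (f p)) =
    (if \<Lambda>1 = \<Lambda>2 then ennreal (c_lat \<Gamma> / 2) * (\<integral>\<^sup>+x. ennreal (f (x, - x) + f (x, x)) \<partial>lborel) else 0)"
proof (cases "\<Lambda>1 = \<Lambda>2")
  case False
  have "null_pairs = {}"
  proof (rule ccontr)
    assume "null_pairs \<noteq> {}"
    then obtain x y where "x \<in> \<Lambda>1" "y \<in> \<Lambda>2" "wedge x y = 0" by (auto simp: null_pairs_def pair_wedge_def)
    then have "y = x \<or> y = - x" using orbit_parallel[OF O1 O2] by blast
    then have "x \<in> \<Lambda>2" using \<open>y \<in> \<Lambda>2\<close> orbit_uminus[OF O2, of y] by auto
    then show False using orbit_eq[OF O1 \<open>x \<in> \<Lambda>1\<close>] orbit_eq[OF O2 \<open>x \<in> \<Lambda>2\<close>] False by simp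
  qed
  then show ?thesis using False by (simp add: pair_integral_def nn_integral_empty)
next
  case True
  have null: "null_pairs = (\<lambda>x. (x, - x)) ` \<Lambda>1 \<union> (\<lambda>x. (x, x)) ` \<Lambda>1"
  proof (intro equalityI subsetI)
    fix p assume "p \<in> null_pairs"
    then have "fst p \<in> \<Lambda>1" "snd p \<in> \<Lambda>2" "wedge (fst p) (snd p) = 0"
      by (auto simp: null_pairs_def pair_wedge_def)
    then show "p \<in> (\<lambda>x. (x, - x)) ` \<Lambda>1 \<union> (\<lambda>x. (x, x)) ` \<Lambda>1"
      using orbit_parallel[OF O1 O2, of "fst p" "snd p"] by (cases p) auto
  next
    fix p assume "p \<in> (\<lambda>x. (x, - x)) ` \<Lambda>1 \<union> (\<lambda>x. (x, x)) ` \<Lambda>1"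
    then obtain x where "x \<in> \<Lambda>1" "p = (x, - x) \<or> p = (x, x)" by auto
    moreover from this have "x \<in> \<Lambda>2" "- x \<in> \<Lambda>2" using orbit_uminus[OF O1, of x] True by simp_all
    ultimately show "p \<in> null_pairs" by (elim disjE) (simp_all add: null_pairs_def pair_wedge_def)
  qed
  have disj: "(\<lambda>x. (x, - x)) ` \<Lambda>1 \<inter> (\<lambda>x. (x, x)) ` \<Lambda>1 = {}"
  proof -
    have "x = 0" if "- x = x" for x :: "real^2" using that by (simp add: vec2_eq_iff)
    then show ?thesis using orbit_nonzero[OF O1] by fastforce
  qed
  define h where "h x = f (x, - x) + f (x, x)" for x
  have [measurable]: "h \<in> borel_measurable borel" unfolding h_def[abs_def] by measurable
  obtain M where M: "\<And>p. \<bar>f p\<bar> \<le> M" using bdd(1) by (auto simp: bounded_iff)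
  obtain R where R: "\<And>p. f p \<noteq> 0 \<Longrightarrow> norm p \<le> R" using bdd(2) by (auto simp: bounded_iff)
  have hM: "\<bar>h x\<bar> \<le> 2 * M" for x using M[of "(x, x)"] M[of "(x, - x)"] by (simp add: h_def)
  have hR: "norm x \<le> R" if "h x \<noteq> 0" for x
  proof -
    have "f (x, x) \<noteq> 0 \<or> f (x, - x) \<noteq> 0" using that by (auto simp: h_def)
    then have "norm (x, x) \<le> R \<or> norm (x, - x) \<le> R" using R by metis
    then show ?thesis using norm_fst_le[of x x] norm_fst_le[of x "- x"] by linarith
  qed
  have *: "ennreal t * (\<integral>\<^sup>+K. \<integral>\<^sup>+p. ennreal (f (sqrt t *\<^sub>R app (sec K) p)) \<partial>count_space null_pairs \<partial>\<mu>) =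
    ennreal (c_lat \<Gamma>) * (\<integral>\<^sup>+x. ennreal (h x) \<partial>lborel)" if t: "t > 0" for t
  proof -
    have "(\<integral>\<^sup>+p. ennreal (f (sqrt t *\<^sub>R app A p)) \<partial>count_space null_pairs) =
      (\<integral>\<^sup>+x. ennreal (h (sqrt t *\<^sub>R (A *v x))) \<partial>count_space \<Lambda>1)" for A
    proof -
      have "bij_betw (\<lambda>x. (x, - x)) \<Lambda>1 ((\<lambda>x. (x, - x)) ` \<Lambda>1)" "bij_betw (\<lambda>x. (x, x)) \<Lambda>1 ((\<lambda>x. (x, x)) ` \<Lambda>1)"
        by (auto simp: bij_betw_def inj_on_def)
      then show ?thesis unfolding null nn_integral_count_space_Un[OF disj]
        by (simp add: nn_integral_bij_count_space[symmetric] nn_integral_add[symmetric] h_def app_def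
            mat_vec_uminus nonneg ennreal_plus)
    qed
    then have "(\<integral>\<^sup>+K. \<integral>\<^sup>+p. ennreal (f (sqrt t *\<^sub>R app (sec K) p)) \<partial>count_space null_pairs \<partial>\<mu>) =
      (\<integral>\<^sup>+K. \<integral>\<^sup>+x. ennreal (h (sqrt t *\<^sub>R (sec K *v x))) \<partial>count_space \<Lambda>1 \<partial>\<mu>)" by simp
    also have "\<dots> = ennreal (c_lat \<Gamma>) * (\<integral>\<^sup>+x. ennreal (h (sqrt t *\<^sub>R x)) \<partial>lborel)"
    proof (rule veech_formula[OF O1])
      show "(\<lambda>x. h (sqrt t *\<^sub>R x)) \<in> borel_measurable borel" by measurable
      show "0 \<le> h (sqrt t *\<^sub>R x)" for x using nonneg by (simp add: h_def)
      show "bounded (range (\<lambda>x. h (sqrt t *\<^sub>R x)))" using hM by (auto simp: bounded_iff)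
      have "norm x \<le> R / sqrt t" if "h (sqrt t *\<^sub>R x) \<noteq> 0" for x
        using hR[OF that] t by (simp add: field_simps)
      then show "bounded {x. h (sqrt t *\<^sub>R x) \<noteq> 0}" unfolding bounded_iff by blast
    qed
    finally have "ennreal t * (\<integral>\<^sup>+K. \<integral>\<^sup>+p. ennreal (f (sqrt t *\<^sub>R app (sec K) p)) \<partial>count_space null_pairs \<partial>\<mu>) =
      ennreal (c_lat \<Gamma>) * (ennreal t * (\<integral>\<^sup>+x. ennreal (h (sqrt t *\<^sub>R x)) \<partial>lborel))" by (simp add: mult_ac)
    also have "ennreal t * (\<integral>\<^sup>+x. ennreal (h (sqrt t *\<^sub>R x)) \<partial>lborel) = (\<integral>\<^sup>+x. ennreal (h x) \<partial>lborel)"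
      using nn_integral_lborel_affine[of "\<lambda>x. ennreal (h x)" "sqrt t" 0] t by simp
    finally show ?thesis .
  qed
  have "pair_integral null_pairs (\<lambda>p. ennreal (f p)) =
    (\<integral>\<^sup>+t. (ennreal t * indicator {0..1} t) * (ennreal (c_lat \<Gamma>) * (\<integral>\<^sup>+x. ennreal (h x) \<partial>lborel)) \<partial>lborel)"
    unfolding pair_integral_def
  proof (rule nn_integral_cong)
    fix t :: real
    show "indicator {0<..1} t * ennreal (t\<^sup>2) * (\<integral>\<^sup>+K. \<integral>\<^sup>+p. ennreal (f (sqrt t *\<^sub>R app (sec K) p)) \<partial>count_space null_pairs \<partial>\<mu>)
      = (ennreal t * indicator {0..1} t) * (ennreal (c_lat \<Gamma>) * (\<integral>\<^sup>+x. ennreal (h x) \<partial>lborel))"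
    proof (cases "t > 0")
      case True
      then have "ennreal (t\<^sup>2) = ennreal t * ennreal t" by (simp add: power2_eq_square ennreal_mult')
      moreover have "indicator {0..1} t = (indicator {0<..1} t :: ennreal)" using True by (simp add: indicator_def)
      ultimately show ?thesis unfolding *[OF True, symmetric] by (simp only: mult_ac)
    qed (auto simp: indicator_def)
  qed
  also have "\<dots> = (\<integral>\<^sup>+t. ennreal t * indicator {0..1} t \<partial>lborel) * (ennreal (c_lat \<Gamma>) * (\<integral>\<^sup>+x. ennreal (h x) \<partial>lborel))"
    by (rule nn_integral_multc) measurable
  also have "(\<integral>\<^sup>+t. ennreal t * indicator {0..1} t \<partial>lborel) = ennreal (1\<^sup>2 / 2 - 0\<^sup>2 / (2::real))"
    by (rule nn_integral_FTC_Icc) (auto intro!: derivative_eq_intros)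
  also have "\<dots> * (ennreal (c_lat \<Gamma>) * (\<integral>\<^sup>+x. ennreal (h x) \<partial>lborel)) = ennreal (c_lat \<Gamma> / 2) * (\<integral>\<^sup>+x. ennreal (h x) \<partial>lborel)"
    using c_lat_window(1) by (subst mult.assoc[symmetric], subst ennreal_mult'[symmetric]) auto
  finally show ?thesis using True by (simp add: h_def)
qed

lemma pair_integral_all:
  fixes f :: "(real^2) \<times> (real^2) \<Rightarrow> real"
  assumes f[measurable]: "f \<in> borel_measurable borel" and nonneg: "\<And>p. 0 \<le> f p"
    and bdd: "bounded (range f)" "bounded {p. f p \<noteq> 0}"
  shows "pair_integral (\<Lambda>1 \<times> \<Lambda>2) (\<lambda>p. ennreal (f p)) =
    (if \<Lambda>1 = \<Lambda>2 then ennreal (c_lat \<Gamma> / 2) * (\<integral>\<^sup>+x. ennreal (f (x, - x) + f (x, x)) \<partial>lborel) else 0) +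
    ennreal (c_lat \<Gamma>) * (\<integral>\<^sup>+q. ennreal \<bar>pair_wedge q\<bar> * class_sum \<bar>pair_wedge q\<bar> * ennreal (f q) \<partial>lborel)"
proof -
  have add: "pair_integral (D \<union> D') F = pair_integral D F + pair_integral D' F"
    if D: "D \<inter> D' = {}" "D \<union> D' \<subseteq> \<Lambda>1 \<times> \<Lambda>2" and [measurable]: "F \<in> borel_measurable borel" for D D' F
  proof -
    have c: "countable D" "countable D'" using D(2) by (auto intro: countable_subset[OF _ countable_pairs])
    have [measurable]: "(\<lambda>z. \<integral>\<^sup>+p. F (sqrt (fst z) *\<^sub>R app (sec (snd z)) p) \<partial>count_space X) \<in> borel_measurable (lborel \<Otimes>\<^sub>M \<mu>)"
      if "countable X" for X
      by (rule borel_measurable_nn_integral_countable[OF that]) measurable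
    have 1[measurable]: "(\<lambda>K. \<integral>\<^sup>+p. F (sqrt t *\<^sub>R app (sec K) p) \<partial>count_space X) \<in> borel_measurable \<mu>"
      if "countable X" for X t
      by (rule borel_measurable_nn_integral_countable[OF that]) measurable
    have 2[measurable]: "(\<lambda>t. \<integral>\<^sup>+K. \<integral>\<^sup>+p. F (sqrt t *\<^sub>R app (sec K) p) \<partial>count_space X \<partial>\<mu>) \<in> borel_measurable lborel"
      if "countable X" for X
      by (rule mu.borel_measurable_nn_integral) (use that in \<open>simp add: case_prod_beta'\<close>)
    show ?thesis
      unfolding pair_integral_def nn_integral_count_space_Un[OF D(1)]
      using c by (simp add: nn_integral_add distrib_left)
  qed
  have u: "\<Lambda>1 \<times> \<Lambda>2 = null_pairs \<union> (pos_pairs \<union> neg_pairs)"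
    by (auto simp: null_pairs_def pos_pairs_def neg_pairs_def)
  have "pair_integral (\<Lambda>1 \<times> \<Lambda>2) (\<lambda>p. ennreal (f p)) = pair_integral null_pairs (\<lambda>p. ennreal (f p)) +
     (pair_integral pos_pairs (\<lambda>p. ennreal (f p)) + pair_integral neg_pairs (\<lambda>p. ennreal (f p)))"
  proof -
    have d: "null_pairs \<inter> (pos_pairs \<union> neg_pairs) = {}" "pos_pairs \<inter> neg_pairs = {}"
      by (auto simp: null_pairs_def pos_pairs_def neg_pairs_def)
    have s: "null_pairs \<union> (pos_pairs \<union> neg_pairs) \<subseteq> \<Lambda>1 \<times> \<Lambda>2" "pos_pairs \<union> neg_pairs \<subseteq> \<Lambda>1 \<times> \<Lambda>2"
      using u by auto
    have m: "(\<lambda>p. ennreal (f p)) \<in> borel_measurable borel" by measurable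
    show ?thesis using add[OF d(1) s(1) m] add[OF d(2) s(2) m] unfolding u[symmetric] by simp
  qed
  also have "pair_integral pos_pairs (\<lambda>p. ennreal (f p)) + pair_integral neg_pairs (\<lambda>p. ennreal (f p)) =
    ennreal (c_lat \<Gamma>) * (\<integral>\<^sup>+q. ennreal \<bar>pair_wedge q\<bar> * class_sum \<bar>pair_wedge q\<bar> * ennreal (f q) \<partial>lborel)"
  proof -
    let ?p = "\<lambda>q. indicator {0<..} (pair_wedge q) * ennreal (pair_wedge q) * class_sum (pair_wedge q) * ennreal (f q)"
    let ?n = "\<lambda>q. indicator {..<0} (pair_wedge q) * ennreal \<bar>pair_wedge q\<bar> * class_sum \<bar>pair_wedge q\<bar> * ennreal (f q)"
    have m: "(\<lambda>p. ennreal (f p)) \<in> borel_measurable borel" by measurable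
    have "(\<integral>\<^sup>+q. ?p q \<partial>lborel) + (\<integral>\<^sup>+q. ?n q \<partial>lborel) = (\<integral>\<^sup>+q. ?p q + ?n q \<partial>lborel)"
      by (rule nn_integral_add[symmetric]) measurable
    also have "\<dots> = (\<integral>\<^sup>+q. ennreal \<bar>pair_wedge q\<bar> * class_sum \<bar>pair_wedge q\<bar> * ennreal (f q) \<partial>lborel)"
    proof (rule nn_integral_cong)
      fix q
      show "?p q + ?n q = ennreal \<bar>pair_wedge q\<bar> * class_sum \<bar>pair_wedge q\<bar> * ennreal (f q)"
        by (cases "pair_wedge q" "0 :: real" rule: linorder_cases) simp_all
    qed
    finally show ?thesis
      unfolding pair_integral_pos[OF m] pair_integral_neg[OF m] distrib_left[symmetric] by simp
  qed
  finally show ?thesis by (simp add: pair_integral_null[OF assms])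
qed

end

end

section \<open>The cone\<close>

lemma summable_on_finite_support:
  fixes f :: "'a \<Rightarrow> real"
  assumes "finite {x \<in> A. f x \<noteq> 0}"
  shows "f summable_on A" "infsum f A = sum f {x \<in> A. f x \<noteq> 0}"
proof -
  have "f summable_on {x \<in> A. f x \<noteq> 0}" using assms by simp
  then show "f summable_on A" by (subst summable_on_cong_neutral) auto
  have "infsum f A = infsum f {x \<in> A. f x \<noteq> 0}" by (rule infsum_cong_neutral) auto
  then show "infsum f A = sum f {x \<in> A. f x \<noteq> 0}" using assms by simp
qed

lemma summable_on_count_space:
  fixes f :: "'a \<Rightarrow> real"
  assumes "\<And>x. x \<in> A \<Longrightarrow> 0 \<le> f x" "(\<integral>\<^sup>+x. ennreal (f x) \<partial>count_space A) < \<infinity>"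
  shows "f summable_on A"
proof -
  have "(\<integral>\<^sup>+x. ennreal (norm (f x)) \<partial>count_space A) = (\<integral>\<^sup>+x. ennreal (f x) \<partial>count_space A)"
    using assms(1) by (intro nn_integral_cong) simp
  then have "integrable (count_space A) f" using assms(2) by (intro integrableI_bounded) auto
  then have "Infinite_Set_Sum.abs_summable_on f A" by (simp add: Infinite_Set_Sum.abs_summable_on_def)
  then have "Infinite_Sum.abs_summable_on f A" by (rule iffD2[OF abs_summable_equivalent])
  then show ?thesis using summable_on_iff_abs_summable_on_real by blast
qed

context lattice_neg
begin

definition cone_sec :: "(real^2^2) set \<Rightarrow> real^2^2" where
  "cone_sec = (SOME s. s \<in> coset_borel det_cone \<Gamma> \<rightarrow>\<^sub>M borel \<and> (\<forall>K \<in> coset \<Gamma> ` det_cone. s K \<in> K))"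

lemma cone_sec: "cone_sec \<in> coset_borel det_cone \<Gamma> \<rightarrow>\<^sub>M borel" "K \<in> coset \<Gamma> ` det_cone \<Longrightarrow> cone_sec K \<in> K"
proof -
  have "det A \<noteq> 0" if "A \<in> det_cone" for A using that by (simp add: det_cone_def)
  moreover have "A ** \<gamma> \<in> det_cone" if "A \<in> det_cone" "\<gamma> \<in> \<Gamma>" for A \<gamma>
    using that by (simp add: det_cone_def det_mul det_mem)
  ultimately obtain s where "s \<in> coset_borel det_cone \<Gamma> \<rightarrow>\<^sub>M borel" "\<And>K. K \<in> coset \<Gamma> ` det_cone \<Longrightarrow> s K \<in> K"
    using borel_section[of det_cone] by blast
  then have "\<exists>s. s \<in> coset_borel det_cone \<Gamma> \<rightarrow>\<^sub>M borel \<and> (\<forall>K \<in> coset \<Gamma> ` det_cone. s K \<in> K)" by blast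
  from someI_ex[OF this] show "cone_sec \<in> coset_borel det_cone \<Gamma> \<rightarrow>\<^sub>M borel" "K \<in> coset \<Gamma> ` det_cone \<Longrightarrow> cone_sec K \<in> K"
    unfolding cone_sec_def by auto
qed

lemma cone_coset:
  assumes "K \<in> coset \<Gamma> ` det_cone" "A \<in> K"
  shows "K = coset \<Gamma> A" "0 < det A" "det A \<le> 1"
proof -
  obtain B where B: "B \<in> det_cone" "K = coset \<Gamma> B" using assms by auto
  then show "K = coset \<Gamma> A" using coset_eq assms by simp
  show "0 < det A" "det A \<le> 1" using B assms by (auto simp: mem_coset det_mul det_mem det_cone_def)
qed

lemma sets_cone_measure: "sets (cone_measure \<Gamma> \<mu>) = sets (coset_borel det_cone \<Gamma>)"
  by (simp add: cone_measure_def)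

lemma space_cone_measure: "space (cone_measure \<Gamma> \<mu>) = coset \<Gamma> ` det_cone"
  using sets_eq_imp_space_eq[OF sets_cone_measure] by (simp add: space_coset_borel)

lemma scale_coset: "(\<lambda>g. c *\<^sub>R g) ` coset \<Gamma> A = coset \<Gamma> (c *\<^sub>R A)"
proof -
  have "c *\<^sub>R (A ** \<gamma>) = (c *\<^sub>R A) ** \<gamma>" for \<gamma> :: "real^2^2"
    by (simp add: mat2_eq_iff mat2_mult_nth distrib_left)
  then show ?thesis by (simp add: coset_def image_image)
qed

lemma measurable_cone_map:
  "(\<lambda>(\<nu>, K). (\<lambda>g. sqrt \<nu> *\<^sub>R g) ` K) \<in> restrict_space lborel {0<..1::real} \<Otimes>\<^sub>M \<mu> \<rightarrow>\<^sub>M coset_borel det_cone \<Gamma>"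
proof -
  let ?M = "restrict_space lborel {0<..1::real} \<Otimes>\<^sub>M \<mu>"
  have [measurable]: "(\<lambda>\<nu>. sqrt \<nu>) \<in> borel_measurable (restrict_space lborel {0<..1::real})"
    by (rule measurable_restrict_space1) simp
  have sp: "0 < fst p" "fst p \<le> 1" "snd p \<in> space \<mu>" if "p \<in> space ?M" for p
    using that by (auto simp: space_pair_measure space_restrict_space)
  have "(\<lambda>p. sqrt (fst p) *\<^sub>R sec (snd p)) \<in> ?M \<rightarrow>\<^sub>M restrict_space borel det_cone"
  proof (rule measurable_restrict_space2)
    show "(\<lambda>p. sqrt (fst p) *\<^sub>R sec (snd p)) \<in> space ?M \<rightarrow> det_cone"
      using sp by (auto simp: det_cone_def det_scaleR2 sec_space less_imp_le)
  qed measurable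
  from measurable_compose[OF this measurable_coset]
  have m: "(\<lambda>p. coset \<Gamma> (sqrt (fst p) *\<^sub>R sec (snd p))) \<in> ?M \<rightarrow>\<^sub>M coset_borel det_cone \<Gamma>" .
  have e: "coset \<Gamma> (sqrt (fst p) *\<^sub>R sec (snd p)) = (\<lambda>(\<nu>, K). (\<lambda>g. sqrt \<nu> *\<^sub>R g) ` K) p"
    if "p \<in> space ?M" for p
    using sec_space(3)[OF sp(3)[OF that]] scale_coset[of "sqrt (fst p)" "sec (snd p)"]
    unfolding case_prod_beta by metis
  show ?thesis by (rule iffD1[OF measurable_cong[OF e] m])
qed

lemma nn_integral_cone_measure:
  assumes [measurable]: "\<phi> \<in> borel_measurable (coset_borel det_cone \<Gamma>)"
  shows "(\<integral>\<^sup>+K. \<phi> K \<partial>cone_measure \<Gamma> \<mu>) =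
    (\<integral>\<^sup>+t. (\<integral>\<^sup>+K. \<phi> (coset \<Gamma> (sqrt t *\<^sub>R sec K)) \<partial>\<mu>) * indicator {0<..1} t \<partial>lborel)"
proof -
  let ?R = "restrict_space lborel {0<..1::real}"
  let ?m = "\<lambda>(\<nu>, K). (\<lambda>g. sqrt \<nu> *\<^sub>R g) ` K"
  note [measurable] = measurable_cone_map
  have "(\<integral>\<^sup>+K. \<phi> K \<partial>cone_measure \<Gamma> \<mu>) = (\<integral>\<^sup>+p. \<phi> (?m p) \<partial>(?R \<Otimes>\<^sub>M \<mu>))"
    unfolding cone_measure_def by (rule nn_integral_distr) measurable
  also have "\<dots> = (\<integral>\<^sup>+t. \<integral>\<^sup>+K. \<phi> (?m (t, K)) \<partial>\<mu> \<partial>?R)"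
    by (rule mu.nn_integral_fst[symmetric]) measurable
  also have "\<dots> = (\<integral>\<^sup>+t. \<integral>\<^sup>+K. \<phi> (coset \<Gamma> (sqrt t *\<^sub>R sec K)) \<partial>\<mu> \<partial>?R)"
    using sec_space(3) scale_coset by (intro nn_integral_cong) (metis case_prod_conv)
  also have "\<dots> = (\<integral>\<^sup>+t. (\<integral>\<^sup>+K. \<phi> (coset \<Gamma> (sqrt t *\<^sub>R sec K)) \<partial>\<mu>) * indicator {0<..1} t \<partial>lborel)"
    by (rule nn_integral_restrict_space) simp
  finally show ?thesis .
qed

lemma finite_measure_cone: "finite_measure (cone_measure \<Gamma> \<mu>)"
proof (rule finite_measureI)
  have "emeasure (cone_measure \<Gamma> \<mu>) (space (cone_measure \<Gamma> \<mu>)) = (\<integral>\<^sup>+K. 1 \<partial>cone_measure \<Gamma> \<mu>)" by simp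
  also have "\<dots> = (\<integral>\<^sup>+t. (\<integral>\<^sup>+K. 1 \<partial>\<mu>) * indicator {0<..1::real} t \<partial>lborel)"
    by (rule nn_integral_cone_measure) simp
  also have "\<dots> = 1" by (simp add: emeasure_space_mu)
  finally show "emeasure (cone_measure \<Gamma> \<mu>) (space (cone_measure \<Gamma> \<mu>)) \<noteq> \<infinity>" by simp
qed

definition test_function :: "((real^2) \<times> (real^2) \<Rightarrow> real) \<Rightarrow> bool" where
  "test_function f \<longleftrightarrow> f \<in> borel_measurable borel \<and> bounded (range f) \<and> bounded {p. f p \<noteq> 0}"

context
  fixes \<Lambda>1 \<Lambda>2 assumes O1: "scaled_orbit \<Lambda>1" and O2: "scaled_orbit \<Lambda>2"
begin

lemma theta_bound:
  assumes f: "test_function f"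
  obtains B where "\<And>A. 0 < det A \<Longrightarrow> det A \<le> 1 \<Longrightarrow> finite {p \<in> \<Lambda>1 \<times> \<Lambda>2. f (app A p) \<noteq> 0}"
    "\<And>A. 0 < det A \<Longrightarrow> det A \<le> 1 \<Longrightarrow> \<bar>\<Sum>\<^sub>\<infinity>p\<in>\<Lambda>1 \<times> \<Lambda>2. f (app A p)\<bar> * (det A)\<^sup>2 \<le> B"
proof -
  obtain M where M: "\<And>p. \<bar>f p\<bar> \<le> M" using f by (auto simp: bounded_iff test_function_def)
  then have "M \<ge> 0" by (meson abs_ge_zero order_trans)
  obtain R where R: "R > 0" "\<And>p. f p \<noteq> 0 \<Longrightarrow> norm p \<le> R" using f
    by (auto simp: bounded_pos test_function_def)
  let ?X = "\<lambda>\<Lambda> (A :: real^2^2). {x \<in> \<Lambda>. norm (A *v x) \<le> R}"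
  obtain C1 where C1: "C1 > 0" "\<And>A. 0 < det A \<Longrightarrow> det A \<le> 1 \<Longrightarrow> finite (?X \<Lambda>1 A) \<and> real (card (?X \<Lambda>1 A)) \<le> C1 / det A"
    using orbit_count_bound[OF O1 R(1)] by blast
  obtain C2 where C2: "C2 > 0" "\<And>A. 0 < det A \<Longrightarrow> det A \<le> 1 \<Longrightarrow> finite (?X \<Lambda>2 A) \<and> real (card (?X \<Lambda>2 A)) \<le> C2 / det A"
    using orbit_count_bound[OF O2 R(1)] by blast
  have sub: "{p \<in> \<Lambda>1 \<times> \<Lambda>2. f (app A p) \<noteq> 0} \<subseteq> ?X \<Lambda>1 A \<times> ?X \<Lambda>2 A" for A
  proof
    fix p assume "p \<in> {p \<in> \<Lambda>1 \<times> \<Lambda>2. f (app A p) \<noteq> 0}"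
    then have p: "p \<in> \<Lambda>1 \<times> \<Lambda>2" "norm (app A p) \<le> R" using R by auto
    have "norm (A *v fst p) \<le> R" "norm (A *v snd p) \<le> R"
      using p(2) norm_fst_le[of "A *v fst p" "A *v snd p"] norm_snd_le[of "A *v snd p" "A *v fst p"]
      unfolding app_def by linarith+
    then show "p \<in> ?X \<Lambda>1 A \<times> ?X \<Lambda>2 A" using p(1) by (cases p) auto
  qed
  have fin: "finite {p \<in> \<Lambda>1 \<times> \<Lambda>2. f (app A p) \<noteq> 0}" if "0 < det A" "det A \<le> 1" for A
    by (rule finite_subset[OF sub]) (use C1(2)[OF that] C2(2)[OF that] in simp)
  show ?thesis
  proof (rule that[of "M * (C1 * C2)", OF fin])
    fix A :: "real^2^2" assume A: "0 < det A" "det A \<le> 1"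
    let ?S = "{p \<in> \<Lambda>1 \<times> \<Lambda>2. f (app A p) \<noteq> 0}"
    have "\<bar>\<Sum>\<^sub>\<infinity>p\<in>\<Lambda>1 \<times> \<Lambda>2. f (app A p)\<bar> = \<bar>\<Sum>p\<in>?S. f (app A p)\<bar>"
      using summable_on_finite_support(2)[OF fin[OF A]] by simp
    also have "\<dots> \<le> (\<Sum>p\<in>?S. \<bar>f (app A p)\<bar>)" by (rule sum_abs)
    also have "\<dots> \<le> (\<Sum>p\<in>?S. M)" using M by (intro sum_mono) auto
    also have "\<dots> = M * real (card ?S)" by simp
    also have "\<dots> \<le> M * (real (card (?X \<Lambda>1 A)) * real (card (?X \<Lambda>2 A)))"
    proof -
      have "card ?S \<le> card (?X \<Lambda>1 A \<times> ?X \<Lambda>2 A)"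
        using C1(2)[OF A] C2(2)[OF A] by (intro card_mono sub) auto
      then have "real (card ?S) \<le> real (card (?X \<Lambda>1 A) * card (?X \<Lambda>2 A))"
        unfolding card_cartesian_product by (simp only: of_nat_le_iff)
      then show ?thesis using \<open>M \<ge> 0\<close> by (intro mult_left_mono) auto
    qed
    also have "\<dots> \<le> M * ((C1 / det A) * (C2 / det A))"
      using C1(2)[OF A] C2(2)[OF A] C1(1) C2(1) A \<open>M \<ge> 0\<close> by (intro mult_left_mono mult_mono) auto
    finally have "\<bar>\<Sum>\<^sub>\<infinity>p\<in>\<Lambda>1 \<times> \<Lambda>2. f (app A p)\<bar> * (det A)\<^sup>2 \<le> M * ((C1 / det A) * (C2 / det A)) * (det A)\<^sup>2"
      by (intro mult_right_mono) auto
    also have "\<dots> = M * (C1 * C2)" using A by (simp add: power2_eq_square)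
    finally show "\<bar>\<Sum>\<^sub>\<infinity>p\<in>\<Lambda>1 \<times> \<Lambda>2. f (app A p)\<bar> * (det A)\<^sup>2 \<le> M * (C1 * C2)" .
  qed
qed

lemma theta_summable:
  fixes A :: "real^2^2"
  assumes "test_function f" "0 < det A" "det A \<le> 1"
  shows "(\<lambda>p. f (app A p)) summable_on \<Lambda>1 \<times> \<Lambda>2"
proof (rule summable_on_finite_support(1))
  show "finite {p \<in> \<Lambda>1 \<times> \<Lambda>2. f (app A p) \<noteq> 0}"
  proof (rule theta_bound[OF assms(1)])
    fix B assume "\<And>A. 0 < det A \<Longrightarrow> det A \<le> 1 \<Longrightarrow> finite {p \<in> \<Lambda>1 \<times> \<Lambda>2. f (app A p) \<noteq> 0}"
    then show ?thesis using assms(2,3) .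
  qed
qed

lemma Theta_eq: "Theta \<Lambda>1 \<Lambda>2 f K = (\<Sum>\<^sub>\<infinity>p\<in>\<Lambda>1 \<times> \<Lambda>2. f (app (rep K) p))"
  unfolding Theta_def by (intro infsum_cong) (auto simp: app_def)

lemma Theta_coset:
  assumes K: "K \<in> coset \<Gamma> ` det_cone" "A \<in> K"
  shows "Theta \<Lambda>1 \<Lambda>2 f K = (\<Sum>\<^sub>\<infinity>p\<in>\<Lambda>1 \<times> \<Lambda>2. f (app A p))" "det (rep K) = det A"
proof -
  have "rep K \<in> K" using rep_mem[OF O1 K(1)] .
  then obtain \<gamma> where g: "\<gamma> \<in> \<Gamma>" "rep K = A ** \<gamma>" using cone_coset(1)[OF K] by (metis mem_coset)
  then show "det (rep K) = det A" by (simp add: det_mul det_mem)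
  have "bij_betw (app \<gamma>) (\<Lambda>1 \<times> \<Lambda>2) (\<Lambda>1 \<times> \<Lambda>2)"
    by (rule bij_betwI[of _ _ _ "app (adj \<gamma>)"])
       (use g app_pairs[OF O1 O2] in \<open>auto simp: adj_mem app_def adj_mult_vec det_mem\<close>)
  then have "(\<Sum>\<^sub>\<infinity>p\<in>\<Lambda>1 \<times> \<Lambda>2. f (app A (app \<gamma> p))) = (\<Sum>\<^sub>\<infinity>p\<in>\<Lambda>1 \<times> \<Lambda>2. f (app A p))"
    by (rule infsum_reindex_bij_betw)
  then show "Theta \<Lambda>1 \<Lambda>2 f K = (\<Sum>\<^sub>\<infinity>p\<in>\<Lambda>1 \<times> \<Lambda>2. f (app A p))"
    by (simp add: Theta_eq g(2) app_app)
qed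

lemma theta_nonneg:
  assumes f: "test_function f" "\<And>p. 0 \<le> f p"
  defines "\<Theta> \<equiv> \<lambda>K. Theta \<Lambda>1 \<Lambda>2 f K * (det (rep K))\<^sup>2"
  shows "integrable (cone_measure \<Gamma> \<mu>) \<Theta>"
    and "(\<integral>\<^sup>+K. ennreal (\<Theta> K) \<partial>cone_measure \<Gamma> \<mu>) = pair_integral (\<Lambda>1 \<times> \<Lambda>2) (\<lambda>p. ennreal (f p))"
    and "pair_integral (\<Lambda>1 \<times> \<Lambda>2) (\<lambda>p. ennreal (f p)) < \<infinity>"
    and "\<And>K. \<Theta> K \<ge> 0"
proof -
  have [measurable]: "f \<in> borel_measurable borel" using f by (simp add: test_function_def)
  note [measurable] = cone_sec(1)
  have nn: "ennreal (\<Sum>\<^sub>\<infinity>p\<in>\<Lambda>1 \<times> \<Lambda>2. f (app A p)) = (\<integral>\<^sup>+p. ennreal (f (app A p)) \<partial>count_space (\<Lambda>1 \<times> \<Lambda>2))"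
    if "0 < det A" "det A \<le> 1" for A
    using theta_summable[OF f(1) that] f(2) by (simp add: nn_integral_count_space_infsum)
  have \<Theta>_eq: "ennreal (\<Theta> K) = (\<integral>\<^sup>+p. ennreal (f (app A p)) \<partial>count_space (\<Lambda>1 \<times> \<Lambda>2)) * ennreal ((det A)\<^sup>2)"
    if "K \<in> coset \<Gamma> ` det_cone" "A \<in> K" for K A
    unfolding \<Theta>_def Theta_coset[OF that] using nn cone_coset[OF that] by (simp add: ennreal_mult'')
  show nonneg: "\<Theta> K \<ge> 0" for K
    unfolding \<Theta>_def Theta_eq using f(2) by (simp add: infsum_nonneg)
  have [measurable]: "(\<lambda>K. \<integral>\<^sup>+p. ennreal (f (app (cone_sec K) p)) \<partial>count_space (\<Lambda>1 \<times> \<Lambda>2))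
      \<in> borel_measurable (coset_borel det_cone \<Gamma>)"
    by (intro borel_measurable_nn_integral_countable[OF countable_pairs[OF O1 O2]]) measurable
  have "(\<lambda>K. (\<integral>\<^sup>+p. ennreal (f (app (cone_sec K) p)) \<partial>count_space (\<Lambda>1 \<times> \<Lambda>2)) * ennreal ((det (cone_sec K))\<^sup>2))
      \<in> borel_measurable (coset_borel det_cone \<Gamma>)" by measurable
  then have m: "(\<lambda>K. ennreal (\<Theta> K)) \<in> borel_measurable (coset_borel det_cone \<Gamma>)"
    using \<Theta>_eq[OF _ cone_sec(2)] by (subst measurable_cong) (auto simp: space_coset_borel)
  then have "(\<lambda>K. enn2real (ennreal (\<Theta> K))) \<in> borel_measurable (coset_borel det_cone \<Gamma>)" by measurable
  then have \<Theta>_meas: "\<Theta> \<in> borel_measurable (cone_measure \<Gamma> \<mu>)"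
    using nonneg by (simp add: measurable_cong_sets[OF sets_cone_measure refl])
  obtain B where B: "\<And>A. 0 < det A \<Longrightarrow> det A \<le> 1 \<Longrightarrow> \<bar>\<Sum>\<^sub>\<infinity>p\<in>\<Lambda>1 \<times> \<Lambda>2. f (app A p)\<bar> * (det A)\<^sup>2 \<le> B"
    by (rule theta_bound[OF f(1)], rule that)
  interpret C: finite_measure "cone_measure \<Gamma> \<mu>" by (rule finite_measure_cone)
  show int: "integrable (cone_measure \<Gamma> \<mu>) \<Theta>"
  proof (rule C.integrable_const_bound[OF AE_I2 \<Theta>_meas])
    fix K assume "K \<in> space (cone_measure \<Gamma> \<mu>)"
    then have K: "K \<in> coset \<Gamma> ` det_cone" by (simp add: space_cone_measure)
    have r: "rep K \<in> K" using rep_mem[OF O1 K] .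
    show "norm (\<Theta> K) \<le> B"
      using B[OF cone_coset(2,3)[OF K r]] unfolding \<Theta>_def Theta_eq by (simp add: abs_mult)
  qed
  show eq: "(\<integral>\<^sup>+K. ennreal (\<Theta> K) \<partial>cone_measure \<Gamma> \<mu>) = pair_integral (\<Lambda>1 \<times> \<Lambda>2) (\<lambda>p. ennreal (f p))"
    unfolding nn_integral_cone_measure[OF m] pair_integral_def[OF O1 O2]
  proof (rule nn_integral_cong)
    fix t :: real
    show "(\<integral>\<^sup>+K. ennreal (\<Theta> (coset \<Gamma> (sqrt t *\<^sub>R sec K))) \<partial>\<mu>) * indicator {0<..1} t =
      indicator {0<..1} t * ennreal (t\<^sup>2) *
      (\<integral>\<^sup>+K. \<integral>\<^sup>+p. ennreal (f (sqrt t *\<^sub>R app (sec K) p)) \<partial>count_space (\<Lambda>1 \<times> \<Lambda>2) \<partial>\<mu>)"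
    proof (cases "t \<in> {0<..1}")
      case True
      have "(\<integral>\<^sup>+K. ennreal (\<Theta> (coset \<Gamma> (sqrt t *\<^sub>R sec K))) \<partial>\<mu>) =
        (\<integral>\<^sup>+K. (\<integral>\<^sup>+p. ennreal (f (sqrt t *\<^sub>R app (sec K) p)) \<partial>count_space (\<Lambda>1 \<times> \<Lambda>2)) * ennreal (t\<^sup>2) \<partial>\<mu>)"
      proof (rule nn_integral_cong)
        fix K assume K: "K \<in> space \<mu>"
        have d: "det (sqrt t *\<^sub>R sec K) = t" using True K by (simp add: det_scaleR2 sec_space)
        then have "coset \<Gamma> (sqrt t *\<^sub>R sec K) \<in> coset \<Gamma> ` det_cone" using True by (simp add: det_cone_def)
        from \<Theta>_eq[OF this self_mem_coset] show "ennreal (\<Theta> (coset \<Gamma> (sqrt t *\<^sub>R sec K))) =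
          (\<integral>\<^sup>+p. ennreal (f (sqrt t *\<^sub>R app (sec K) p)) \<partial>count_space (\<Lambda>1 \<times> \<Lambda>2)) * ennreal (t\<^sup>2)"
          unfolding d app_scaleR .
      qed
      also have "\<dots> = (\<integral>\<^sup>+K. \<integral>\<^sup>+p. ennreal (f (sqrt t *\<^sub>R app (sec K) p)) \<partial>count_space (\<Lambda>1 \<times> \<Lambda>2) \<partial>\<mu>) * ennreal (t\<^sup>2)"
        by (intro nn_integral_multc borel_measurable_nn_integral_countable[OF countable_pairs[OF O1 O2]]) measurable
      finally show ?thesis using True by (simp add: mult.commute)
    qed simp
  qed
  show "pair_integral (\<Lambda>1 \<times> \<Lambda>2) (\<lambda>p. ennreal (f p)) < \<infinity>"
    unfolding eq[symmetric] using int nonneg by (simp add: integrable_iff_bounded)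
qed

section \<open>Finiteness of the numbers of classes\<close>

abbreviation "\<S> \<equiv> class_sum \<Lambda>1 \<Lambda>2"

lemma class_sum_antimono: "s \<le> t \<Longrightarrow> \<S> t \<le> \<S> s"
  unfolding class_sum_def[OF O1 O2] by (intro nn_integral_mono mult_right_mono) (auto simp: indicator_def)

lemma class_sum_finite:
  assumes t: "t > 0" shows "\<S> t < \<infinity>"
proof (rule ccontr)
  assume "\<not> \<S> t < \<infinity>"
  then have top: "\<S> t = \<infinity>" by (metis infinity_ennreal_def top.not_eq_extremum)
  define f :: "(real^2) \<times> (real^2) \<Rightarrow> real" where "f = indicator (cball 0 2)"
  have f: "test_function f" "\<And>p. 0 \<le> f p"
  proof -
    have "f \<in> borel_measurable borel" unfolding f_def by (rule borel_measurable_indicator) simp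
    then show "test_function f"
      by (auto simp: test_function_def f_def bounded_iff indicator_def intro!: exI[of _ 1] exI[of _ 2])
  qed (simp add: f_def)
  have [measurable]: "f \<in> borel_measurable borel" using f by (simp add: test_function_def)
  let ?g = "\<lambda>q. ennreal \<bar>pair_wedge q\<bar> * \<S> \<bar>pair_wedge q\<bar> * ennreal (f q)"
  note [measurable] = measurable_class_sum[OF O1 O2]
  have "ennreal (c_lat \<Gamma>) * (\<integral>\<^sup>+q. ?g q \<partial>lborel) \<le> pair_integral (\<Lambda>1 \<times> \<Lambda>2) (\<lambda>p. ennreal (f p))"
    using pair_integral_all[OF O1 O2, of f] f by (simp add: test_function_def)
  also have "\<dots> < \<infinity>" by (rule theta_nonneg(3)[OF f])
  finally have "(\<integral>\<^sup>+q. ?g q \<partial>lborel) \<noteq> \<infinity>" using c_lat_window(1) by (auto simp: ennreal_mult_top)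
  then have AE: "AE q in lborel. ?g q \<noteq> \<infinity>" by (intro nn_integral_PInf_AE) measurable
  define U where "U = {q :: (real^2) \<times> (real^2). 0 < pair_wedge q} \<inter> {q. pair_wedge q < t} \<inter> ball 0 2"
  have "open U" unfolding U_def pair_wedge_def wedge_eq
    by (intro open_Int open_Collect_less continuous_intros open_ball)
  define e where "e = min t 1 / 2"
  have e: "0 < e" "e < t" "e < 1" using t by (auto simp: e_def)
  define q where "q = (axis 1 1 :: real^2, axis 2 e :: real^2)"
  have "norm q \<le> norm (axis 1 1 :: real^2) + norm (axis 2 e :: real^2)"
    unfolding q_def by (rule norm_Pair_le)
  also have "\<dots> \<le> 1 + e"
    using norm_le_l1_cart[of "axis 1 1 :: real^2"] norm_le_l1_cart[of "axis 2 e :: real^2"] e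
    by (simp add: sum_2 axis_def)
  also have "\<dots> < 2" using e by simp
  finally have "q \<in> U" using e by (simp add: U_def q_def pair_wedge_def wedge_eq axis_def)
  with \<open>open U\<close> have "emeasure lborel U > 0" by (rule emeasure_lborel_open_pos)
  moreover have "AE q in lborel. q \<notin> U"
    using AE
  proof eventually_elim
    fix q assume g: "?g q \<noteq> \<infinity>"
    show "q \<notin> U"
    proof
      assume q: "q \<in> U"
      then have "\<S> \<bar>pair_wedge q\<bar> = \<infinity>"
        using class_sum_antimono[of "\<bar>pair_wedge q\<bar>" t] top by (auto simp: U_def top_unique)
      moreover have "f q = 1" "pair_wedge q > 0" using q by (auto simp: U_def f_def)
      ultimately show False using g by (simp add: ennreal_mult_top)
    qed
  qed
  then have "emeasure lborel U = 0" using \<open>open U\<close>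
    by (subst (asm) AE_iff_measurable[of U]) auto
  ultimately show False by simp
qed

definition class_count :: "real \<Rightarrow> ennreal" where
  "class_count c = emeasure (count_space UNIV) (pairs_with_det \<Lambda>1 \<Lambda>2 c // pair_equiv \<Gamma> \<Lambda>1 \<Lambda>2)"

lemma class_sum_eq:
  assumes t: "t > 0"
  shows "\<S> t = (\<integral>\<^sup>+c. ennreal (1 / c ^ 3) * class_count c \<partial>count_space {c \<in> dets \<Lambda>1 \<Lambda>2 - {0}. c \<ge> t})"
proof -
  let ?N = "{c \<in> dets \<Lambda>1 \<Lambda>2 - {0}. c \<ge> t}"
  let ?E = "pair_equiv \<Gamma> \<Lambda>1 \<Lambda>2"
  let ?C = "pos_pairs \<Lambda>1 \<Lambda>2 // ?E"
  let ?w = "\<lambda>C. pair_wedge (pair_rep C)"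
  note pos = pos_pairs_def[OF O1 O2]
  have cN: "countable ?N"
  proof -
    have "dets \<Lambda>1 \<Lambda>2 = pair_wedge ` (\<Lambda>1 \<times> \<Lambda>2)" by (force simp: dets_def pair_wedge_def)
    then have "countable (dets \<Lambda>1 \<Lambda>2)" using countable_pairs[OF O1 O2] by simp
    then show ?thesis by (rule countable_subset[rotated]) auto
  qed
  have mem: "?w C \<in> ?N" if "C \<in> ?C" "?w C \<ge> t" for C
  proof -
    have "pair_rep C \<in> \<Lambda>1 \<times> \<Lambda>2" using pair_rep(3)[OF O1 O2 that(1)] by (simp add: pos)
    then have "?w C \<in> dets \<Lambda>1 \<Lambda>2" unfolding dets_def pair_wedge_def by (auto simp: mem_Times_iff)
    then show ?thesis using that(2) t by simp
  qed
  have "\<S> t = (\<integral>\<^sup>+C. \<integral>\<^sup>+c. ennreal (1 / c ^ 3) * indicator {c} (?w C) \<partial>count_space ?N \<partial>count_space ?C)"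
    unfolding class_sum_def[OF O1 O2]
  proof (rule nn_integral_cong)
    fix C assume "C \<in> space (count_space ?C)"
    then have C: "C \<in> ?C" by simp
    show "indicator {t..} (?w C) * ennreal (1 / ?w C ^ 3) =
      (\<integral>\<^sup>+c. ennreal (1 / c ^ 3) * indicator {c} (?w C) \<partial>count_space ?N)"
    proof (cases "?w C \<ge> t")
      case True
      then show ?thesis
        using mem[OF C] by (subst nn_integral_count_space'[of "{?w C}"]) (auto simp: indicator_def)
    next
      case False
      then have "(\<integral>\<^sup>+c. ennreal (1 / c ^ 3) * indicator {c} (?w C) \<partial>count_space ?N) = (\<integral>\<^sup>+c. 0 \<partial>count_space ?N)"
        by (intro nn_integral_cong) (auto simp: indicator_def)
      then show ?thesis using False by simp
    qed
  qed
  also have "\<dots> = (\<integral>\<^sup>+c. \<integral>\<^sup>+C. ennreal (1 / c ^ 3) * indicator {c} (?w C) \<partial>count_space ?C \<partial>count_space ?N)"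
    by (rule nn_integral_count_space_nn_integral[OF cN]) simp
  also have "\<dots> = (\<integral>\<^sup>+c. ennreal (1 / c ^ 3) * class_count c \<partial>count_space ?N)"
  proof (rule nn_integral_cong)
    fix c assume "c \<in> space (count_space ?N)"
    then have c: "c > 0" using t by simp
    have "{C \<in> ?C. ?w C = c} = pairs_with_det \<Lambda>1 \<Lambda>2 c // ?E"
    proof (intro equalityI subsetI)
      fix C assume C: "C \<in> {C \<in> ?C. ?w C = c}"
      then have "pair_rep C \<in> pos_pairs \<Lambda>1 \<Lambda>2" "C = ?E `` {pair_rep C}" using pair_rep[OF O1 O2] by auto
      moreover from this have "pair_rep C \<in> pairs_with_det \<Lambda>1 \<Lambda>2 c"
        using C by (auto simp: pairs_with_det_def pos pair_wedge_def)
      ultimately show "C \<in> pairs_with_det \<Lambda>1 \<Lambda>2 c // ?E" by (metis quotientI)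
    next
      fix C assume "C \<in> pairs_with_det \<Lambda>1 \<Lambda>2 c // ?E"
      then obtain p where p: "p \<in> pairs_with_det \<Lambda>1 \<Lambda>2 c" "C = ?E `` {p}" by (auto simp: quotient_def)
      then have "p \<in> pos_pairs \<Lambda>1 \<Lambda>2" "pair_wedge p = c" using c by (auto simp: pairs_with_det_def pos pair_wedge_def)
      moreover from this have C: "C \<in> ?C" using p by (auto intro: quotientI)
      moreover have "(p, pair_rep C) \<in> ?E" using pair_rep(1)[OF O1 O2 C] p by auto
      ultimately show "C \<in> {C \<in> ?C. ?w C = c}" using pair_equiv_wedge[OF O1 O2] by auto
    qed
    moreover have "(\<integral>\<^sup>+C. indicator {c} (?w C) \<partial>count_space ?C) = emeasure (count_space UNIV) {C \<in> ?C. ?w C = c}"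
    proof -
      have "(\<integral>\<^sup>+C. indicator {c} (?w C) \<partial>count_space ?C) = (\<integral>\<^sup>+C. indicator {c} (?w C) * indicator ?C C \<partial>count_space UNIV)"
        by (rule nn_integral_count_space_indicator) simp
      also have "\<dots> = (\<integral>\<^sup>+C. indicator {C \<in> ?C. ?w C = c} C \<partial>count_space UNIV)"
        by (intro nn_integral_cong) (auto simp: indicator_def)
      finally show ?thesis by simp
    qed
    ultimately show "(\<integral>\<^sup>+C. ennreal (1 / c ^ 3) * indicator {c} (?w C) \<partial>count_space ?C) = ennreal (1 / c ^ 3) * class_count c"
      by (simp add: nn_integral_cmult class_count_def)
  qed
  finally show ?thesis .
qed

lemma finite_classes_pos:
  assumes c: "c > 0" shows "finite (pairs_with_det \<Lambda>1 \<Lambda>2 c // pair_equiv \<Gamma> \<Lambda>1 \<Lambda>2)"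
proof (cases "c \<in> dets \<Lambda>1 \<Lambda>2")
  case False
  then have "pairs_with_det \<Lambda>1 \<Lambda>2 c = {}" by (auto simp: pairs_with_det_def dets_def)
  then show ?thesis by (simp add: quotient_def)
next
  case True
  have "ennreal (1 / c ^ 3) * class_count c = (\<integral>\<^sup>+x. ennreal (1 / x ^ 3) * class_count x * indicator {c} x \<partial>count_space {x \<in> dets \<Lambda>1 \<Lambda>2 - {0}. x \<ge> c})"
    using True c by (subst nn_integral_count_space'[of "{c}"]) auto
  also have "\<dots> \<le> \<S> c" unfolding class_sum_eq[OF c] by (intro nn_integral_mono) (auto simp: indicator_def)
  also have "\<dots> < \<infinity>" by (rule class_sum_finite[OF c])
  finally have "class_count c < \<infinity>"
    using c by (cases "class_count c = \<infinity>") (auto simp: ennreal_mult_top less_top)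
  then show ?thesis unfolding class_count_def
    using emeasure_count_space_infinite[OF subset_UNIV] by (metis infinity_ennreal_def less_irrefl)
qed

lemma finite_classes:
  assumes c: "c \<noteq> 0" shows "finite (pairs_with_det \<Lambda>1 \<Lambda>2 c // pair_equiv \<Gamma> \<Lambda>1 \<Lambda>2)"
proof (cases "c > 0")
  case False
  define \<sigma> where "\<sigma> q = (fst q, - snd q)" for q :: "(real^2) \<times> (real^2)"
  let ?E = "pair_equiv \<Gamma> \<Lambda>1 \<Lambda>2"
  have \<sigma>: "\<sigma> (\<sigma> q) = q" for q by (simp add: \<sigma>_def)
  have P: "\<sigma> q \<in> pairs_with_det \<Lambda>1 \<Lambda>2 (- d)" if "q \<in> pairs_with_det \<Lambda>1 \<Lambda>2 d" for q d
    using that orbit_uminus[OF O2] by (auto simp: \<sigma>_def pairs_with_det_def)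
  have E: "(\<sigma> p, \<sigma> q) \<in> ?E" if pq: "(p, q) \<in> ?E" for p q
  proof -
    obtain \<gamma> where g: "p \<in> \<Lambda>1 \<times> \<Lambda>2" "q \<in> \<Lambda>1 \<times> \<Lambda>2" "\<gamma> \<in> \<Gamma>" "p = app \<gamma> q"
      using pq unfolding pair_equiv_iff[OF O1 O2] by metis
    have "\<sigma> p = app \<gamma> (\<sigma> q)" using g(4) by (simp add: app_def \<sigma>_def mat_vec_uminus)
    moreover have "\<sigma> r \<in> \<Lambda>1 \<times> \<Lambda>2" if "r \<in> \<Lambda>1 \<times> \<Lambda>2" for r
      using that orbit_uminus[OF O2, of "snd r"] by (cases r) (simp add: \<sigma>_def)
    ultimately show ?thesis unfolding pair_equiv_iff[OF O1 O2] using g by blast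
  qed
  have "pairs_with_det \<Lambda>1 \<Lambda>2 c // ?E \<subseteq> (\<lambda>C. \<sigma> ` C) ` (pairs_with_det \<Lambda>1 \<Lambda>2 (- c) // ?E)"
  proof
    fix C assume "C \<in> pairs_with_det \<Lambda>1 \<Lambda>2 c // ?E"
    then obtain p where p: "p \<in> pairs_with_det \<Lambda>1 \<Lambda>2 c" "C = ?E `` {p}" by (auto simp: quotient_def)
    have "C = \<sigma> ` (?E `` {\<sigma> p})"
    proof (intro equalityI subsetI)
      fix q assume "q \<in> C"
      then have "\<sigma> q \<in> ?E `` {\<sigma> p}" using E p by auto
      then show "q \<in> \<sigma> ` (?E `` {\<sigma> p})" using \<sigma>[of q] by (metis imageI)
    next
      fix q assume "q \<in> \<sigma> ` (?E `` {\<sigma> p})"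
      then obtain r where "(\<sigma> p, r) \<in> ?E" "q = \<sigma> r" by auto
      then have "(p, q) \<in> ?E" using E[of "\<sigma> p" r] \<sigma>[of p] by simp
      then show "q \<in> C" using p by simp
    qed
    then show "C \<in> (\<lambda>C. \<sigma> ` C) ` (pairs_with_det \<Lambda>1 \<Lambda>2 (- c) // ?E)"
      using P[OF p(1)] by (intro image_eqI[of _ _ "?E `` {\<sigma> p}"] quotientI) auto
  qed
  moreover have "finite (pairs_with_det \<Lambda>1 \<Lambda>2 (- c) // ?E)" using False c by (intro finite_classes_pos) simp
  ultimately show ?thesis by (meson finite_imageI finite_subset)
qed (rule finite_classes_pos)

lemma class_sum_num_classes:
  assumes t: "t > 0"
  defines "N \<equiv> {c \<in> dets \<Lambda>1 \<Lambda>2 - {0}. c \<ge> t}"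
  shows "(\<lambda>c. real (num_classes \<Gamma> \<Lambda>1 \<Lambda>2 c) / c ^ 3) summable_on N"
    and "(\<Sum>\<^sub>\<infinity>c\<in>N. real (num_classes \<Gamma> \<Lambda>1 \<Lambda>2 c) / c ^ 3) = enn2real (\<S> t)"
proof -
  let ?a = "\<lambda>c. real (num_classes \<Gamma> \<Lambda>1 \<Lambda>2 c) / c ^ 3"
  have nonneg: "0 \<le> ?a c" if "c \<in> N" for c using that t by (auto simp: N_def)
  have eq: "(\<integral>\<^sup>+c. ennreal (?a c) \<partial>count_space N) = \<S> t"
    unfolding class_sum_eq[OF t] N_def[symmetric]
  proof (rule nn_integral_cong)
    fix c assume "c \<in> space (count_space N)"
    then have c: "c > 0" using t by (auto simp: N_def)
    have "class_count c = ennreal (real (num_classes \<Gamma> \<Lambda>1 \<Lambda>2 c))"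
      using finite_classes_pos[OF c] by (simp add: class_count_def num_classes_def ennreal_of_nat_eq_real_of_nat)
    then show "ennreal (?a c) = ennreal (1 / c ^ 3) * class_count c"
      using c by (simp add: ennreal_mult'[symmetric])
  qed
  show s: "?a summable_on N"
    by (rule summable_on_count_space[OF nonneg]) (use eq class_sum_finite[OF t] in auto)
  then have "\<S> t = ennreal (infsum ?a N)" unfolding eq[symmetric] using nonneg by (intro nn_integral_count_space_infsum)
  then show "infsum ?a N = enn2real (\<S> t)" using nonneg by (simp add: infsum_nonneg)
qed

definition weight :: "(real^2) \<times> (real^2) \<Rightarrow> real" where
  "weight q = \<bar>pair_wedge q\<bar> * enn2real (\<S> \<bar>pair_wedge q\<bar>)"

lemma Psi_weight: "Psi \<Gamma> \<Lambda>1 \<Lambda>2 \<bar>pair_wedge q\<bar> = weight q - c_lat \<Gamma>"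
  using class_sum_num_classes(2)[of "\<bar>pair_wedge q\<bar>"]
  by (cases "pair_wedge q = 0") (simp_all add: Psi_def weight_def)

lemma measurable_weight [measurable]: "weight \<in> borel_measurable borel"
  using measurable_class_sum[OF O1 O2] unfolding weight_def[abs_def] by measurable

lemma ennreal_weight: "ennreal (weight q) = ennreal \<bar>pair_wedge q\<bar> * \<S> \<bar>pair_wedge q\<bar>"
  using class_sum_finite[of "\<bar>pair_wedge q\<bar>"]
  by (cases "pair_wedge q = 0") (simp_all add: weight_def ennreal_mult')

section \<open>The mean value formula\<close>

definition mean_value_formula :: "((real^2) \<times> (real^2) \<Rightarrow> real) \<Rightarrow> bool" where
  "mean_value_formula f \<longleftrightarrow>
     integrable (cone_measure \<Gamma> \<mu>) (\<lambda>K. Theta \<Lambda>1 \<Lambda>2 f K * (det (rep K))\<^sup>2) \<and>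
     integrable lborel (\<lambda>q. weight q * f q) \<and>
     integrable lborel (\<lambda>x. f (x, - x) + f (x, x)) \<and>
     (\<integral>K. Theta \<Lambda>1 \<Lambda>2 f K * (det (rep K))\<^sup>2 \<partial>cone_measure \<Gamma> \<mu>) =
       (if \<Lambda>1 = \<Lambda>2 then c_lat \<Gamma> / 2 * (\<integral>x. f (x, - x) + f (x, x) \<partial>lborel) else 0)
       + c_lat \<Gamma> * (\<integral>q. weight q * f q \<partial>lborel)"

lemma integrable_diagonal:
  assumes f: "test_function f" shows "integrable lborel (\<lambda>x. f (x, - x) + f (x, x))"
proof -
  have [measurable]: "f \<in> borel_measurable borel" using f by (simp add: test_function_def)
  obtain M where M: "\<And>p. \<bar>f p\<bar> \<le> M" using f by (auto simp: bounded_iff test_function_def)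
  obtain R where R: "\<And>p. f p \<noteq> 0 \<Longrightarrow> norm p \<le> R" using f by (auto simp: bounded_iff test_function_def)
  have D: "integrable lborel (\<lambda>x. f (x, s *\<^sub>R x))" for s
  proof (rule integrable_bounded_support)
    show "(\<lambda>x. f (x, s *\<^sub>R x)) \<in> borel_measurable borel" by measurable
    show "bounded (range (\<lambda>x. f (x, s *\<^sub>R x)))" using M by (auto simp: bounded_iff)
    have "norm x \<le> R" if "f (x, s *\<^sub>R x) \<noteq> 0" for x using R[OF that] norm_fst_le[of x "s *\<^sub>R x"] by linarith
    then show "bounded {x. f (x, s *\<^sub>R x) \<noteq> 0}" by (auto simp: bounded_iff)
  qed
  show ?thesis using Bochner_Integration.integrable_add[OF D[of "-1"] D[of 1]] by simp
qed

lemma mean_value_formula_nonneg: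
  assumes f: "test_function f" "\<And>p. 0 \<le> f p"
  shows "mean_value_formula f"
proof -
  let ?\<Theta> = "\<lambda>K. Theta \<Lambda>1 \<Lambda>2 f K * (det (rep K))\<^sup>2"
  let ?h = "\<lambda>x. f (x, - x) + f (x, x)"
  have [measurable]: "f \<in> borel_measurable borel" using f by (simp add: test_function_def)
  have w0: "0 \<le> weight q" for q by (simp add: weight_def)
  let ?W = "\<integral>\<^sup>+q. ennreal (weight q * f q) \<partial>lborel"
  have h: "(\<integral>\<^sup>+x. ennreal (?h x) \<partial>lborel) = ennreal (\<integral>x. ?h x \<partial>lborel)"
    using integrable_diagonal[OF f(1)] f(2) by (intro nn_integral_eq_integral) auto
  have all: "pair_integral (\<Lambda>1 \<times> \<Lambda>2) (\<lambda>p. ennreal (f p)) =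
    (if \<Lambda>1 = \<Lambda>2 then ennreal (c_lat \<Gamma> / 2) * ennreal (\<integral>x. ?h x \<partial>lborel) else 0) + ennreal (c_lat \<Gamma>) * ?W"
  proof -
    have "?W = (\<integral>\<^sup>+q. ennreal \<bar>pair_wedge q\<bar> * \<S> \<bar>pair_wedge q\<bar> * ennreal (f q) \<partial>lborel)"
      using w0 by (intro nn_integral_cong) (simp add: ennreal_mult' ennreal_weight)
    moreover have m: "f \<in> borel_measurable borel" and b: "bounded (range f)" "bounded {p. f p \<noteq> 0}"
      using f(1) by (auto simp: test_function_def)
    ultimately show ?thesis using pair_integral_all[OF O1 O2 m f(2) b] unfolding h by simp
  qed
  have "ennreal (c_lat \<Gamma>) * ?W \<le> pair_integral (\<Lambda>1 \<times> \<Lambda>2) (\<lambda>p. ennreal (f p))" unfolding all by simp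
  also have "\<dots> < \<infinity>" by (rule theta_nonneg(3)[OF f])
  finally have W: "?W < \<infinity>"
    using c_lat_window(1) by (cases "?W = \<infinity>") (auto simp: less_top ennreal_mult_top)
  have int: "integrable lborel (\<lambda>q. weight q * f q)"
    using W f(2) w0 by (intro integrableI_nonneg) auto
  then have We: "?W = ennreal (\<integral>q. weight q * f q \<partial>lborel)"
    using f(2) w0 by (intro nn_integral_eq_integral) auto
  have i0: "0 \<le> (\<integral>x. ?h x \<partial>lborel)" "0 \<le> (\<integral>q. weight q * f q \<partial>lborel)"
    using f(2) w0 by (auto intro!: Bochner_Integration.integral_nonneg)
  let ?R = "(if \<Lambda>1 = \<Lambda>2 then c_lat \<Gamma> / 2 * (\<integral>x. ?h x \<partial>lborel) else 0) + c_lat \<Gamma> * (\<integral>q. weight q * f q \<partial>lborel)"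
  have "ennreal (\<integral>K. ?\<Theta> K \<partial>cone_measure \<Gamma> \<mu>) = (\<integral>\<^sup>+K. ennreal (?\<Theta> K) \<partial>cone_measure \<Gamma> \<mu>)"
    using theta_nonneg(1,4)[OF f] by (intro nn_integral_eq_integral[symmetric]) auto
  also have "\<dots> = ennreal ?R"
  proof -
    have e: "ennreal a * ennreal b = ennreal (a * b)" if "0 \<le> a" for a b
      using that by (simp add: ennreal_mult')
    have "0 \<le> c_lat \<Gamma> / 2" "0 \<le> c_lat \<Gamma>" using c_lat_window(1) by simp_all
    then show ?thesis
      unfolding theta_nonneg(2)[OF f] all We e[OF \<open>0 \<le> c_lat \<Gamma> / 2\<close>] e[OF \<open>0 \<le> c_lat \<Gamma>\<close>]
      using i0 by (cases "\<Lambda>1 = \<Lambda>2") (simp_all only: if_True if_False refl ennreal_plus mult_nonneg_nonneg add_0)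
  qed
  finally have "(\<integral>K. ?\<Theta> K \<partial>cone_measure \<Gamma> \<mu>) = ?R"
    using i0 c_lat_window(1) theta_nonneg(4)[OF f]
    by (subst (asm) ennreal_inj) (auto intro!: Bochner_Integration.integral_nonneg add_nonneg_nonneg)
  then show ?thesis unfolding mean_value_formula_def
    using theta_nonneg(1)[OF f] int integrable_diagonal[OF f(1)] by simp
qed

lemma mean_value_formula_test_function:
  assumes f: "test_function f"
  shows "mean_value_formula f"
proof -
  define u where "u p = max (f p) 0" for p
  define v where "v p = max (- f p) 0" for p
  have fuv: "f p = u p - v p" for p by (simp add: u_def v_def)
  have [measurable]: "f \<in> borel_measurable borel" using f by (simp add: test_function_def)
  obtain M where M: "\<And>p. \<bar>f p\<bar> \<le> M" using f by (auto simp: bounded_iff test_function_def)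
  have bs: "bounded {p. f p \<noteq> 0}" using f by (simp add: test_function_def)
  have "\<bar>u p\<bar> \<le> M" "\<bar>v p\<bar> \<le> M" for p using M[of p] by (auto simp: u_def v_def)
  then have "bounded (range u)" "bounded (range v)" by (auto simp: bounded_iff)
  moreover have "bounded {p. u p \<noteq> 0}" "bounded {p. v p \<noteq> 0}"
    by (rule bounded_subset[OF bs], force simp: u_def v_def)+
  moreover have "u \<in> borel_measurable borel" "v \<in> borel_measurable borel" unfolding u_def[abs_def] v_def[abs_def] by measurable
  ultimately have t: "test_function u" "test_function v"
    by (simp_all add: test_function_def)
  have U: "mean_value_formula u" by (rule mean_value_formula_nonneg[OF t(1)]) (simp add: u_def)
  have V: "mean_value_formula v" by (rule mean_value_formula_nonneg[OF t(2)]) (simp add: v_def)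
  let ?\<Theta> = "\<lambda>f K. Theta \<Lambda>1 \<Lambda>2 f K * (det (rep K))\<^sup>2"
  let ?h = "\<lambda>f x. f (x, - x) + f (x, x) :: real"
  have th: "?\<Theta> f K = ?\<Theta> u K - ?\<Theta> v K" if "K \<in> space (cone_measure \<Gamma> \<mu>)" for K
  proof -
    have K: "K \<in> coset \<Gamma> ` det_cone" using that by (simp add: space_cone_measure)
    note d = cone_coset(2,3)[OF K rep_mem[OF O1 K]]
    have "infsum (\<lambda>p. u (app (rep K) p) + - v (app (rep K) p)) (\<Lambda>1 \<times> \<Lambda>2) =
      infsum (\<lambda>p. u (app (rep K) p)) (\<Lambda>1 \<times> \<Lambda>2) + infsum (\<lambda>p. - v (app (rep K) p)) (\<Lambda>1 \<times> \<Lambda>2)"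
      using theta_summable[OF t(1) d] theta_summable[OF t(2) d]
      by (intro infsum_add) (simp_all add: summable_on_uminus)
    then show ?thesis unfolding Theta_eq fuv by (simp add: infsum_uminus left_diff_distrib)
  qed
  have hh: "?h f x = ?h u x - ?h v x" for x by (simp add: fuv)
  have ww: "weight q * f q = weight q * u q - weight q * v q" for q by (simp add: fuv right_diff_distrib)
  have 1: "integrable (cone_measure \<Gamma> \<mu>) (?\<Theta> f)" "(\<integral>K. ?\<Theta> f K \<partial>cone_measure \<Gamma> \<mu>) = (\<integral>K. ?\<Theta> u K \<partial>cone_measure \<Gamma> \<mu>) - (\<integral>K. ?\<Theta> v K \<partial>cone_measure \<Gamma> \<mu>)"
    using U V unfolding mean_value_formula_def
    by (simp_all cong: Bochner_Integration.integrable_cong Bochner_Integration.integral_cong add: th)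
  have 2: "integrable lborel (\<lambda>q. weight q * f q)"
    "(\<integral>q. weight q * f q \<partial>lborel) = (\<integral>q. weight q * u q \<partial>lborel) - (\<integral>q. weight q * v q \<partial>lborel)"
    using U V unfolding mean_value_formula_def ww by simp_all
  have 3: "(\<integral>x. ?h f x \<partial>lborel) = (\<integral>x. ?h u x \<partial>lborel) - (\<integral>x. ?h v x \<partial>lborel)"
    using integrable_diagonal[OF t(1)] integrable_diagonal[OF t(2)] unfolding hh by (intro Bochner_Integration.integral_diff)
  show ?thesis
    unfolding mean_value_formula_def 1(2) 2(2) 3
    using 1(1) 2(1) integrable_diagonal[OF f] U V unfolding mean_value_formula_def
    by (simp add: algebra_simps)
qed

end

end

lemma semicontinuous_borel:
  fixes f :: "'a::topological_space \<Rightarrow> real"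
  assumes "lower_semicontinuous f \<or> upper_semicontinuous f"
  shows "f \<in> borel_measurable borel"
  using assms
proof
  assume "lower_semicontinuous f"
  then show ?thesis unfolding lower_semicontinuous_def borel_measurable_iff_greater
    by (auto intro!: borel_open)
next
  assume "upper_semicontinuous f"
  then show ?thesis unfolding upper_semicontinuous_def borel_measurable_iff_less
    by (auto intro!: borel_open)
qed

theorem theorem1p8:
  fixes \<Gamma> :: "(real^2^2) set"
    and \<mu> :: "(real^2^2) set measure"
    and \<Lambda>1 \<Lambda>2 :: "(real^2) set"
    and f :: "(real^2) \<times> (real^2) \<Rightarrow> real"
  assumes "is_lattice \<Gamma>" and "nonuniform \<Gamma>" and "- mat 1 \<in> \<Gamma>"
    and "invariant_prob \<Gamma> \<mu>"
    and "discrete_orbit \<Gamma> \<Lambda>1" and "scaled \<Gamma> \<mu> \<Lambda>1"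
    and "discrete_orbit \<Gamma> \<Lambda>2" and "scaled \<Gamma> \<mu> \<Lambda>2"
    and "bounded (range f)" and "compact_support f"
    and "lower_semicontinuous f \<or> upper_semicontinuous f"
  shows "(\<forall>K \<in> coset \<Gamma> ` det_cone.
            (\<lambda>(x, y). f (rep K *v x, rep K *v y)) summable_on \<Lambda>1 \<times> \<Lambda>2)
    \<and> (\<forall>c \<in> dets \<Lambda>1 \<Lambda>2 - {0}. finite (pairs_with_det \<Lambda>1 \<Lambda>2 c // pair_equiv \<Gamma> \<Lambda>1 \<Lambda>2))
    \<and> (\<forall>t>0. (\<lambda>c. real (num_classes \<Gamma> \<Lambda>1 \<Lambda>2 c) / c ^ 3)
            summable_on {c \<in> dets \<Lambda>1 \<Lambda>2 - {0}. c \<ge> t})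
    \<and> integrable (cone_measure \<Gamma> \<mu>) (\<lambda>K. Theta \<Lambda>1 \<Lambda>2 f K * (det (rep K))\<^sup>2)
    \<and> integrable lborel (\<lambda>(x, y). Psi \<Gamma> \<Lambda>1 \<Lambda>2 \<bar>wedge x y\<bar> * f (x, y))
    \<and> (\<integral>K. Theta \<Lambda>1 \<Lambda>2 f K * (det (rep K))\<^sup>2 \<partial>cone_measure \<Gamma> \<mu>)
      = (c_lat \<Gamma>)\<^sup>2 * (\<integral>p. f p \<partial>lborel)
        + (if homothetic \<Lambda>1 \<Lambda>2 then 1 else 0) * c_lat \<Gamma> / 2
            * (\<integral>x. f (x, - x) + f (x, x) \<partial>lborel)
        + c_lat \<Gamma> * (\<integral>(x, y). Psi \<Gamma> \<Lambda>1 \<Lambda>2 \<bar>wedge x y\<bar> * f (x, y) \<partial>lborel)"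
proof -
  interpret lattice_neg \<Gamma> \<mu>
    by (intro lattice_neg.intro lattice_measure.intro discrete_subgroup.intro
        lattice_measure_axioms.intro lattice_neg_axioms.intro)
       (use assms(1,3,4) in \<open>simp_all add: is_lattice_def\<close>)
  have O1: "scaled_orbit \<Lambda>1" and O2: "scaled_orbit \<Lambda>2"
    using assms(5-8) by (simp_all add: scaled_orbit_def)
  have f: "test_function f"
    using assms(9-11) semicontinuous_borel by (simp add: test_function_def compact_support_bounded)
  then have fi: "integrable lborel f"
    by (intro integrable_bounded_support) (auto simp: test_function_def)
  let ?w = "weight \<Lambda>1 \<Lambda>2"
  have P: "(\<lambda>(x, y). Psi \<Gamma> \<Lambda>1 \<Lambda>2 \<bar>wedge x y\<bar> * f (x, y)) = (\<lambda>q. ?w q * f q - c_lat \<Gamma> * f q)"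
    using Psi_weight[OF O1 O2] by (auto simp: fun_eq_iff pair_wedge_def left_diff_distrib)
  have F: "integrable (cone_measure \<Gamma> \<mu>) (\<lambda>K. Theta \<Lambda>1 \<Lambda>2 f K * (det (rep K))\<^sup>2)"
    "integrable lborel (\<lambda>q. ?w q * f q)"
    "(\<integral>K. Theta \<Lambda>1 \<Lambda>2 f K * (det (rep K))\<^sup>2 \<partial>cone_measure \<Gamma> \<mu>) =
       (if \<Lambda>1 = \<Lambda>2 then c_lat \<Gamma> / 2 * (\<integral>x. f (x, - x) + f (x, x) \<partial>lborel) else 0)
       + c_lat \<Gamma> * (\<integral>q. ?w q * f q \<partial>lborel)"
    using mean_value_formula_test_function[OF O1 O2 f] unfolding mean_value_formula_def[OF O1 O2] by auto
  have PI: "integrable lborel (\<lambda>(x, y). Psi \<Gamma> \<Lambda>1 \<Lambda>2 \<bar>wedge x y\<bar> * f (x, y))"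
    "(\<integral>(x, y). Psi \<Gamma> \<Lambda>1 \<Lambda>2 \<bar>wedge x y\<bar> * f (x, y) \<partial>lborel) =
       (\<integral>q. ?w q * f q \<partial>lborel) - c_lat \<Gamma> * (\<integral>q. f q \<partial>lborel)"
    unfolding P using F(2) fi by simp_all
  have "(\<lambda>(x, y). f (rep K *v x, rep K *v y)) summable_on \<Lambda>1 \<times> \<Lambda>2" if K: "K \<in> coset \<Gamma> ` det_cone" for K
    using theta_summable[OF O1 O2 f cone_coset(2,3)[OF K rep_mem[OF O1 K]]] by (simp add: app_def case_prod_beta')
  moreover have "finite (pairs_with_det \<Lambda>1 \<Lambda>2 c // pair_equiv \<Gamma> \<Lambda>1 \<Lambda>2)" if "c \<in> dets \<Lambda>1 \<Lambda>2 - {0}" for c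
    using finite_classes[OF O1 O2] that by blast
  moreover have "(\<lambda>c. real (num_classes \<Gamma> \<Lambda>1 \<Lambda>2 c) / c ^ 3) summable_on {c \<in> dets \<Lambda>1 \<Lambda>2 - {0}. c \<ge> t}"
    if "t > 0" for t
    using class_sum_num_classes(1)[OF O1 O2 that] .
  moreover have "(\<integral>K. Theta \<Lambda>1 \<Lambda>2 f K * (det (rep K))\<^sup>2 \<partial>cone_measure \<Gamma> \<mu>)
      = (c_lat \<Gamma>)\<^sup>2 * (\<integral>p. f p \<partial>lborel)
        + (if homothetic \<Lambda>1 \<Lambda>2 then 1 else 0) * c_lat \<Gamma> / 2
            * (\<integral>x. f (x, - x) + f (x, x) \<partial>lborel)
        + c_lat \<Gamma> * (\<integral>(x, y). Psi \<Gamma> \<Lambda>1 \<Lambda>2 \<bar>wedge x y\<bar> * f (x, y) \<partial>lborel)"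
    unfolding F(3) PI(2) homothetic_orbits[OF O1 O2] by (simp add: power2_eq_square algebra_simps)
  ultimately show ?thesis using F(1) PI(1) by blast
qed

end
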